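(* Let $n\ge2$, $0\le m\le n-2$, $r\ge1$, and let $\mathcal T_h$ be a conforming simplicial mesh of a bounded domain $\Omega\subset\mathbb R^n$. For each $f\in\Delta_\ell(\mathcal T_h)$ with $\ell\le m$ choose $n-\ell$ linearly independent normal vectors $\boldsymbol n_1^f,\dots,\boldsymbol n_{n-\ell}^f$ of $f$ (depending only on $f$), and for each $F\in\Delta_{n-1}(\mathcal T_h)$ choose a normal vector $\boldsymbol n_F$. Then the degrees of freedom (DoFs) (a) $\boldsymbol A(\mathtt v)\in\mathbb T$, for $\mathtt v\in\Delta_0(\mathcal T_h)$; (b) $\int_f(\boldsymbol A\boldsymbol n_i^f)\cdot\boldsymbol q\,\mathrm ds$, for $f\in\Delta_\ell(\mathcal T_h)$, $\boldsymbol q\in\mathbb P_{r-(\ell+1)}(f;\mathbb R^n)$, $i=1,\dots,n-\ell$, $\ell=1,\dots,m$; (c) $\int_f(\boldsymbol A\boldsymbol n_F)|_F\cdot\boldsymbol q\,\mathrm ds$, for $F\in\Delta_{n-1}(\mathcal T_h)$, $f\in\Delta_\ell(F)$, $\boldsymbol q\in\mathbb P_{r-(\ell+1)}(f;\mathbb R^n)$, $\ell=m+1,\dots,n-1$; (d) $\int_T\boldsymbol A:\boldsymbol q\,\mathrm dx$, for $T\in\mathcal T_h$, $\boldsymbol q\in\mathbb B_r(\mathrm{div},T;\mathbb T)$, determine a finite element space $V^r(\mathbb T)\subset H(\mathrm{div},\Omega;\mathbb T)$. That is, for each $T\in\mathcal T_h$ the DoFs attached to $T$ and its sub-simplices uniquely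 determine an element of $\mathbb P_r(T;\mathbb T)$ (unisolvence), and the space $$V^r(\mathbb T):=\{\boldsymbol A\in L^2(\Omega;\mathbb T):\boldsymbol A|_T\in\mathbb P_r(T;\mathbb T)\ \forall T\in\mathcal T_h,\ \text{(a),(b) single-valued across each } f\in\Delta_\ell(\mathcal T_h),\ \ell=0,\dots,m,\ \text{(c) single-valued across each } F\in\Delta_{n-1}(\mathcal T_h)\}$$ is contained in $H(\mathrm{div},\Omega;\mathbb T)$.
   Context: $\mathbb T\subset\mathbb R^{n\times n}$ is the space of trace-free matrices; $\boldsymbol A:\boldsymbol q$ is the Frobenius product. $\Delta_\ell(\cdot)$ is the set of $\ell$-dimensional sub-simplices; a mesh is conforming if any two simplices intersect in the empty set or a common sub-simplex. A normal vector of $f$ is a (unit) vector orthogonal to the tangent plane of $f$. $\mathbb P_r(f;V)$ is the space of $V$-valued polynomials of degree $\le r$ on $f$ ($\{0\}$ if $r<0$). $H(\mathrm{div},\Omega;\mathbb T)=\{\boldsymbol A\in L^2(\Omega;\mathbb T):\mathrm{div}\boldsymbol A\in L^2(\Omega;\mathbb R^n)\}$ with row-wise divergence. $\mathbb B_r(\mathrm{div},T;\mathbb T)=\{\boldsymbol A\in\mathbb P_r(T;\mathbb T):\boldsymbol A\boldsymbol n=0\text{ on }\partial T\}$, $\boldsymbol n$ the unit normal on $\partial T$. A DoF is single-valued across $f$ (or $F$) if its values computed from $\boldsymbol A|_T$ and $\boldsymbol A|_{T'}$ coincide for all $T,T'\in\mathcal T_h$ containing $f$ (or $F$). *)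

theory Defs
  imports "HOL-Analysis.Analysis"
begin

section \<open>Simplices and meshes\<close>

text \<open>The ambient space is \<^typ>\<open>real^'n\<close> with $n$ = \<^term>\<open>CARD('n)\<close>; matrices are
  \<^typ>\<open>real^'n^'n\<close>, whose \<^const>\<open>inner\<close> is the Frobenius product.\<close>

definition subsimplices :: "nat \<Rightarrow> 'a::euclidean_space set \<Rightarrow> 'a set set" where
  "subsimplices l T = {f. f face_of T \<and> (int l) simplex f}"

definition mesh_subsimplices :: "nat \<Rightarrow> 'a::euclidean_space set set \<Rightarrow> 'a set set" where
  "mesh_subsimplices l \<T> = (\<Union>T\<in>\<T>. subsimplices l T)"

definition bounded_domain :: "'a::euclidean_space set \<Rightarrow> bool" where
  "bounded_domain \<Omega> \<longleftrightarrow> open \<Omega> \<and> connected \<Omega> \<and> bounded \<Omega> \<and> \<Omega> \<noteq> {}"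

text \<open>Conformity is part of \<^const>\<open>triangulation\<close>: for all \<open>T\<close>, \<open>T'\<close> in the mesh, \<open>T \<inter> T'\<close> is a
  (possibly empty) face of \<open>T\<close>, and by symmetry of \<open>T'\<close>.\<close>

definition conforming_mesh :: "'a::euclidean_space set \<Rightarrow> 'a set set \<Rightarrow> bool" where
  "conforming_mesh \<Omega> \<T> \<longleftrightarrow>
     triangulation \<T> \<and> (\<forall>T\<in>\<T>. int DIM('a) simplex T) \<and> \<Union>\<T> = closure \<Omega>"

definition tangent_space :: "'a::euclidean_space set \<Rightarrow> 'a set" where
  "tangent_space f = span {x - y | x y. x \<in> f \<and> y \<in> f}"

text \<open>Normal vectors need not be normalised; unit normals are a special case.\<close>

definition normal_vector :: "'a::euclidean_space set \<Rightarrow> 'a \<Rightarrow> bool" where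
  "normal_vector f \<nu> \<longleftrightarrow> \<nu> \<noteq> 0 \<and> (\<forall>t\<in>tangent_space f. \<nu> \<bullet> t = 0)"

text \<open>The measure $\mathrm ds$: Lebesgue measure on the affine hull of \<open>f\<close>, transported by an
  isometric parametrisation \<open>t \<mapsto> a + (\<Sum>b\<in>B. t b *\<^sub>R b)\<close> with \<open>B\<close> an orthonormal basis of the
  tangent space; it depends neither on \<open>a\<close> nor on \<open>B\<close>. Compare the definition of \<^const>\<open>lborel\<close>.\<close>

definition surface_measure :: "'a::euclidean_space set \<Rightarrow> 'a measure" where
  "surface_measure f =
    (let a = (SOME a. a \<in> f);
         B = (SOME B. pairwise orthogonal B \<and> (\<forall>b\<in>B. norm b = 1) \<and> span B = tangent_space f)
     in distr (\<Pi>\<^sub>M b\<in>B. lborel) borel (\<lambda>t. a + (\<Sum>b\<in>B. t b *\<^sub>R b)))"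

section \<open>Polynomial spaces\<close>

text \<open>The degree bound is an integer, so that only the zero polynomial has degree at most \<open>k < 0\<close>.\<close>

definition poly_deg_le :: "int \<Rightarrow> (real^'n \<Rightarrow> 'b::real_vector) \<Rightarrow> bool" where
  "poly_deg_le k p \<longleftrightarrow>
    (\<exists>c :: ('n \<Rightarrow> nat) \<Rightarrow> 'b. \<forall>x.
       p x = (\<Sum>\<alpha> | int (\<Sum>i\<in>UNIV. \<alpha> i) \<le> k. (\<Prod>i\<in>UNIV. (x $ i) ^ \<alpha> i) *\<^sub>R c \<alpha>))"

text \<open>Functions on \<open>f\<close> are represented by their extension by zero, so that equality in
  \<open>poly_space k f V\<close> is equality on \<open>f\<close>.\<close>

definition poly_space :: "int \<Rightarrow> (real^'n) set \<Rightarrow> 'b::real_vector set \<Rightarrow> (real^'n \<Rightarrow> 'b) set" where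
  "poly_space k f V = {(\<lambda>x. if x \<in> f then p x else 0) | p. poly_deg_le k p \<and> (\<forall>x\<in>f. p x \<in> V)}"

definition trace_free :: "(real^'n^'n) set" where
  "trace_free = {A. trace A = 0}"

text \<open>The boundary condition is imposed for both unit normals of each facet: the condition
  \<open>A n = 0\<close> does not depend on the orientation of \<open>n\<close>.\<close>

definition div_bubbles :: "int \<Rightarrow> (real^'n) set \<Rightarrow> (real^'n \<Rightarrow> real^'n^'n) set" where
  "div_bubbles k T = {A \<in> poly_space k T trace_free.
     \<forall>F\<in>subsimplices (CARD('n) - 1) T. \<forall>\<nu>. norm \<nu> = 1 \<and> normal_vector F \<nu> \<longrightarrow>
       (\<forall>x\<in>F. A x *v \<nu> = 0)}"

section \<open>The space H(div)\<close>

definition L2_space :: "'a::euclidean_space set \<Rightarrow> 'b::euclidean_space set \<Rightarrow> ('a \<Rightarrow> 'b) set" where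
  "L2_space \<Omega> V = {A. A \<in> borel_measurable (lebesgue_on \<Omega>) \<and>
     integrable (lebesgue_on \<Omega>) (\<lambda>x. (norm (A x))\<^sup>2) \<and> (AE x in lebesgue_on \<Omega>. A x \<in> V)}"

definition partial_deriv :: "'n::finite \<Rightarrow> (real^'n \<Rightarrow> real) \<Rightarrow> real^'n \<Rightarrow> real" where
  "partial_deriv i \<phi> x = frechet_derivative \<phi> (at x) (axis i 1)"

definition gradient :: "(real^'n \<Rightarrow> real) \<Rightarrow> real^'n \<Rightarrow> real^'n" where
  "gradient \<phi> x = (\<chi> i. partial_deriv i \<phi> x)"

primrec C_k :: "nat \<Rightarrow> (real^'n \<Rightarrow> real) \<Rightarrow> bool" where
  "C_k 0 \<phi> \<longleftrightarrow> continuous_on UNIV \<phi>"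
| "C_k (Suc k) \<phi> \<longleftrightarrow> \<phi> differentiable_on UNIV \<and> (\<forall>i. C_k k (partial_deriv i \<phi>))"

definition test_functions :: "(real^'n) set \<Rightarrow> (real^'n \<Rightarrow> real) set" where
  "test_functions \<Omega> = {\<phi>. (\<forall>k. C_k k \<phi>) \<and>
     compact (closure {x. \<phi> x \<noteq> 0}) \<and> closure {x. \<phi> x \<noteq> 0} \<subseteq> \<Omega>}"

definition has_weak_div ::
  "(real^'n) set \<Rightarrow> (real^'n \<Rightarrow> real^'n^'n) \<Rightarrow> (real^'n \<Rightarrow> real^'n) \<Rightarrow> bool" where
  "has_weak_div \<Omega> A g \<longleftrightarrow> (\<forall>\<phi>\<in>test_functions \<Omega>. \<forall>i.
     (LINT x|lebesgue_on \<Omega>. row i (A x) \<bullet> gradient \<phi> x) = - (LINT x|lebesgue_on \<Omega>. g x $ i * \<phi> x))"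

definition H_div :: "(real^'n) set \<Rightarrow> (real^'n^'n) set \<Rightarrow> (real^'n \<Rightarrow> real^'n^'n) set" where
  "H_div \<Omega> V = {A \<in> L2_space \<Omega> V. \<exists>g\<in>L2_space \<Omega> UNIV. has_weak_div \<Omega> A g}"

section \<open>Degrees of freedom\<close>

definition normal_moment ::
  "(real^'n) set \<Rightarrow> real^'n \<Rightarrow> (real^'n \<Rightarrow> real^'n^'n) \<Rightarrow> (real^'n \<Rightarrow> real^'n) \<Rightarrow> real" where
  "normal_moment f \<nu> A q = (LINT x:f|surface_measure f. (A x *v \<nu>) \<bullet> q x)"

definition interior_moment ::
  "(real^'n) set \<Rightarrow> (real^'n \<Rightarrow> real^'n^'n) \<Rightarrow> (real^'n \<Rightarrow> real^'n^'n) \<Rightarrow> real" where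
  "interior_moment T A q = (LINT x:T|lborel. A x \<bullet> q x)"

definition linear_form_on :: "('a \<Rightarrow> 'b::real_vector) set \<Rightarrow> (('a \<Rightarrow> 'b) \<Rightarrow> real) \<Rightarrow> bool" where
  "linear_form_on S L \<longleftrightarrow>
     (\<forall>p\<in>S. \<forall>q\<in>S. L (\<lambda>x. p x + q x) = L p + L q) \<and> (\<forall>p\<in>S. \<forall>c. L (\<lambda>x. c *\<^sub>R p x) = c * L p)"

abbreviation moment_space :: "nat \<Rightarrow> nat \<Rightarrow> (real^'n) set \<Rightarrow> (real^'n \<Rightarrow> real^'n) set" where
  "moment_space r l f \<equiv> poly_space (int r - (int l + 1)) f UNIV"

text \<open>Unisolvence on \<open>T\<close>: every prescription of values of the DoFs is attained by exactly one shape
  function. The values of a DoF indexed by \<open>q\<close> in a linear space form an arbitrary linear form in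
  \<open>q\<close>; after choosing bases of the test spaces this is an arbitrary choice of finitely many reals.
  The normals are \<open>nf f i\<close> with \<open>1 \<le> i \<le> n - l\<close> for an \<open>l\<close>-dimensional \<open>f\<close>, and \<open>nF F\<close> for
  facets.\<close>

definition unisolvent :: "nat \<Rightarrow> nat \<Rightarrow> ((real^'n) set \<Rightarrow> nat \<Rightarrow> real^'n) \<Rightarrow>
    ((real^'n) set \<Rightarrow> real^'n) \<Rightarrow> (real^'n) set \<Rightarrow> bool" where
  "unisolvent m r nf nF T \<longleftrightarrow>
    (\<forall>a b c d.
       (\<forall>v. {v} \<in> subsimplices 0 T \<longrightarrow> a v \<in> trace_free) \<and>
       (\<forall>l\<in>{1..m}. \<forall>f\<in>subsimplices l T. \<forall>i\<in>{1..CARD('n) - l}.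
          linear_form_on (moment_space r l f) (b f i)) \<and>
       (\<forall>F\<in>subsimplices (CARD('n) - 1) T. \<forall>l\<in>{m+1..CARD('n) - 1}. \<forall>f\<in>subsimplices l F.
          linear_form_on (moment_space r l f) (c F f)) \<and>
       linear_form_on (div_bubbles (int r) T) d
     \<longrightarrow>
       (\<exists>!A. A \<in> poly_space (int r) T trace_free \<and>
         (\<forall>v. {v} \<in> subsimplices 0 T \<longrightarrow> A v = a v) \<and>
         (\<forall>l\<in>{1..m}. \<forall>f\<in>subsimplices l T. \<forall>i\<in>{1..CARD('n) - l}. \<forall>q\<in>moment_space r l f.
            normal_moment f (nf f i) A q = b f i q) \<and>
         (\<forall>F\<in>subsimplices (CARD('n) - 1) T. \<forall>l\<in>{m+1..CARD('n) - 1}. \<forall>f\<in>subsimplices l F.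
            \<forall>q\<in>moment_space r l f. normal_moment f (nF F) A q = c F f q) \<and>
         (\<forall>q\<in>div_bubbles (int r) T. interior_moment T A q = d q)))"

text \<open>Elements of \<open>L\<^sup>2\<close> are determined only almost everywhere, so \<open>p T\<close> is the (unique) polynomial
  representative of \<open>A\<close> on \<open>T\<close>, from which the point values and traces are computed.\<close>

definition fe_space :: "nat \<Rightarrow> nat \<Rightarrow> ((real^'n) set \<Rightarrow> nat \<Rightarrow> real^'n) \<Rightarrow>
    ((real^'n) set \<Rightarrow> real^'n) \<Rightarrow> (real^'n) set \<Rightarrow> (real^'n) set set \<Rightarrow>
    (real^'n \<Rightarrow> real^'n^'n) set" where
  "fe_space m r nf nF \<Omega> \<T> = {A \<in> L2_space \<Omega> trace_free.
     \<exists>p. (\<forall>T\<in>\<T>. p T \<in> poly_space (int r) T trace_free \<and>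
             (AE x in lebesgue_on (T \<inter> \<Omega>). A x = p T x)) \<and>
         (\<forall>v. {v} \<in> mesh_subsimplices 0 \<T> \<longrightarrow>
            (\<forall>T\<in>\<T>. \<forall>T'\<in>\<T>. v \<in> T \<and> v \<in> T' \<longrightarrow> p T v = p T' v)) \<and>
         (\<forall>l\<in>{1..m}. \<forall>f\<in>mesh_subsimplices l \<T>. \<forall>T\<in>\<T>. \<forall>T'\<in>\<T>. f \<subseteq> T \<and> f \<subseteq> T' \<longrightarrow>
            (\<forall>i\<in>{1..CARD('n) - l}. \<forall>q\<in>moment_space r l f.
               normal_moment f (nf f i) (p T) q = normal_moment f (nf f i) (p T') q)) \<and>
         (\<forall>F\<in>mesh_subsimplices (CARD('n) - 1) \<T>. \<forall>T\<in>\<T>. \<forall>T'\<in>\<T>. F \<subseteq> T \<and> F \<subseteq> T' \<longrightarrow>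
            (\<forall>l\<in>{m+1..CARD('n) - 1}. \<forall>f\<in>subsimplices l F. \<forall>q\<in>moment_space r l f.
               normal_moment f (nF F) (p T) q = normal_moment f (nF F) (p T') q))}"

end

theory Submission
  imports Defs
begin

text \<open>A polynomial that vanishes on all facets of a face $f$ is divisible by the face bubble $b_f$, the
  product of the barycentric coordinates of the vertices of $f$, and taking the cofactor as test function
  in the moments over $f$ shows that it vanishes on $f$. By induction on the dimension of the face, the
  degrees of freedom (a)--(c) determine $A n_F$ on each facet $F$; if they all vanish, $A$ is a bubble and (d)
  gives $A = 0$. Existence needs no dimension count: the moments on $f$ are corrected by a field $b_f M$ with
  trace-free $M$, which vanishes on every face that does not contain $f$, so that they can be
  adjusted in the order of increasing dimension. A final correction by a bubble adjusts (d).

  For the inclusion in $H(\mathrm{div})$, the divergence theorem is used on each simplex with a smooth cutoff of the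
  interior in place of boundary integrals. As the cutoffs increase to the indicator function, their gradients
  concentrate in layers along the facets. The affine map that fixes a common facet of two simplices and
  takes one opposite vertex to the other maps one layer onto the other, with a Jacobian that is exactly the ratio
  of the gradients. The two contributions therefore cancel in the limit if the normal components agree.\<close>

text \<open>The trace constraint shapes the degrees of freedom. A face of positive dimension has a
  tangent direction, and a rank-one matrix built from it absorbs the trace without touching the
  normal components; at a vertex there is none, so the whole matrix is prescribed there. The moments
  on a face and the moments (d) are both attained by finite-dimensional Riesz representation: for
  the L2 product weighted by the face bubble, and for the plain L2 product on the bubble space. In
  the second half no single layer flux is ever evaluated. The gradients of the cutoffs grow without
  bound, and only functions that vanish linearly at the facet are controlled, because
  \<open>t * smooth_step' k t\<close> is bounded uniformly in \<open>k\<close>. Hence fluxes are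
  compared in pairs, pulled back to one simplex, and surface measure occurs in the moments only.
  Throughout, the gradient \<open>G v\<close> of a barycentric coordinate stands for the normal of
  the facet opposite \<open>v\<close>: a prescribed facet normal is a multiple of it, and the
  prescribed normals of a smaller face in that facet span a space containing it.\<close>

section \<open>Polynomials\<close>

text \<open>The index is an exclusive degree bound: 0 admits only the zero polynomial and
  \<open>Suc k\<close> the degrees up to k, so that truncated subtraction expresses a negative
  degree correctly. The recursion peels off one coordinate factor, p = c + sum x_i q_i, where the
  q_i are not unique and serve as induction material.\<close>

primrec deg_below :: "nat \<Rightarrow> (real^'n \<Rightarrow> 'b::real_vector) \<Rightarrow> bool" where
  "deg_below 0 p \<longleftrightarrow> p = (\<lambda>x. 0)"
| "deg_below (Suc k) p \<longleftrightarrow>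
     (\<exists>c q. (\<forall>i. deg_below k (q i)) \<and> p = (\<lambda>x. c + (\<Sum>i\<in>UNIV. (x $ i) *\<^sub>R q i x)))"

lemma deg_below_zero [simp]: "deg_below k (\<lambda>x. 0)"
  by (induction k) (auto intro!: exI[of _ 0] exI[of _ "\<lambda>i x. 0"])

lemma deg_below_const: "deg_below (Suc k) (\<lambda>x. c)"
  by (auto intro!: exI[of _ c] exI[of _ "\<lambda>i x. 0"])

lemma deg_below_add:
  "deg_below k p \<Longrightarrow> deg_below k q \<Longrightarrow> deg_below k (\<lambda>x. p x + q x)"
proof (induction k arbitrary: p q)
  case (Suc k)
  obtain c1 q1 where 1: "\<And>i. deg_below k (q1 i)" "p = (\<lambda>x. c1 + (\<Sum>i\<in>UNIV. (x $ i) *\<^sub>R q1 i x))"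
    using Suc.prems(1) by auto
  obtain c2 q2 where 2: "\<And>i. deg_below k (q2 i)" "q = (\<lambda>x. c2 + (\<Sum>i\<in>UNIV. (x $ i) *\<^sub>R q2 i x))"
    using Suc.prems(2) by auto
  have "(\<forall>i. deg_below k (\<lambda>x. q1 i x + q2 i x)) \<and> (\<lambda>x. p x + q x) =
      (\<lambda>x. (c1 + c2) + (\<Sum>i\<in>UNIV. (x $ i) *\<^sub>R (q1 i x + q2 i x)))"
    using 1 2 Suc.IH by (auto simp: algebra_simps sum.distrib)
  then show ?case unfolding deg_below.simps
    by (intro exI[of _ "c1+c2"] exI[of _ "\<lambda>i x. q1 i x + q2 i x"])
qed simp

lemma deg_below_linear:
  assumes "linear L"
  shows "deg_below k p \<Longrightarrow> deg_below k (\<lambda>x. L (p x))"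
proof (induction k arbitrary: p)
  case 0 then show ?case using linear_0[OF assms] by simp
next
  case (Suc k)
  obtain c q where 1: "\<And>i. deg_below k (q i)" "p = (\<lambda>x. c + (\<Sum>i\<in>UNIV. (x $ i) *\<^sub>R q i x))"
    using Suc.prems(1) by auto
  show ?case unfolding deg_below.simps
    by (intro exI[of _ "L c"] exI[of _ "\<lambda>i x. L (q i x)"])
      (use 1 Suc.IH in \<open>auto simp: linear_add[OF assms] linear_sum[OF assms] linear_scale[OF assms]\<close>)
qed

lemma deg_below_scaleR: "deg_below k p \<Longrightarrow> deg_below k (\<lambda>x. c *\<^sub>R p x)"
  by (rule deg_below_linear[OF linear_scale_self]) 

lemma deg_below_diff: "deg_below k p \<Longrightarrow> deg_below k q \<Longrightarrow> deg_below k (\<lambda>x. p x - q x)"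
  using deg_below_add[of k p "\<lambda>x. (-1) *\<^sub>R q x"] deg_below_scaleR[of k q "-1"] by simp

lemma deg_below_sum:
  "(\<And>i. i \<in> I \<Longrightarrow> deg_below k (p i)) \<Longrightarrow> deg_below k (\<lambda>x. \<Sum>i\<in>I. p i x)"
  by (induction I rule: infinite_finite_induct) (auto intro: deg_below_add)

lemma deg_below_mult_coord: "deg_below k p \<Longrightarrow> deg_below (Suc k) (\<lambda>x. (x $ i) *\<^sub>R p x)"
  unfolding deg_below.simps
proof (intro exI[of _ 0] exI[of _ "\<lambda>j x. (if j = i then 1 else 0) *\<^sub>R p x"] conjI allI ext)
  fix x :: "real^'a" assume "deg_below k p"
  have "(x $ j) *\<^sub>R ((if j = i then 1 else 0::real) *\<^sub>R p x) = (if j = i then (x $ j) *\<^sub>R p x else 0)" for j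
    by simp
  then show "(x $ i) *\<^sub>R p x = 0 + (\<Sum>j\<in>UNIV. (x $ j) *\<^sub>R ((if j = i then 1 else 0) *\<^sub>R p x))"
    by (simp only: sum.delta finite_UNIV) simp
qed (rule deg_below_scaleR)

lemma deg_below_Suc: "deg_below k p \<Longrightarrow> deg_below (Suc k) p"
proof (induction k arbitrary: p)
  case (Suc k)
  obtain c q where 1: "\<And>i. deg_below k (q i)" "p = (\<lambda>x. c + (\<Sum>i\<in>UNIV. (x $ i) *\<^sub>R q i x))"
    using Suc.prems(1) by auto
  show ?case unfolding deg_below.simps(2)[of "Suc k"]
    by (intro exI[of _ c] exI[of _ q]) (use 1 Suc.IH in auto)
qed (simp only: deg_below.simps(1) deg_below_zero)

lemma deg_below_mono: "deg_below k p \<Longrightarrow> k \<le> l \<Longrightarrow> deg_below l p"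
proof -
  assume p: "deg_below k p" and "k \<le> l"
  from \<open>k \<le> l\<close> show ?thesis
    by (induction l rule: dec_induct) (fact p, rule deg_below_Suc)
qed

lemma affine_form_expand:
  "linear g \<Longrightarrow> g x = (\<Sum>i\<in>UNIV. (x $ i) *\<^sub>R g (axis i 1))" for g :: "real^'n \<Rightarrow> 'b::real_vector"
  by (subst (1) basis_expansion[symmetric])
     (simp add: linear_sum linear_scale scalar_mult_eq_scaleR)

lemma deg_below_mult_affine:
  fixes g :: "real^'n \<Rightarrow> real"
  assumes "linear g" "deg_below k p"
  shows "deg_below (Suc k) (\<lambda>x. (g x + c) *\<^sub>R p x)"
proof -
  have "(\<lambda>x. (g x + c) *\<^sub>R p x) =
     (\<lambda>x. (\<Sum>i\<in>UNIV. g (axis i 1) *\<^sub>R ((x $ i) *\<^sub>R p x)) + c *\<^sub>R p x)"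
    by (subst affine_form_expand[OF assms(1)])
       (auto simp: algebra_simps scaleR_sum_left)
  moreover have "deg_below (Suc k) \<dots>"
    by (intro deg_below_add deg_below_sum deg_below_scaleR deg_below_mult_coord assms(2) deg_below_Suc)
  ultimately show ?thesis by simp
qed

lemma deg_below_compose_affine:
  fixes L :: "real^'n \<Rightarrow> real^'n"
  assumes "linear L"
  shows "deg_below k p \<Longrightarrow> deg_below k (\<lambda>x. p (L x + a))"
proof (induction k arbitrary: p)
  case (Suc k)
  obtain c q where 1: "\<And>i. deg_below k (q i)" "p = (\<lambda>x. c + (\<Sum>i\<in>UNIV. (x $ i) *\<^sub>R q i x))"
    using Suc.prems(1) by auto
  have "linear (\<lambda>x. L x $ i)" for i
    using linear_compose[OF assms, of "\<lambda>x. x $ i"] by (simp add: o_def linear_iff)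
  then have "deg_below (Suc k) (\<lambda>x. c + (\<Sum>i\<in>UNIV. (L x $ i + a $ i) *\<^sub>R q i (L x + a)))"
    by (intro deg_below_add deg_below_const deg_below_sum deg_below_mult_affine Suc.IH 1)
  then show ?case using 1(2) by simp
qed simp

text \<open>Modulo the form \<open>g + c\<close>, a polynomial may be evaluated at any
  point \<open>x - (g x + c) w\<close>. With \<open>g w = 1\<close> this point lies on the zero set of the form.\<close>

lemma deg_below_divide_affine:
  fixes g :: "real^'n \<Rightarrow> real"
  assumes "linear g"
  shows "deg_below k p \<Longrightarrow>
    \<exists>q. deg_below (k - 1) q \<and> (\<forall>x. p x = p (x - (g x + c) *\<^sub>R w) + (g x + c) *\<^sub>R q x)"
proof (induction k arbitrary: p)
  case 0 then show ?case by (auto intro!: exI[of _ "\<lambda>x. 0"])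
next
  case (Suc k)
  obtain c0 q where 1: "\<And>i. deg_below k (q i)" "p = (\<lambda>x. c0 + (\<Sum>i\<in>UNIV. (x $ i) *\<^sub>R q i x))"
    using Suc.prems(1) by auto
  define h where "h = (\<lambda>x. x - (g x + c) *\<^sub>R w)"
  obtain r where r: "\<And>i. deg_below (k - 1) (r i)"
     "\<And>i x. q i x = q i (h x) + (g x + c) *\<^sub>R r i x"
  proof -
    have "\<forall>i. \<exists>r. deg_below (k - 1) r \<and> (\<forall>x. q i x = q i (h x) + (g x + c) *\<^sub>R r x)"
      unfolding h_def by (intro allI Suc.IH 1(1))
    from choice[OF this] show ?thesis using that by blast
  qed
  have lin: "linear (\<lambda>x. x - g x *\<^sub>R w)"
    using assms by (auto simp: linear_iff algebra_simps)
  have h: "h = (\<lambda>x. (x - g x *\<^sub>R w) + (- c *\<^sub>R w))"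
    by (auto simp: h_def algebra_simps)
  have qh: "deg_below k (\<lambda>x. q i (h x))" for i
    unfolding h by (rule deg_below_compose_affine[OF lin 1(1)])
  \<comment> \<open>For \<open>k = 0\<close> the bound \<open>k - 1\<close> is 0 as well, and
    multiplying by a coordinate would raise it; in that case \<open>r i\<close> is zero.\<close>
  have xr: "deg_below k (\<lambda>x. (x $ i) *\<^sub>R r i x)" for i
  proof (cases k)
    case 0
    then have "r i = (\<lambda>x. 0)" using r(1)[of i] by (simp only: diff_0_eq_0 deg_below.simps)
    then show ?thesis by simp
  next
    case (Suc k')
    then have "Suc (k - 1) = k" by simp
    then show ?thesis using deg_below_mult_coord[OF r(1)[of i], of i] by (simp only:)
  qed
  \<comment> \<open>Here x_i q_i(x) = x_i q_i(h x) + (g x + c) x_i r_i(x), and x_i = (h x)_i + (g x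
    + c) w_i is inserted in the first term only; \<open>s\<close> collects what carries the factor g
    x + c.\<close>
  define s where "s = (\<lambda>x. \<Sum>i\<in>UNIV. (w $ i) *\<^sub>R q i (h x) + (x $ i) *\<^sub>R r i x)"
  have "deg_below k s" unfolding s_def
    by (intro deg_below_sum deg_below_add deg_below_scaleR qh xr)
  moreover have "p x = p (h x) + (g x + c) *\<^sub>R s x" for x
  proof -
    have *: "(x $ i) *\<^sub>R q i x = (h x $ i) *\<^sub>R q i (h x) +
        (g x + c) *\<^sub>R ((w $ i) *\<^sub>R q i (h x) + (x $ i) *\<^sub>R r i x)" for i
      by (subst r(2)) (simp add: h_def algebra_simps)
    have "p x = c0 + (\<Sum>i\<in>UNIV. (h x $ i) *\<^sub>R q i (h x) +
        (g x + c) *\<^sub>R ((w $ i) *\<^sub>R q i (h x) + (x $ i) *\<^sub>R r i x))"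
      by (simp only: 1(2) *[symmetric])
    also have "\<dots> = p (h x) + (g x + c) *\<^sub>R s x"
      by (simp only: 1(2) s_def scaleR_sum_right sum.distrib[symmetric] add.assoc)
    finally show ?thesis .
  qed
  ultimately show ?case unfolding h_def diff_Suc_1 by (intro exI[of _ s]) blast
qed

section \<open>Agreement with the multi-index definition of polynomials\<close>

lemma finite_multiindices: "finite {\<alpha> :: 'n::finite \<Rightarrow> nat. int (\<Sum>i\<in>UNIV. \<alpha> i) \<le> k}"
proof (rule finite_subset)
  have "\<alpha> i \<le> nat k" if "int (\<Sum>i\<in>UNIV. \<alpha> i) \<le> k" for \<alpha> :: "'n \<Rightarrow> nat" and i
    using member_le_sum[of i UNIV \<alpha>] that by (simp del: of_nat_sum)
  then show "{\<alpha> :: 'n \<Rightarrow> nat. int (\<Sum>i\<in>UNIV. \<alpha> i) \<le> k} \<subseteq> (UNIV \<rightarrow>\<^sub>E {..nat k})"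
    by (auto simp: PiE_UNIV_domain)
  show "finite ((UNIV :: 'n set) \<rightarrow>\<^sub>E {..nat k})" by (intro finite_PiE) auto
qed

lemma deg_below_monomial:
  "deg_below (Suc (\<Sum>i\<in>UNIV. \<alpha> i)) (\<lambda>x::real^'n. (\<Prod>i\<in>UNIV. (x $ i) ^ \<alpha> i) *\<^sub>R c)"
proof (induction "\<Sum>i\<in>UNIV. \<alpha> i" arbitrary: \<alpha>)
  case 0
  then have "\<alpha> = (\<lambda>i. 0)" by auto
  then show ?case using deg_below_const[of 0 c] by simp
next
  case (Suc s)
  then obtain j where j: "\<alpha> j > 0" by (metis gr0I nat.simps(3) sum.neutral)
  define \<beta> where "\<beta> = \<alpha>(j := \<alpha> j - 1)"
  have a: "\<alpha> i = \<beta> i + (if i = j then 1 else 0)" for i using j by (auto simp: \<beta>_def)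
  have s: "s = (\<Sum>i\<in>UNIV. \<beta> i)" using Suc(2) unfolding a by (simp add: sum.distrib)
  have "(\<Prod>i\<in>UNIV. (x $ i) ^ \<alpha> i) = x $ j * (\<Prod>i\<in>UNIV. (x $ i) ^ \<beta> i)" for x :: "real^'n"
    unfolding a power_add prod.distrib by (simp add: if_distrib[of "\<lambda>k. _ ^ k"] cong: if_cong)
  then show ?case
    using deg_below_mult_coord[OF Suc(1)[OF s], of j] unfolding Suc(2)[symmetric] s[symmetric]
    by simp
qed

lemma poly_deg_le_add:
  "poly_deg_le k p \<Longrightarrow> poly_deg_le k q \<Longrightarrow> poly_deg_le k (\<lambda>x. p x + q x)"
proof -
  assume "poly_deg_le k p" "poly_deg_le k q"
  then obtain c d where "\<forall>x. p x = (\<Sum>\<alpha> | int (\<Sum>i\<in>UNIV. \<alpha> i) \<le> k. (\<Prod>i\<in>UNIV. (x $ i) ^ \<alpha> i) *\<^sub>R c \<alpha>)"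
    "\<forall>x. q x = (\<Sum>\<alpha> | int (\<Sum>i\<in>UNIV. \<alpha> i) \<le> k. (\<Prod>i\<in>UNIV. (x $ i) ^ \<alpha> i) *\<^sub>R d \<alpha>)"
    unfolding poly_deg_le_def by blast
  then have "\<forall>x. p x + q x = (\<Sum>\<alpha> | int (\<Sum>i\<in>UNIV. \<alpha> i) \<le> k.
      (\<Prod>i\<in>UNIV. (x $ i) ^ \<alpha> i) *\<^sub>R (c \<alpha> + d \<alpha>))"
    by (simp only: scaleR_add_right sum.distrib simp_thms)
  then show ?thesis unfolding poly_deg_le_def by (intro exI[of _ "\<lambda>\<alpha>. c \<alpha> + d \<alpha>"])
qed

lemma poly_deg_le_zero: "poly_deg_le k (\<lambda>x. 0)"
  unfolding poly_deg_le_def by (rule exI[of _ "\<lambda>\<alpha>. 0"]) simp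

lemma poly_deg_le_sum:
  "(\<And>i. i \<in> I \<Longrightarrow> poly_deg_le k (p i)) \<Longrightarrow> poly_deg_le k (\<lambda>x. \<Sum>i\<in>I. p i x)"
  by (induction I rule: infinite_finite_induct) (auto intro: poly_deg_le_add poly_deg_le_zero)

lemma poly_deg_le_monomial:
  assumes "int (\<Sum>i\<in>UNIV. \<alpha> i) \<le> k"
  shows "poly_deg_le k (\<lambda>x::real^'n. (\<Prod>i\<in>UNIV. (x $ i) ^ \<alpha> i) *\<^sub>R c)"
  unfolding poly_deg_le_def
proof (intro exI allI)
  fix x :: "real^'n"
  let ?S = "{\<beta>. int (\<Sum>i\<in>UNIV. \<beta> i) \<le> k}"
  have "(\<Sum>\<beta>\<in>?S. (\<Prod>i\<in>UNIV. (x $ i) ^ \<beta> i) *\<^sub>R (if \<beta> = \<alpha> then c else 0)) =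
      (\<Sum>\<beta>\<in>?S. if \<beta> = \<alpha> then (\<Prod>i\<in>UNIV. (x $ i) ^ \<beta> i) *\<^sub>R c else 0)"
    by (rule sum.cong[OF refl]) simp
  also have "\<dots> = (\<Prod>i\<in>UNIV. (x $ i) ^ \<alpha> i) *\<^sub>R c"
    by (subst sum.delta[OF finite_multiindices]) (use assms in \<open>simp del: of_nat_sum\<close>)
  finally show "(\<Prod>i\<in>UNIV. (x $ i) ^ \<alpha> i) *\<^sub>R c =
      (\<Sum>\<beta>\<in>?S. (\<Prod>i\<in>UNIV. (x $ i) ^ \<beta> i) *\<^sub>R (if \<beta> = \<alpha> then c else 0))" by simp
qed

lemma poly_deg_le_const: "k \<ge> 0 \<Longrightarrow> poly_deg_le k (\<lambda>x::real^'n. c)"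
  using poly_deg_le_monomial[of "\<lambda>i. 0" k c] by simp

lemma poly_deg_le_mult_coord:
  assumes "poly_deg_le k p"
  shows "poly_deg_le (k + 1) (\<lambda>x. (x $ j) *\<^sub>R p x)"
proof -
  obtain c where p: "\<And>x. p x =
      (\<Sum>\<alpha> | int (\<Sum>i\<in>UNIV. \<alpha> i) \<le> k. (\<Prod>i\<in>UNIV. (x $ i) ^ \<alpha> i) *\<^sub>R c \<alpha>)"
    using assms unfolding poly_deg_le_def by auto
  have *: "x $ j * (\<Prod>i\<in>UNIV. (x $ i) ^ \<alpha> i) =
      (\<Prod>i\<in>UNIV. (x $ i) ^ (\<alpha> i + (if i = j then 1 else 0)))" for \<alpha> and x :: "real^'a"
    unfolding power_add prod.distrib by (simp add: if_distrib[of "\<lambda>k. _ ^ k"] cong: if_cong)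
  have "poly_deg_le (k + 1) (\<lambda>x. \<Sum>\<alpha> | int (\<Sum>i\<in>UNIV. \<alpha> i) \<le> k.
      (\<Prod>i\<in>UNIV. (x $ i) ^ (\<alpha> i + (if i = j then 1 else 0))) *\<^sub>R c \<alpha>)"
    by (intro poly_deg_le_sum poly_deg_le_monomial) (auto simp: sum.distrib)
  then show ?thesis unfolding p scaleR_sum_right scaleR_scaleR * .
qed

lemma poly_deg_le_of_deg_below: "deg_below k p \<Longrightarrow> poly_deg_le (int k - 1) p"
proof (induction k arbitrary: p)
  case 0 then show ?case using poly_deg_le_zero by simp
next
  case (Suc k)
  obtain c q where 1: "\<And>i. deg_below k (q i)" "p = (\<lambda>x. c + (\<Sum>i\<in>UNIV. (x $ i) *\<^sub>R q i x))"
    using Suc.prems(1) by auto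
  have "poly_deg_le (int k - 1 + 1) p" unfolding 1(2)
    by (intro poly_deg_le_add poly_deg_le_sum poly_deg_le_mult_coord Suc.IH 1 poly_deg_le_const) simp
  then show ?case by simp
qed

text \<open>\<open>nat\<close> collapses all negative \<open>k\<close> to 0, where both sides
  describe the zero function alone; otherwise the shift by one converts the inclusive bound into the
  exclusive one.\<close>

lemma poly_deg_le_iff: "poly_deg_le k p \<longleftrightarrow> deg_below (nat (k + 1)) p"
proof
  assume "poly_deg_le k p"
  then obtain c where p: "p = (\<lambda>x.
      (\<Sum>\<alpha> | int (\<Sum>i\<in>UNIV. \<alpha> i) \<le> k. (\<Prod>i\<in>UNIV. (x $ i) ^ \<alpha> i) *\<^sub>R c \<alpha>))"
    unfolding poly_deg_le_def by auto
  show "deg_below (nat (k + 1)) p" unfolding p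
  proof (intro deg_below_sum deg_below_mono[OF deg_below_monomial])
    fix \<alpha> :: "'a \<Rightarrow> nat" assume a: "\<alpha> \<in> {\<alpha>. int (sum \<alpha> UNIV) \<le> k}"
    have "Suc s \<le> nat (k + 1)" if "int s \<le> k" for s using that by linarith
    from this[of "sum \<alpha> UNIV"] a show "Suc (sum \<alpha> UNIV) \<le> nat (k + 1)" by blast
  qed
next
  assume *: "deg_below (nat (k + 1)) p"
  show "poly_deg_le k p"
  proof (cases "k < 0")
    case True
    then have "nat (k + 1) = 0" by simp
    with * have "p = (\<lambda>x. 0)" by (simp only: deg_below.simps)
    then show ?thesis by (simp only: poly_deg_le_zero)
  next
    case False
    then have "int (nat (k + 1)) - 1 = k" by simp
    then show ?thesis using poly_deg_le_of_deg_below[OF *] by (simp only:)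
  qed
qed

lemma deg_below_continuous:
  fixes p :: "real^'n \<Rightarrow> 'b::real_normed_vector"
  shows "deg_below k p \<Longrightarrow> continuous_on S p"
proof (induction k arbitrary: p)
  case (Suc k)
  obtain c q where 1: "\<And>i. deg_below k (q i)" "p = (\<lambda>x. c + (\<Sum>i\<in>UNIV. (x $ i) *\<^sub>R q i x))"
    using Suc.prems(1) by auto
  show ?case unfolding 1(2) by (intro continuous_intros Suc.IH 1)
qed simp

text \<open>Splitting the vector coefficients along \<open>Basis\<close> gives finitely many
  generators with real coefficients, over which the Riesz representation runs its induction.\<close>

lemma poly_deg_le_finite_span:
  fixes p :: "real^'n \<Rightarrow> 'b::euclidean_space"
  assumes "poly_deg_le k p"
  shows "\<exists>d. \<forall>x. p x = (\<Sum>z \<in> {\<alpha>. int (\<Sum>i\<in>UNIV. \<alpha> i) \<le> k} \<times> Basis.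
     d z *\<^sub>R ((\<Prod>i\<in>UNIV. (x $ i) ^ fst z i) *\<^sub>R snd z))"
proof -
  obtain c where p: "\<And>x. p x =
      (\<Sum>\<alpha> | int (\<Sum>i\<in>UNIV. \<alpha> i) \<le> k. (\<Prod>i\<in>UNIV. (x $ i) ^ \<alpha> i) *\<^sub>R c \<alpha>)"
    using assms unfolding poly_deg_le_def by auto
  have "p x = (\<Sum>z \<in> {\<alpha>. int (\<Sum>i\<in>UNIV. \<alpha> i) \<le> k} \<times> Basis.
     (c (fst z) \<bullet> snd z) *\<^sub>R ((\<Prod>i\<in>UNIV. (x $ i) ^ fst z i) *\<^sub>R snd z))" for x
  proof -
    have "p x = (\<Sum>\<alpha> | int (\<Sum>i\<in>UNIV. \<alpha> i) \<le> k. \<Sum>b\<in>Basis.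
        (c \<alpha> \<bullet> b) *\<^sub>R ((\<Prod>i\<in>UNIV. (x $ i) ^ \<alpha> i) *\<^sub>R b))"
      unfolding p
    proof (rule sum.cong[OF refl])
      fix \<alpha> :: "'n \<Rightarrow> nat"
      have "(\<Prod>i\<in>UNIV. (x $ i) ^ \<alpha> i) *\<^sub>R c \<alpha> = (\<Prod>i\<in>UNIV. (x $ i) ^ \<alpha> i) *\<^sub>R (\<Sum>b\<in>Basis. (c \<alpha> \<bullet> b) *\<^sub>R b)"
        by (simp only: euclidean_representation)
      then show "(\<Prod>i\<in>UNIV. (x $ i) ^ \<alpha> i) *\<^sub>R c \<alpha> =
          (\<Sum>b\<in>Basis. (c \<alpha> \<bullet> b) *\<^sub>R ((\<Prod>i\<in>UNIV. (x $ i) ^ \<alpha> i) *\<^sub>R b))"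
        by (simp only: scaleR_sum_right scaleR_scaleR mult.commute)
    qed
    also have "\<dots> = (\<Sum>z \<in> {\<alpha>. int (\<Sum>i\<in>UNIV. \<alpha> i) \<le> k} \<times> Basis.
       (c (fst z) \<bullet> snd z) *\<^sub>R ((\<Prod>i\<in>UNIV. (x $ i) ^ fst z i) *\<^sub>R snd z))"
      by (simp only: sum.cartesian_product case_prod_unfold)
    finally show ?thesis .
  qed
  then show ?thesis by (intro exI[of _ "\<lambda>z. c (fst z) \<bullet> snd z"]) simp
qed

declare deg_below.simps [simp del]

section \<open>Barycentric coordinates\<close>

text \<open>\<open>G v\<close> and \<open>c v\<close> are the gradient and the constant term of the
  barycentric coordinate of the vertex \<open>v\<close>. The Kronecker property makes
  \<open>C\<close> affinely independent, and the affine hull makes the simplex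
  full-dimensional.\<close>

locale affine_coords =
  fixes C :: "'a::euclidean_space set" and G :: "'a \<Rightarrow> 'a" and c :: "'a \<Rightarrow> real"
  assumes finite_C: "finite C"
    and affine_hull_C: "affine hull C = UNIV"
    and coords_delta: "v \<in> C \<Longrightarrow> w \<in> C \<Longrightarrow> G v \<bullet> w + c v = (if w = v then 1 else 0)"
begin

definition bary :: "'a \<Rightarrow> 'a \<Rightarrow> real" where
  "bary v x = G v \<bullet> x + c v"

lemma bary_vertex: "v \<in> C \<Longrightarrow> w \<in> C \<Longrightarrow> bary v w = (if w = v then 1 else 0)"
  using coords_delta by (simp add: bary_def)

lemma bary_add: "bary v (x + y) = bary v x + G v \<bullet> y"
  by (simp add: bary_def inner_add_right)

lemma bary_affine_comb:
  assumes "sum u S = 1"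
  shows "bary v (\<Sum>w\<in>S. u w *\<^sub>R w) = (\<Sum>w\<in>S. u w * bary v w)"
proof -
  have "(\<Sum>w\<in>S. u w * bary v w) = (\<Sum>w\<in>S. u w * (G v \<bullet> w)) + (\<Sum>w\<in>S. u w) * c v"
    by (simp add: bary_def distrib_left sum.distrib sum_distrib_right)
  then show ?thesis using assms by (simp add: bary_def inner_sum_right)
qed

lemma bary_affine_comb_vertex:
  assumes "sum u C = 1" "v \<in> C"
  shows "bary v (\<Sum>w\<in>C. u w *\<^sub>R w) = u v"
proof -
  have "(\<Sum>w\<in>C. u w * bary v w) = (\<Sum>w\<in>C. if w = v then u w else 0)"
    by (rule sum.cong) (use assms bary_vertex in auto)
  then show ?thesis using assms finite_C by (simp add: bary_affine_comb)
qed

lemma bary_sum: "(\<Sum>v\<in>C. bary v x) = 1" and bary_repr: "(\<Sum>v\<in>C. bary v x *\<^sub>R v) = x"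
proof -
  have "x \<in> affine hull C" using affine_hull_C by simp
  then obtain u where u: "sum u C = 1" "(\<Sum>v\<in>C. u v *\<^sub>R v) = x"
    unfolding affine_hull_finite[OF finite_C] by blast
  then have "bary v x = u v" if "v \<in> C" for v
    using bary_affine_comb_vertex[OF u(1) that] by simp
  then show "(\<Sum>v\<in>C. bary v x) = 1" "(\<Sum>v\<in>C. bary v x *\<^sub>R v) = x"
    using u by auto
qed

text \<open>Convex weights on \<open>E\<close>, extended by zero to \<open>C\<close>, are the
  barycentric coordinates of the point; conversely, coordinates that vanish off \<open>E\<close>
  reduce the representation over \<open>C\<close> to one over \<open>E\<close>.\<close>

lemma mem_face_iff:
  assumes "E \<subseteq> C"
  shows "x \<in> convex hull E \<longleftrightarrow> (\<forall>v\<in>E. 0 \<le> bary v x) \<and> (\<forall>v\<in>C - E. bary v x = 0)"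
proof
  have fin: "finite E" using assms finite_C finite_subset by blast
  assume "x \<in> convex hull E"
  then obtain u where u: "\<And>w. w \<in> E \<Longrightarrow> 0 \<le> u w" "sum u E = 1" "(\<Sum>w\<in>E. u w *\<^sub>R w) = x"
    unfolding convex_hull_finite[OF fin] by blast
  have *: "bary v x = (\<Sum>w\<in>E. u w * (if w = v then 1 else 0))" if "v \<in> C" for v
    unfolding u(3)[symmetric] bary_affine_comb[OF u(2)]
    by (rule sum.cong) (use that assms bary_vertex in auto)
  have "bary v x = (if v \<in> E then u v else 0)" if "v \<in> C" for v
    unfolding *[OF that] using fin by (simp add: mult_delta_right)
  then show "(\<forall>v\<in>E. 0 \<le> bary v x) \<and> (\<forall>v\<in>C - E. bary v x = 0)"
    using u(1) assms by (auto simp: subset_iff)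
next
  have fin: "finite E" using assms finite_C finite_subset by blast
  assume *: "(\<forall>v\<in>E. 0 \<le> bary v x) \<and> (\<forall>v\<in>C - E. bary v x = 0)"
  have "(\<Sum>v\<in>E. bary v x) = (\<Sum>v\<in>C. bary v x)" "(\<Sum>v\<in>E. bary v x *\<^sub>R v) = (\<Sum>v\<in>C. bary v x *\<^sub>R v)"
    by (rule sum.mono_neutral_left; use finite_C assms * in auto)+
  then show "x \<in> convex hull E"
    unfolding convex_hull_finite[OF fin] using * bary_sum bary_repr by auto
qed

text \<open>Evaluating the form of \<open>v\<close> on an affine relation isolates the coefficient
  of \<open>v\<close>.\<close>

lemma not_affine_dependent_C: "\<not> affine_dependent C"
proof
  assume "affine_dependent C"
  then obtain u v where u: "sum u C = 0" "v \<in> C" "u v \<noteq> 0" "(\<Sum>w\<in>C. u w *\<^sub>R w) = 0"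
    using affine_dependent_explicit_finite[OF finite_C] by blast
  have "u v = (\<Sum>w\<in>C. u w * (G v \<bullet> w + c v))"
  proof -
    have "(\<Sum>w\<in>C. u w * (G v \<bullet> w + c v)) = (\<Sum>w\<in>C. if w = v then u w else 0)"
      by (rule sum.cong) (use coords_delta u(2) in auto)
    then show ?thesis using finite_C u(2) by simp
  qed
  also have "\<dots> = G v \<bullet> (\<Sum>w\<in>C. u w *\<^sub>R w) + (\<Sum>w\<in>C. u w) * c v"
    by (simp add: distrib_left sum.distrib sum_distrib_right inner_sum_right)
  also have "\<dots> = 0" using u by simp
  finally show False using u(3) by simp
qed

lemma rel_interior_face_pos:
  assumes "E \<subseteq> C" "x \<in> rel_interior (convex hull E)" "v \<in> E"
  shows "bary v x > 0"
proof -
  have fin: "finite E" using assms finite_C finite_subset by blast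
  have "\<not> affine_dependent E" using not_affine_dependent_C assms(1) affine_dependent_subset by blast
  then obtain u where u: "\<And>w. w \<in> E \<Longrightarrow> 0 < u w" "sum u E = 1" "(\<Sum>w\<in>E. u w *\<^sub>R w) = x"
    using assms(2) unfolding rel_interior_convex_hull_explicit[OF \<open>\<not> affine_dependent E\<close>] by blast
  have "bary v x = (\<Sum>w\<in>E. u w * bary v w)"
    unfolding u(3)[symmetric] by (rule bary_affine_comb[OF u(2)])
  also have "\<dots> = (\<Sum>w\<in>E. if w = v then u w else 0)"
    by (rule sum.cong) (use assms bary_vertex[of v] in \<open>auto simp: subset_iff\<close>)
  also have "\<dots> = u v" using fin assms by simp
  finally show ?thesis using u(1) assms by simp
qed

section \<open>Normal spaces and sub-simplices of a simplex\<close>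

lemma card_C: "card C = DIM('a) + 1"
  using aff_dim_affine_independent[OF not_affine_dependent_C] affine_hull_C
    aff_dim_affine_hull[of C] by simp

lemma tangent_orthogonal:
  assumes "E \<subseteq> C" "v \<in> C - E" "t \<in> tangent_space (convex hull E)"
  shows "G v \<bullet> t = 0"
  using assms(3) unfolding tangent_space_def
proof (induction rule: span_induct_alt)
  case (step k y z)
  then obtain x x' where x: "x \<in> convex hull E" "x' \<in> convex hull E" "y = x - x'" by blast
  then have "bary v x = 0" "bary v x' = 0" using mem_face_iff[OF assms(1)] assms(2) by auto
  then show ?case using step x by (simp add: bary_def inner_diff_right inner_add_right)
qed simp

lemma vertex_diff_tangent: "v \<in> E \<Longrightarrow> w \<in> E \<Longrightarrow> v - w \<in> tangent_space (convex hull E)"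
  unfolding tangent_space_def by (rule span_base) (auto intro: hull_inc)

text \<open>The gradients \<open>G v\<close> of the coordinates vanishing on a face span its normal space.\<close>

lemma normal_expand:
  assumes "E \<subseteq> C" "e \<in> E" "\<And>t. t \<in> tangent_space (convex hull E) \<Longrightarrow> \<nu> \<bullet> t = 0"
  shows "\<nu> = (\<Sum>v\<in>C - E. (\<nu> \<bullet> (v - e)) *\<^sub>R G v)"
proof (rule vector_eq_rdot[THEN iffD1], rule allI)
  fix y
  \<comment> \<open>The barycentric representation of \<open>e + y\<close> minus \<open>e\<close>,
    with weights that sum to one. In the product with \<nu> only the vertices outside
    \<open>E\<close> survive, because \<open>v - e\<close> is tangent for \<open>v\<close> in
    \<open>E\<close>.\<close>
  have s: "(\<Sum>v\<in>C. bary v (e + y) *\<^sub>R (v - e)) = y"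
    by (simp add: scaleR_diff_right sum_subtractf bary_repr scaleR_sum_left[symmetric] bary_sum)
  have "\<nu> \<bullet> y = (\<Sum>v\<in>C. bary v (e + y) * (\<nu> \<bullet> (v - e)))"
    by (subst (1) s[symmetric]) (simp only: inner_sum_right inner_scaleR_right)
  also have "\<dots> = (\<Sum>v\<in>C - E. bary v (e + y) * (\<nu> \<bullet> (v - e)))"
  proof (intro sum.mono_neutral_right finite_C ballI)
    fix v assume "v \<in> C - (C - E)"
    then have "\<nu> \<bullet> (v - e) = 0" by (intro assms(3) vertex_diff_tangent assms(2)) auto
    then show "bary v (e + y) * (\<nu> \<bullet> (v - e)) = 0" by simp
  qed auto
  also have "\<dots> = (\<Sum>v\<in>C - E. (\<nu> \<bullet> (v - e)) * (G v \<bullet> y))"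
  proof (intro sum.cong refl)
    fix v assume "v \<in> C - E"
    then have "bary v e = 0" using assms(1,2) bary_vertex[of v e] by auto
    then show "bary v (e + y) * (\<nu> \<bullet> (v - e)) = (\<nu> \<bullet> (v - e)) * (G v \<bullet> y)"
      by (simp add: bary_add)
  qed
  finally show "\<nu> \<bullet> y = (\<Sum>v\<in>C - E. (\<nu> \<bullet> (v - e)) *\<^sub>R G v) \<bullet> y"
    by (simp add: inner_sum_left)
qed

text \<open>With zero gradient the form would be constant, but it takes the value 1 at
  \<open>v\<close> and 0 at another vertex.\<close>

lemma G_nonzero: "v \<in> C \<Longrightarrow> G v \<noteq> 0"
proof
  assume v: "v \<in> C" "G v = 0"
  have "card C \<ge> 2" using card_C DIM_positive[where 'a='a] by linarith
  then have "\<not> C \<subseteq> {v}" using card_mono[of "{v}" C] by auto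
  then obtain w where w: "w \<in> C" "w \<noteq> v" by auto
  show False using coords_delta[OF v(1) v(1)] coords_delta[OF v(1) w(1)] v w by simp
qed

text \<open>A facet misses a single vertex, so \<open>normal_expand\<close> has one term. A
  prescribed facet normal can thus be exchanged for the gradient \<open>G v\<close>.\<close>

lemma facet_normal:
  assumes "v \<in> C" "normal_vector (convex hull (C - {v})) \<nu>"
  obtains k where "k \<noteq> 0" "\<nu> = k *\<^sub>R G v"
proof -
  have "card C \<ge> 2" using card_C DIM_positive[where 'a='a] by linarith
  then have "\<not> C \<subseteq> {v}" using card_mono[of "{v}" C] by auto
  then obtain e where e: "e \<in> C - {v}" by blast
  have *: "\<nu> \<noteq> 0" "\<And>t. t \<in> tangent_space (convex hull (C - {v})) \<Longrightarrow> \<nu> \<bullet> t = 0"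
    using assms(2) by (auto simp: normal_vector_def)
  have "C - (C - {v}) = {v}" using assms(1) by auto
  then have "\<nu> = (\<nu> \<bullet> (v - e)) *\<^sub>R G v"
    using normal_expand[OF _ e *(2)] by simp
  then show thesis using that[of "\<nu> \<bullet> (v - e)"] *(1) by fastforce
qed

lemma normal_vector_G: "E \<subseteq> C \<Longrightarrow> v \<in> C - E \<Longrightarrow> normal_vector (convex hull E) (G v)"
  using tangent_orthogonal G_nonzero by (auto simp: normal_vector_def)

lemma face_simplex: "E \<subseteq> C \<Longrightarrow> card E = l + 1 \<Longrightarrow> (int l) simplex (convex hull E)"
  unfolding simplex_def using not_affine_dependent_C affine_dependent_subset
  by (intro exI[of _ E]) auto

lemma face_of_hull_iff:
  "E \<subseteq> C \<Longrightarrow> f face_of (convex hull E) \<longleftrightarrow> (\<exists>E'\<subseteq>E. f = convex hull E')"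
  using face_of_convex_hull_affine_independent[of E f] not_affine_dependent_C
    affine_dependent_subset by blast

lemma subsimplices_iff:
  assumes "E \<subseteq> C"
  shows "f \<in> subsimplices l (convex hull E) \<longleftrightarrow>
    (\<exists>E'\<subseteq>E. card E' = l + 1 \<and> f = convex hull E')"
proof
  assume "f \<in> subsimplices l (convex hull E)"
  then obtain E' where E': "E' \<subseteq> E" "f = convex hull E'" "int l simplex f"
    using face_of_hull_iff[OF assms] by (auto simp: subsimplices_def)
  have "\<not> affine_dependent E'"
    using not_affine_dependent_C affine_dependent_subset E'(1) assms by blast
  from aff_dim_affine_independent[OF this] aff_dim_simplex[OF E'(3)] E'(2)
  have "card E' = l + 1" by (simp add: aff_dim_convex_hull)
  then show "\<exists>E'\<subseteq>E. card E' = l + 1 \<and> f = convex hull E'" using E' by blast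
next
  assume "\<exists>E'\<subseteq>E. card E' = l + 1 \<and> f = convex hull E'"
  then obtain E' where E': "E' \<subseteq> E" "f = convex hull E'" "card E' = l + 1" by blast
  then show "f \<in> subsimplices l (convex hull E)"
    using face_of_hull_iff[OF assms] face_simplex[of E' l] assms by (auto simp: subsimplices_def)
qed

lemma subsimplicesE:
  assumes "E \<subseteq> C" "f \<in> subsimplices l (convex hull E)"
  obtains E' where "E' \<subseteq> E" "card E' = l + 1" "f = convex hull E'"
proof -
  have "\<exists>E'\<subseteq>E. card E' = l + 1 \<and> f = convex hull E'"
    using assms(2) by (simp only: subsimplices_iff[OF assms(1)])
  then show thesis using that by (elim exE conjE)
qed

lemma subsimplicesI:
  assumes "E \<subseteq> C" "E' \<subseteq> E" "card E' = l + 1"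
  shows "convex hull E' \<in> subsimplices l (convex hull E)"
  unfolding subsimplices_iff[OF assms(1)] by (intro exI[of _ E'] conjI assms refl)

lemma facets_iff:
  "F \<in> subsimplices (DIM('a) - 1) (convex hull C) \<longleftrightarrow> (\<exists>v\<in>C. F = convex hull (C - {v}))"
proof -
  have "(E \<subseteq> C \<and> card E = DIM('a) - 1 + 1) \<longleftrightarrow> (\<exists>v\<in>C. E = C - {v})" for E
  proof
    assume E: "E \<subseteq> C \<and> card E = DIM('a) - 1 + 1"
    then have "card (C - E) = 1"
      using card_C DIM_positive[where 'a='a] finite_C card_Diff_subset[of E C] finite_subset[of E C]
      by simp
    then obtain v where "C - E = {v}" by (auto simp: card_1_singleton_iff)
    then have "v \<in> C" "E = C - {v}" using E by auto
    then show "\<exists>v\<in>C. E = C - {v}" by (rule_tac bexI)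
  next
    assume "\<exists>v\<in>C. E = C - {v}"
    then obtain v where "v \<in> C" "E = C - {v}" by (rule bexE)
    then show "E \<subseteq> C \<and> card E = DIM('a) - 1 + 1"
      using card_C DIM_positive[where 'a='a] finite_C by auto
  qed
  then have "(\<exists>E. (E \<subseteq> C \<and> card E = DIM('a) - 1 + 1) \<and> F = convex hull E) \<longleftrightarrow>
      (\<exists>E. (\<exists>v\<in>C. E = C - {v}) \<and> F = convex hull E)" by (simp only:)
  then show ?thesis unfolding subsimplices_iff[OF subset_refl] conj_assoc by (simp only:) blast
qed

lemma vertices_iff: "{v} \<in> subsimplices 0 (convex hull C) \<longleftrightarrow> v \<in> C"
proof -
  have "(\<exists>E\<subseteq>C. card E = 0 + 1 \<and> {v} = convex hull E) \<longleftrightarrow> v \<in> C"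
  proof
    assume "\<exists>E\<subseteq>C. card E = 0 + 1 \<and> {v} = convex hull E"
    then obtain E where E: "E \<subseteq> C" "card E = 1" "{v} = convex hull E" by auto
    then obtain w where "E = {w}" by (auto simp: card_1_singleton_iff)
    then have "w \<in> C" "{v} = convex hull {w}" using E by auto
    then show "v \<in> C" by simp
  next
    assume "v \<in> C"
    then show "\<exists>E\<subseteq>C. card E = 0 + 1 \<and> {v} = convex hull E" by (intro exI[of _ "{v}"]) auto
  qed
  then show ?thesis unfolding subsimplices_iff[OF subset_refl] .
qed

end

text \<open>Differences from a base vertex \<open>e\<close> other than \<open>v\<close>, at which
  the form must vanish, are linearly independent. A functional may be prescribed on them, and
  \<open>adjoint h 1\<close> is the vector that represents it.\<close>

lemma affine_coords_exist:
  fixes C :: "'a::euclidean_space set"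
  assumes "\<not> affine_dependent C" "card C = DIM('a) + 1"
  obtains G c where "affine_coords C G c"
proof -
  have fin: "finite C" using assms(1) aff_independent_finite by blast
  have "\<exists>g d. \<forall>w\<in>C. g \<bullet> w + d = (if w = v then 1 else 0)" if v: "v \<in> C" for v
  proof -
    have "card C \<ge> 2" using assms(2) DIM_positive[where 'a='a] by linarith
    then have "\<not> C \<subseteq> {v}" using card_mono[of "{v}" C] by auto
    then obtain e where e: "e \<in> C" "e \<noteq> v" by blast
    have "independent ((\<lambda>x. - e + x) ` (C - {e}))"
      using assms(1) affine_dependent_iff_dependent2[OF e(1)] by blast
    from linear_independent_extend[OF this, of "\<lambda>b. if b = - e + v then 1 else (0::real)"]
    obtain h :: "'a \<Rightarrow> real" where h: "linear h"
      "\<forall>b\<in>(\<lambda>x. - e + x) ` (C - {e}). h b = (if b = - e + v then 1 else 0)" by blast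
    define g where "g = adjoint h 1"
    have hx: "h x = g \<bullet> x" for x
      using adjoint_works[OF h(1), of x 1] by (simp add: inner_commute g_def)
    have "g \<bullet> w + (- (g \<bullet> e)) = (if w = v then 1 else 0)" if w: "w \<in> C" for w
    proof (cases "w = e")
      case True then show ?thesis using e by simp
    next
      case False
      then have "- e + w \<in> (\<lambda>x. - e + x) ` (C - {e})" using w by blast
      from h(2)[rule_format, OF this] have "h (- e + w) = (if w = v then 1 else 0)" by simp
      then show ?thesis by (simp only: hx inner_add_right inner_minus_right add.commute)
    qed
    then show ?thesis by (intro exI[of _ g] exI[of _ "- (g \<bullet> e)"] ballI)
  qed
  then have "\<forall>v\<in>C. \<exists>gd. \<forall>w\<in>C. fst gd \<bullet> w + snd gd = (if w = v then 1 else 0)"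
    by (intro ballI) (simp only: split_paired_Ex fst_conv snd_conv)
  from bchoice[OF this] obtain f
    where "\<forall>v\<in>C. \<forall>w\<in>C. fst (f v) \<bullet> w + snd (f v) = (if w = v then 1 else 0)" by (rule exE)
  moreover have "affine hull C = UNIV"
  proof -
    have "aff_dim C = DIM('a)" using aff_dim_affine_independent[OF assms(1)] assms(2) by simp
    then show ?thesis using affine_hull_UNIV by (simp add: aff_dim_eq_full)
  qed
  ultimately have "affine_coords C (\<lambda>v. fst (f v)) (\<lambda>v. snd (f v))" using fin by unfold_locales auto
  then show thesis by (rule that)
qed

section \<open>Integration over faces\<close>

text \<open>The predicate under the choice of a basis in \<open>surface_measure\<close>, named so
  that the properties of the chosen basis can be recovered.\<close>

definition orthonormal_basis_of :: "'a::euclidean_space set \<Rightarrow> 'a set \<Rightarrow> bool" where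
  "orthonormal_basis_of S B \<longleftrightarrow> pairwise orthogonal B \<and> (\<forall>b\<in>B. norm b = 1) \<and> span B = S"

definition frame_map :: "'a::euclidean_space \<Rightarrow> 'a set \<Rightarrow> ('a \<Rightarrow> real) \<Rightarrow> 'a" where
  "frame_map a B t = a + (\<Sum>b\<in>B. t b *\<^sub>R b)"

lemma orthonormal_basis_of_finite:
  assumes "orthonormal_basis_of S B"
  shows "finite B"
proof -
  have "0 \<notin> B" using assms by (auto simp: orthonormal_basis_of_def)
  then show ?thesis
    using assms pairwise_orthogonal_independent independent_imp_finite
    by (auto simp: orthonormal_basis_of_def)
qed

lemma surface_measure_frame:
  assumes "f \<noteq> {}"
  obtains a B where "a \<in> f" "orthonormal_basis_of (tangent_space f) B"
    "surface_measure f = distr (Pi\<^sub>M B (\<lambda>b. lborel)) borel (frame_map a B)"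
proof -
  have 1: "(SOME a. a \<in> f) \<in> f" using assms by (simp add: some_in_eq)
  have "subspace (tangent_space f)" by (simp add: tangent_space_def)
  then obtain B where "orthonormal_basis_of (tangent_space f) B"
    using orthonormal_basis_subspace[of "tangent_space f"] unfolding orthonormal_basis_of_def by metis
  then have 2: "orthonormal_basis_of (tangent_space f) (SOME B. orthonormal_basis_of (tangent_space f) B)"
    by (rule someI)
  show thesis
    by (rule that[OF 1 2]) (simp add: surface_measure_def frame_map_def[abs_def] orthonormal_basis_of_def Let_def)
qed

lemma frame_map_measurable: "frame_map a B \<in> measurable (Pi\<^sub>M B (\<lambda>b. lborel)) borel"
proof -
  have "(\<lambda>t. a + (\<Sum>b\<in>B. t b *\<^sub>R b)) \<in> borel_measurable (Pi\<^sub>M B (\<lambda>b. lborel))"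
    by measurable
  then show ?thesis unfolding frame_map_def[abs_def] .
qed

lemma frame_map_coord:
  assumes "orthonormal_basis_of S B" "b \<in> B"
  shows "(frame_map a B t - a) \<bullet> b = t b"
proof -
  have fin: "finite B" by (rule orthonormal_basis_of_finite[OF assms(1)])
  have "(frame_map a B t - a) \<bullet> b = (\<Sum>b'\<in>B. t b' * (b' \<bullet> b))"
    by (simp add: frame_map_def inner_sum_left)
  also have "\<dots> = (\<Sum>b'\<in>B. if b' = b then t b' else 0)"
  proof (rule sum.cong[OF refl])
    fix b' assume b': "b' \<in> B"
    have "b' \<bullet> b = (if b' = b then 1 else 0)"
    proof (cases "b' = b")
      case True
      have "norm b = 1" using assms by (auto simp: orthonormal_basis_of_def)
      then have "b \<bullet> b = 1" by (simp add: norm_eq_1)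
      then show ?thesis using True by simp
    next
      case False
      have "pairwise orthogonal B" using assms by (simp add: orthonormal_basis_of_def)
      then have "orthogonal b' b" using b' assms(2) False by (rule pairwiseD)
      then show ?thesis using False by (simp add: orthogonal_def)
    qed
    then show "t b' * (b' \<bullet> b) = (if b' = b then t b' else 0)" by simp
  qed
  also have "\<dots> = t b" using fin assms(2) by simp
  finally show ?thesis .
qed

interpretation lborel_product: product_sigma_finite "\<lambda>_. lborel"
  by standard

text \<open>The parameters of a point are inner products with unit vectors, so the preimage of
  \<open>f\<close> under the parametrisation lies in a cube, whose product measure is
  finite.\<close>

lemma surface_measure_compact_finite:
  assumes "compact f"
  shows "emeasure (surface_measure f) f < \<infinity>"
proof (cases "f = {}")
  case False
  then obtain a B where a: "a \<in> f" and B: "orthonormal_basis_of (tangent_space f) B"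
    and S: "surface_measure f = distr (Pi\<^sub>M B (\<lambda>b. lborel)) borel (frame_map a B)"
    by (rule surface_measure_frame)
  note fin = orthonormal_basis_of_finite[OF B]
  obtain R where R: "\<And>x. x \<in> f \<Longrightarrow> norm (x - a) \<le> R"
    using compact_imp_bounded[OF assms] unfolding bounded_any_center[where a=a]
    by (auto simp: dist_norm norm_minus_commute)
  have "emeasure (surface_measure f) f =
      emeasure (Pi\<^sub>M B (\<lambda>b. lborel)) (frame_map a B -` f \<inter> space (Pi\<^sub>M B (\<lambda>b. lborel)))"
    unfolding S by (rule emeasure_distr[OF frame_map_measurable]) (use assms in \<open>simp add: borel_compact\<close>)
  also have "\<dots> \<le> emeasure (Pi\<^sub>M B (\<lambda>b. lborel)) (PiE B (\<lambda>b. {-R..R}))"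
  proof (rule emeasure_mono)
    show "frame_map a B -` f \<inter> space (Pi\<^sub>M B (\<lambda>b. lborel)) \<subseteq> PiE B (\<lambda>b. {-R..R})"
    proof
      fix t assume t: "t \<in> frame_map a B -` f \<inter> space (Pi\<^sub>M B (\<lambda>b. lborel))"
      have "t b \<in> {-R..R}" if b: "b \<in> B" for b
      proof -
        have "\<bar>(frame_map a B t - a) \<bullet> b\<bar> \<le> norm (frame_map a B t - a) * norm b"
          by (rule Cauchy_Schwarz_ineq2)
        also have "\<dots> \<le> R" using R[of "frame_map a B t"] t B b by (simp add: orthonormal_basis_of_def)
        finally show ?thesis unfolding frame_map_coord[OF B b] by auto
      qed
      then show "t \<in> PiE B (\<lambda>b. {-R..R})" using t by (auto simp: space_PiM PiE_iff)
    qed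
  qed (use fin in \<open>auto intro: sets_PiM_I_finite\<close>)
  also have "\<dots> = (\<Prod>b\<in>B. emeasure lborel {-R..R})"
    by (rule lborel_product.emeasure_PiM[OF fin]) simp
  also have "\<dots> < \<infinity>" by (simp add: power_less_top_ennreal emeasure_lborel_Icc_eq)
  finally show ?thesis .
qed simp

lemma sets_surface_measure [simp, measurable_cong]: "sets (surface_measure f) = sets borel"
  by (simp add: surface_measure_def Let_def)

lemma surface_integrable:
  fixes h :: "'a::euclidean_space \<Rightarrow> real"
  assumes "compact f" "continuous_on f h"
  shows "set_integrable (surface_measure f) f h"
proof -
  obtain M where M: "\<And>x. x \<in> f \<Longrightarrow> norm (h x) \<le> M"
    using compact_imp_bounded[OF compact_continuous_image[OF assms(2,1)]]
    unfolding bounded_iff by auto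
  have "(\<lambda>x. indicator f x *\<^sub>R h x) \<in> borel_measurable (surface_measure f)"
    using borel_measurable_continuous_on_indicator[OF borel_compact[OF assms(1)] assms(2)]
    by (simp cong: measurable_cong_sets)
  then show ?thesis unfolding set_integrable_def
    by (intro integrableI_bounded_set[where A=f and B=M])
       (use assms M surface_measure_compact_finite[OF assms(1)] in
         \<open>auto simp: borel_compact indicator_def\<close>)
qed

lemma affine_hull_add_tangent:
  assumes "t \<in> tangent_space f" "x \<in> affine hull f"
  shows "x + t \<in> affine hull f"
  using assms(1) unfolding tangent_space_def
proof (induction rule: span_induct_alt)
  case base then show ?case using assms(2) by simp
next
  case (step k y z)
  then obtain u v where "u \<in> f" "v \<in> f" "y = u - v" by blast
  then have "(x + z) + k *\<^sub>R (u - v) \<in> affine hull f"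
    using step by (intro mem_affine_3_minus affine_affine_hull) (auto intro: hull_inc)
  then show ?case unfolding \<open>y = u - v\<close> by (simp only: ac_simps)
qed

text \<open>A positive value persists nearby, hence at some point of the relative interior, around
  which a whole ball of the affine hull lies in \<open>f\<close>. Its preimage contains a cube of
  positive product measure, which contradicts an integral of zero.\<close>

lemma surface_integral_eq_0:
  fixes h :: "'a::euclidean_space \<Rightarrow> real"
  assumes f: "compact f" "convex f" and h: "continuous_on f h" "\<And>x. x \<in> f \<Longrightarrow> h x \<ge> 0"
    and int: "(LINT x:f|surface_measure f. h x) = 0" and x: "x \<in> f"
  shows "h x = 0"
proof (rule ccontr)
  assume "h x \<noteq> 0"
  then have hx: "h x > 0" using h(2)[OF x] by simp
  have "f \<noteq> {}" using x by auto
  then obtain a B where a: "a \<in> f" and B: "orthonormal_basis_of (tangent_space f) B"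
    and S: "surface_measure f = distr (Pi\<^sub>M B (\<lambda>b. lborel)) borel (frame_map a B)"
    by (rule surface_measure_frame)
  note fin = orthonormal_basis_of_finite[OF B]
  have pos_near: "\<exists>d>0. \<forall>y\<in>f. dist y z < d \<longrightarrow> h y > 0" if z: "z \<in> f" "h z > 0" for z
  proof -
    obtain d where "d > 0" "\<forall>y\<in>f. dist y z < d \<longrightarrow> dist (h y) (h z) < h z"
      using h(1)[unfolded continuous_on_iff, rule_format, OF z] by blast
    then show ?thesis by (intro exI[of _ d]) (auto simp: dist_real_def abs_if split: if_splits)
  qed
  obtain d where d: "d > 0" "\<And>y. y \<in> f \<Longrightarrow> dist y x < d \<Longrightarrow> h y > 0"
    using pos_near[OF x hx] by blast
  have "x \<in> closure (rel_interior f)"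
    using x convex_closure_rel_interior[OF f(2)] closure_subset by blast
  then obtain x1 where x1: "x1 \<in> rel_interior f" "dist x1 x < d"
    using d(1) unfolding closure_approachable by blast
  then have "x1 \<in> f" using rel_interior_subset by blast
  then have "h x1 > 0" using d(2) x1(2) by blast
  from pos_near[OF \<open>x1 \<in> f\<close> this] obtain d1 where d1: "d1 > 0"
    "\<And>y. y \<in> f \<Longrightarrow> dist y x1 < d1 \<Longrightarrow> h y > 0" by blast
  obtain d2 where d2: "d2 > 0" "ball x1 d2 \<inter> affine hull f \<subseteq> f"
    using x1(1) unfolding mem_rel_interior_ball by blast
  define e where "e = min d1 d2"
  have e: "e > 0" "\<And>y. y \<in> affine hull f \<Longrightarrow> dist y x1 < e \<Longrightarrow> y \<in> f \<and> h y > 0"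
  proof -
    show "e > 0" using d1 d2 by (simp add: e_def)
    fix y assume y: "y \<in> affine hull f" "dist y x1 < e"
    then have "y \<in> f" using d2(2) by (auto simp: e_def dist_commute)
    then show "y \<in> f \<and> h y > 0" using d1(2) y by (simp add: e_def)
  qed
  have "x1 - a \<in> span B"
    using B \<open>x1 \<in> f\<close> a by (auto simp: orthonormal_basis_of_def tangent_space_def intro!: span_base)
  then obtain t1 where t1: "(\<Sum>b\<in>B. t1 b *\<^sub>R b) = x1 - a"
    unfolding span_finite[OF fin] by auto
  \<comment> \<open>The \<open>card B\<close> terms of size \<delta> must add up to less than
    \<open>e\<close>; the added 1 keeps the denominator positive when \<open>f\<close> is a point
    and \<open>B\<close> is empty.\<close>
  define \<delta> where "\<delta> = e / (2 * (card B + 1))"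
  have \<delta>: "\<delta> > 0" using e by (simp add: \<delta>_def)
  define U where "U = PiE B (\<lambda>b. {t1 b - \<delta><..<t1 b + \<delta>})"
  have U: "h (frame_map a B t) > 0 \<and> frame_map a B t \<in> f" if t: "t \<in> U" for t
  proof -
    have "(\<Sum>b\<in>B. t b *\<^sub>R b) \<in> span B" by (intro span_sum span_scale span_base)
    then have aff: "frame_map a B t \<in> affine hull f"
      using affine_hull_add_tangent[OF _ hull_inc[OF a]] B by (auto simp: orthonormal_basis_of_def frame_map_def)
    have "frame_map a B t - x1 = (\<Sum>b\<in>B. (t b - t1 b) *\<^sub>R b)"
      using t1 by (simp add: frame_map_def algebra_simps sum_subtractf)
    then have "norm (frame_map a B t - x1) \<le> (\<Sum>b\<in>B. norm ((t b - t1 b) *\<^sub>R b))"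
      by (simp only: norm_sum)
    also have "\<dots> \<le> (\<Sum>b\<in>B. \<delta>)"
    proof (rule sum_mono)
      fix b assume b: "b \<in> B"
      have "norm b = 1" using B b by (auto simp: orthonormal_basis_of_def)
      moreover have "t b \<in> {t1 b - \<delta><..<t1 b + \<delta>}" using t b by (auto simp: U_def)
      ultimately show "norm ((t b - t1 b) *\<^sub>R b) \<le> \<delta>" by auto
    qed
    also have "\<dots> < e"
    proof -
      have "\<delta> * (2 * (real (card B) + 1)) = e"
        unfolding \<delta>_def by (rule nonzero_eq_divide_eq[THEN iffD1]) simp_all
      then have "e = 2 * (real (card B) * \<delta>) + 2 * \<delta>" by (simp only: algebra_simps)
      moreover have "real (card B) * \<delta> \<ge> 0" using \<delta> by simp
      ultimately show ?thesis using \<delta> unfolding sum_constant by linarith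
    qed
    finally show ?thesis using e(2)[OF aff] by (simp add: dist_norm)
  qed
  have "AE x in surface_measure f. indicator f x *\<^sub>R h x = 0"
  proof (subst integral_nonneg_eq_0_iff_AE[symmetric])
    show "integrable (surface_measure f) (\<lambda>x. indicator f x *\<^sub>R h x)"
      using surface_integrable[OF f(1) h(1)] by (simp add: set_integrable_def)
    show "AE x in surface_measure f. 0 \<le> indicator f x *\<^sub>R h x"
      by (rule AE_I2) (use h(2) in \<open>auto simp: indicator_def\<close>)
    show "(LINT x|surface_measure f. indicator f x *\<^sub>R h x) = 0"
      using int by (simp add: set_lebesgue_integral_def)
  qed
  then have "AE t in Pi\<^sub>M B (\<lambda>b. lborel). indicator f (frame_map a B t) *\<^sub>R h (frame_map a B t) = 0"
    unfolding S
  proof (subst (asm) AE_distr_iff[OF frame_map_measurable])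
    have "(\<lambda>x. indicator f x *\<^sub>R h x) \<in> borel_measurable borel"
      by (rule borel_measurable_continuous_on_indicator[OF borel_compact[OF f(1)] h(1)])
    then show "{x \<in> space borel. indicator f x *\<^sub>R h x = 0} \<in> sets borel" by measurable
  qed simp
  then have ae: "AE t in Pi\<^sub>M B (\<lambda>b. lborel). t \<notin> U"
    by eventually_elim (use U in fastforce)
  have "U \<in> sets (Pi\<^sub>M B (\<lambda>b. lborel))"
    unfolding U_def by (intro sets_PiM_I_finite fin) auto
  then have "emeasure (Pi\<^sub>M B (\<lambda>b. lborel)) U = 0"
    using ae AE_iff_null_sets by blast
  moreover have "emeasure (Pi\<^sub>M B (\<lambda>b. lborel)) U = (\<Prod>b\<in>B. emeasure lborel {t1 b - \<delta><..<t1 b + \<delta>})"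
    unfolding U_def by (rule lborel_product.emeasure_PiM[OF fin]) simp
  \<comment> \<open>The measure is a product of lengths \<open>2 * \<delta>\<close>, or the empty
    product 1 over a point.\<close>
  ultimately show False using \<delta> fin by (simp add: prod_zero_iff)
qed

section \<open>Linear forms on polynomial spaces\<close>

definition fun_subspace :: "('a \<Rightarrow> 'b::real_vector) set \<Rightarrow> bool" where
  "fun_subspace S \<longleftrightarrow> (\<lambda>x. 0) \<in> S \<and> (\<forall>p\<in>S. \<forall>q\<in>S. (\<lambda>x. p x + q x) \<in> S) \<and>
     (\<forall>p\<in>S. \<forall>k. (\<lambda>x. k *\<^sub>R p x) \<in> S)"

text \<open>Definiteness has the form that Gram-Schmidt uses: a nonzero \<open>t\<close> allows
  division by \<open>B t t\<close>. Symmetry carries linearity from the second argument to the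
  first.\<close>

definition inner_form_on :: "('a \<Rightarrow> 'b::real_vector) set \<Rightarrow> (('a \<Rightarrow> 'b) \<Rightarrow> ('a \<Rightarrow> 'b) \<Rightarrow> real) \<Rightarrow> bool" where
  "inner_form_on S B \<longleftrightarrow> (\<forall>p\<in>S. \<forall>q\<in>S. B p q = B q p) \<and> (\<forall>r\<in>S. linear_form_on S (B r)) \<and>
     (\<forall>p\<in>S. B p p = 0 \<longrightarrow> p = (\<lambda>x. 0))"

definition spanned_by :: "'i set \<Rightarrow> ('i \<Rightarrow> 'a \<Rightarrow> 'b::real_vector) \<Rightarrow> ('a \<Rightarrow> 'b) set" where
  "spanned_by I e = {p. \<exists>d. \<forall>x. p x = (\<Sum>i\<in>I. d i *\<^sub>R e i x)}"

lemma fun_subspace_zero: "fun_subspace S \<Longrightarrow> (\<lambda>x. 0) \<in> S"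
  and fun_subspace_add: "fun_subspace S \<Longrightarrow> p \<in> S \<Longrightarrow> q \<in> S \<Longrightarrow> (\<lambda>x. p x + q x) \<in> S"
  and fun_subspace_scale: "fun_subspace S \<Longrightarrow> p \<in> S \<Longrightarrow> (\<lambda>x. k *\<^sub>R p x) \<in> S"
  by (auto simp: fun_subspace_def)

lemma fun_subspace_add_scale:
  "fun_subspace S \<Longrightarrow> p \<in> S \<Longrightarrow> q \<in> S \<Longrightarrow> (\<lambda>x. p x + k *\<^sub>R q x) \<in> S"
  by (intro fun_subspace_add fun_subspace_scale)

lemma fun_subspace_diff:
  assumes "fun_subspace S" "p \<in> S" "q \<in> S"
  shows "(\<lambda>x. p x - q x) \<in> S"
  using fun_subspace_add_scale[OF assms, of "-1"] by simp

lemma fun_subspace_spanned_by: "fun_subspace (spanned_by I e)"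
  unfolding fun_subspace_def
proof (intro conjI ballI allI)
  show "(\<lambda>x. 0) \<in> spanned_by I e" by (auto simp: spanned_by_def intro!: exI[of _ "\<lambda>i. 0"])
next
  fix p q assume "p \<in> spanned_by I e" "q \<in> spanned_by I e"
  then obtain d d' where "\<And>x. p x = (\<Sum>i\<in>I. d i *\<^sub>R e i x)" "\<And>x. q x = (\<Sum>i\<in>I. d' i *\<^sub>R e i x)"
    unfolding spanned_by_def by blast
  then show "(\<lambda>x. p x + q x) \<in> spanned_by I e"
    by (auto simp: spanned_by_def scaleR_add_left sum.distrib intro!: exI[of _ "\<lambda>i. d i + d' i"])
next
  fix p k assume "p \<in> spanned_by I e"
  then obtain d where "\<And>x. p x = (\<Sum>i\<in>I. d i *\<^sub>R e i x)" unfolding spanned_by_def by blast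
  then show "(\<lambda>x. k *\<^sub>R p x) \<in> spanned_by I e"
    by (auto simp: spanned_by_def scaleR_sum_right intro!: exI[of _ "\<lambda>i. k * d i"])
qed

lemma fun_subspace_Int: "fun_subspace S \<Longrightarrow> fun_subspace S' \<Longrightarrow> fun_subspace (S \<inter> S')"
  by (auto simp: fun_subspace_def)

lemma linear_form_add: "linear_form_on S L \<Longrightarrow> p \<in> S \<Longrightarrow> q \<in> S \<Longrightarrow> L (\<lambda>x. p x + q x) = L p + L q"
  and linear_form_scale: "linear_form_on S L \<Longrightarrow> p \<in> S \<Longrightarrow> L (\<lambda>x. k *\<^sub>R p x) = k * L p"
  by (auto simp: linear_form_on_def)

lemma linear_form_add_scale:
  assumes "fun_subspace S" "linear_form_on S L" "p \<in> S" "q \<in> S"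
  shows "L (\<lambda>x. p x + k *\<^sub>R q x) = L p + k * L q"
  unfolding linear_form_add[OF assms(2,3) fun_subspace_scale[OF assms(1,4)]] linear_form_scale[OF assms(2,4)] ..

lemma linear_form_diff:
  assumes "fun_subspace S" "linear_form_on S L" "p \<in> S" "q \<in> S"
  shows "L (\<lambda>x. p x - q x) = L p - L q"
  using linear_form_add_scale[OF assms, of "-1"] by simp

lemma linear_form_mono: "linear_form_on S L \<Longrightarrow> S' \<subseteq> S \<Longrightarrow> linear_form_on S' L"
  by (auto simp: linear_form_on_def subset_iff)

lemma inner_form_mono:
  assumes "inner_form_on S B" "S' \<subseteq> S"
  shows "inner_form_on S' B"
proof -
  note B = assms(1)[unfolded inner_form_on_def] and S = subsetD[OF assms(2)]
  show ?thesis unfolding inner_form_on_def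
  proof (intro conjI ballI)
    fix p q assume "p \<in> S'" "q \<in> S'"
    then show "B p q = B q p" by (intro B[THEN conjunct1, rule_format] S)
  next
    fix r assume "r \<in> S'"
    then show "linear_form_on S' (B r)"
      by (intro linear_form_mono[OF _ assms(2)] B[THEN conjunct2, THEN conjunct1, rule_format] S)
  next
    fix p assume "p \<in> S'"
    then show "B p p = 0 \<longrightarrow> p = (\<lambda>x. 0)"
      by (intro B[THEN conjunct2, THEN conjunct2, THEN bspec] S)
  qed
qed

text \<open>Induction on the generators: the subspace \<open>S'\<close> spanned without the new
  generator has codimension at most one, and Gram-Schmidt supplies the missing direction. This takes
  the place of a comparison of dimensions in the existence arguments.\<close>

lemma riesz_representation:
  assumes "finite I"
  shows "fun_subspace S \<Longrightarrow> S \<subseteq> spanned_by I e \<Longrightarrow> inner_form_on S B \<Longrightarrow> linear_form_on S L \<Longrightarrow>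
    \<exists>u\<in>S. \<forall>q\<in>S. B u q = L q"
  using assms
proof (induction I arbitrary: S L rule: finite_induct)
  case empty
  have S: "q = (\<lambda>x. 0)" if "q \<in> S" for q
    using empty.prems(2) that by (auto simp: spanned_by_def)
  have z: "(\<lambda>x. 0) \<in> S" by (rule fun_subspace_zero[OF empty.prems(1)])
  have M: "M (\<lambda>x. 0) = 0" if "linear_form_on S M" for M
    using linear_form_scale[OF that z, of 0] by simp
  have "linear_form_on S (B (\<lambda>x. 0))"
    using empty.prems(3)[unfolded inner_form_on_def, THEN conjunct2, THEN conjunct1] z by (rule bspec)
  from M[OF this] M[OF empty.prems(4)] have "B (\<lambda>x. 0) (\<lambda>x. 0) = L (\<lambda>x. 0)" by (rule trans[OF _ sym])
  then have "B (\<lambda>x. 0) q = L q" if "q \<in> S" for q unfolding S[OF that] .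
  then show ?case by (intro bexI[OF _ z] ballI)
next
  case (insert i I)
  define S' where "S' = S \<inter> spanned_by I e"
  note sub = insert.prems(1)
  have sub': "fun_subspace S'" unfolding S'_def
    by (intro fun_subspace_Int sub fun_subspace_spanned_by)
  have S'S: "S' \<subseteq> S" and S'e: "S' \<subseteq> spanned_by I e" by (auto simp: S'_def)
  note B' = inner_form_mono[OF insert.prems(3) S'S]
  note IH = insert.IH[OF sub' S'e B']
  have Bsym: "B p q = B q p" if "p \<in> S" "q \<in> S" for p q
    using insert.prems(3) that by (simp add: inner_form_on_def)
  have Blin: "linear_form_on S (B r)" if "r \<in> S" for r
    using insert.prems(3) that by (simp add: inner_form_on_def)
  show ?case
  proof (cases "S = S'")
    case True
    then show ?thesis using IH[OF linear_form_mono[OF insert.prems(4) S'S]] by (simp only: True[symmetric])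
  next
    case False
    then obtain s where s: "s \<in> S" "s \<notin> S'" using S'S by blast
    have decomp: "\<exists>k r. r \<in> spanned_by I e \<and> p = (\<lambda>x. k *\<^sub>R e i x + r x)" if p: "p \<in> S" for p
    proof -
      obtain d where d: "\<And>x. p x = (\<Sum>j\<in>insert i I. d j *\<^sub>R e j x)"
        using insert.prems(2) p unfolding spanned_by_def by blast
      have "(\<lambda>x. \<Sum>j\<in>I. d j *\<^sub>R e j x) \<in> spanned_by I e"
        unfolding spanned_by_def by (intro CollectI exI[of _ d] allI refl)
      moreover have "p = (\<lambda>x. d i *\<^sub>R e i x + (\<Sum>j\<in>I. d j *\<^sub>R e j x))"
        by (rule ext) (subst d, simp add: insert.hyps)
      ultimately show ?thesis by (intro exI conjI)
    qed
    obtain ks rs where ks: "rs \<in> spanned_by I e" "s = (\<lambda>x. ks *\<^sub>R e i x + rs x)"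
      using decomp[OF s(1)] by (elim exE conjE)
    \<comment> \<open>\<open>s\<close> lies outside \<open>S'\<close>, so it involves the new
      generator; dividing by its coefficient \<open>ks\<close> writes every element of
      \<open>S\<close> as an element of \<open>S'\<close> plus a multiple of
      \<open>s\<close>.\<close>
    have "ks \<noteq> 0"
    proof
      assume "ks = 0"
      then have "s = rs" by (simp add: ks(2))
      then show False using ks(1) s by (simp add: S'_def)
    qed
    have split: "\<exists>k. \<exists>q\<in>S'. p = (\<lambda>x. q x + k *\<^sub>R s x)" if p: "p \<in> S" for p
    proof -
      obtain kp rp where kp: "rp \<in> spanned_by I e" "p = (\<lambda>x. kp *\<^sub>R e i x + rp x)"
        using decomp[OF p] by (elim exE conjE)
      define k where "k = kp / ks"
      have "(\<lambda>x. p x + (- k) *\<^sub>R s x) \<in> S"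
        by (rule fun_subspace_add_scale[OF sub p s(1)])
      moreover have "(\<lambda>x. p x + (- k) *\<^sub>R s x) = (\<lambda>x. rp x + (- k) *\<^sub>R rs x)"
        using \<open>ks \<noteq> 0\<close> by (simp add: kp(2) ks(2) k_def scaleR_add_right)
      moreover have "(\<lambda>x. rp x + (- k) *\<^sub>R rs x) \<in> spanned_by I e"
        by (rule fun_subspace_add_scale[OF fun_subspace_spanned_by kp(1) ks(1)])
      ultimately have "(\<lambda>x. p x + (- k) *\<^sub>R s x) \<in> S'" by (simp add: S'_def)
      then show ?thesis by (intro exI[of _ k] bexI[of _ "\<lambda>x. p x + (- k) *\<^sub>R s x"]) simp_all
    qed
    \<comment> \<open>\<open>w\<close> is the orthogonal projection of \<open>s\<close> to
      \<open>S'\<close>, so that \<open>s - w\<close> is orthogonal to \<open>S'\<close>.\<close>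
    obtain w where w: "w \<in> S'" "\<And>q. q \<in> S' \<Longrightarrow> B w q = B s q"
      using IH[OF linear_form_mono[OF Blin[OF s(1)] S'S]] by blast
    define t where "t = (\<lambda>x. s x - w x)"
    have wS: "w \<in> S" using w S'S by blast
    have tS: "t \<in> S" unfolding t_def by (rule fun_subspace_diff[OF sub s(1) wS])
    have t0: "B t q = 0" if "q \<in> S'" for q
    proof -
      have q: "q \<in> S" using that S'S by blast
      have "B q t = B q s - B q w"
        unfolding t_def by (rule linear_form_diff[OF sub Blin[OF q] s(1) wS])
      then show ?thesis using w(2)[OF that] Bsym[OF q tS] Bsym[OF q s(1)] Bsym[OF q wS] by simp
    qed
    have Bts: "B t s = B t t"
    proof -
      have "B t t = B t s - B t w"
        by (subst (2) t_def) (rule linear_form_diff[OF sub Blin[OF tS] s(1) wS])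
      then show ?thesis using t0[OF w(1)] by simp
    qed
    have "B t t \<noteq> 0"
    proof
      assume "B t t = 0"
      then have "t = (\<lambda>x. 0)" using insert.prems(3) tS by (simp add: inner_form_on_def)
      then have "s = w" by (simp add: t_def fun_eq_iff)
      then show False using s w by simp
    qed
    obtain u0 where u0: "u0 \<in> S'" "\<And>q. q \<in> S' \<Longrightarrow> B u0 q = L q"
      using IH[OF linear_form_mono[OF insert.prems(4) S'S]] by blast
    have u0S: "u0 \<in> S" using u0 S'S by blast
    \<comment> \<open>Adding \<open>k *\<^sub>R t\<close> leaves the values on \<open>S'\<close>
      alone and makes the value at \<open>s\<close> equal to \<open>L s\<close>, because
      \<open>B t s = B t t\<close>.\<close>
    define k where "k = (L s - B u0 s) / B t t"
    define u where "u = (\<lambda>x. u0 x + k *\<^sub>R t x)"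
    have uS: "u \<in> S" unfolding u_def by (rule fun_subspace_add_scale[OF sub u0S tS])
    have Bu: "B u q = B u0 q + k * B t q" if q: "q \<in> S" for q
      using linear_form_add_scale[OF sub Blin[OF q] u0S tS, of k]
        Bsym[OF q uS] Bsym[OF q u0S] Bsym[OF q tS] by (simp add: u_def)
    have Bus: "B u s = L s" using Bu[OF s(1)] \<open>B t t \<noteq> 0\<close> by (simp add: Bts k_def)
    have "B u p = L p" if p: "p \<in> S" for p
    proof -
      obtain l q where q: "q \<in> S'" "p = (\<lambda>x. q x + l *\<^sub>R s x)" using split[OF p] by (elim exE bexE)
      have qS: "q \<in> S" using q S'S by blast
      have "B u p = B u q + l * B u s" unfolding q(2)
        by (rule linear_form_add_scale[OF sub Blin[OF uS] qS s(1)])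
      moreover have "L p = L q + l * L s" unfolding q(2)
        by (rule linear_form_add_scale[OF sub insert.prems(4) qS s(1)])
      moreover have "B u q = L q" using Bu[OF qS] t0[OF q(1)] u0(2)[OF q(1)] by simp
      ultimately show ?thesis using Bus by simp
    qed
    then show ?thesis using uS by blast
  qed
qed

section \<open>Polynomial spaces as finitely generated subspaces\<close>

lemma poly_space_memI:
  "poly_deg_le k p \<Longrightarrow> (\<And>x. x \<in> f \<Longrightarrow> p x \<in> V) \<Longrightarrow> (\<lambda>x. if x \<in> f then p x else 0) \<in> poly_space k f V"
  unfolding poly_space_def by blast

lemma poly_space_memE:
  assumes "q \<in> poly_space k f V"
  obtains p where "poly_deg_le k p" "\<forall>x\<in>f. p x \<in> V" "q = (\<lambda>x. if x \<in> f then p x else 0)"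
  using assms unfolding poly_space_def by blast

lemma poly_space_subspace:
  assumes "subspace V"
  shows "fun_subspace (poly_space k f V)"
  unfolding fun_subspace_def
proof (intro conjI ballI allI)
  show "(\<lambda>x. 0) \<in> poly_space k f V"
    using poly_space_memI[OF poly_deg_le_zero, of f V k] assms by (simp add: subspace_0)
next
  fix p q assume pq: "p \<in> poly_space k f V" "q \<in> poly_space k f V"
  obtain p' where
    p': "poly_deg_le k p'" "\<forall>x\<in>f. p' x \<in> V" "p = (\<lambda>x. if x \<in> f then p' x else 0)"
    using pq(1) by (rule poly_space_memE)
  obtain q' where
    q': "poly_deg_le k q'" "\<forall>x\<in>f. q' x \<in> V" "q = (\<lambda>x. if x \<in> f then q' x else 0)"
    using pq(2) by (rule poly_space_memE)
  have "(\<lambda>x. if x \<in> f then p' x + q' x else 0) \<in> poly_space k f V"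
    by (rule poly_space_memI[OF poly_deg_le_add[OF p'(1) q'(1)]])
       (intro subspace_add[OF assms] p'(2)[rule_format] q'(2)[rule_format])
  moreover have "(\<lambda>x. if x \<in> f then p' x + q' x else 0) = (\<lambda>x. p x + q x)"
    by (auto simp: p'(3) q'(3))
  ultimately show "(\<lambda>x. p x + q x) \<in> poly_space k f V" by simp
next
  fix p c assume "p \<in> poly_space k f V"
  then obtain p' where
    p': "poly_deg_le k p'" "\<forall>x\<in>f. p' x \<in> V" "p = (\<lambda>x. if x \<in> f then p' x else 0)"
    by (rule poly_space_memE)
  have "poly_deg_le k (\<lambda>x. c *\<^sub>R p' x)" using p'(1) unfolding poly_deg_le_iff by (rule deg_below_scaleR)
  then have "(\<lambda>x. if x \<in> f then c *\<^sub>R p' x else 0) \<in> poly_space k f V"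
    by (rule poly_space_memI) (intro subspace_scale[OF assms] p'(2)[rule_format])
  moreover have "(\<lambda>x. if x \<in> f then c *\<^sub>R p' x else 0) = (\<lambda>x. c *\<^sub>R p x)"
    by (auto simp: p'(3))
  ultimately show "(\<lambda>x. c *\<^sub>R p x) \<in> poly_space k f V" by simp
qed

definition monomial_index :: "int \<Rightarrow> (('n::finite \<Rightarrow> nat) \<times> 'b::euclidean_space) set" where
  "monomial_index k = {\<alpha>. int (\<Sum>i\<in>UNIV. \<alpha> i) \<le> k} \<times> Basis"

lemma finite_monomial_index: "finite (monomial_index k)"
  unfolding monomial_index_def by (intro finite_cartesian_product finite_multiindices finite_Basis)

lemma poly_space_spanned:
  "poly_space k f V \<subseteq> spanned_by (monomial_index k)
     (\<lambda>z x. if x \<in> f then (\<Prod>i\<in>UNIV. ((x::real^'n) $ i) ^ fst z i) *\<^sub>R (snd z :: 'b::euclidean_space) else 0)"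
proof
  fix q :: "real^'n \<Rightarrow> 'b" assume "q \<in> poly_space k f V"
  then obtain p where p: "poly_deg_le k p" "\<forall>x\<in>f. p x \<in> V" "q = (\<lambda>x. if x \<in> f then p x else 0)"
    by (rule poly_space_memE)
  from poly_deg_le_finite_span[OF p(1)] obtain d where
    "\<forall>x. p x = (\<Sum>z\<in>monomial_index k. d z *\<^sub>R ((\<Prod>i\<in>UNIV. (x $ i) ^ fst z i) *\<^sub>R snd z))"
    unfolding monomial_index_def by (rule exE)
  then show "q \<in> spanned_by (monomial_index k)
     (\<lambda>z x. if x \<in> f then (\<Prod>i\<in>UNIV. (x $ i) ^ fst z i) *\<^sub>R snd z else 0)"
    unfolding spanned_by_def p(3) by (intro CollectI exI[of _ d]) simp
qed

lemma poly_space_continuous: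
  fixes q :: "real^'n \<Rightarrow> 'b::real_normed_vector"
  assumes "q \<in> poly_space k f V"
  shows "continuous_on f q"
proof -
  obtain p where p: "poly_deg_le k p" "\<forall>x\<in>f. p x \<in> V" "q = (\<lambda>x. if x \<in> f then p x else 0)"
    using assms by (rule poly_space_memE)
  have "continuous_on f p" using p(1) unfolding poly_deg_le_iff by (rule deg_below_continuous)
  then show ?thesis by (rule continuous_on_eq) (simp add: p(3))
qed

lemma poly_space_outside: "q \<in> poly_space k f V \<Longrightarrow> x \<notin> f \<Longrightarrow> q x = 0"
  by (elim poly_space_memE) simp

lemma riesz_poly_space:
  fixes S :: "(real^'n \<Rightarrow> 'b::euclidean_space) set"
  assumes "fun_subspace S" "S \<subseteq> poly_space k f V" "inner_form_on S B" "linear_form_on S L"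
  shows "\<exists>u\<in>S. \<forall>q\<in>S. B u q = L q"
  by (rule riesz_representation[OF finite_monomial_index assms(1) order_trans[OF assms(2) poly_space_spanned] assms(3,4)])

section \<open>Polynomials with vanishing moments\<close>

text \<open>The relative interior is dense in a convex set. This extends cancellations that are
  valid only where a bubble is positive to the whole face.\<close>

lemma continuous_zero_on_rel_interior:
  fixes g :: "'a::euclidean_space \<Rightarrow> 'b::real_normed_vector"
  assumes "convex K" "closed K" "continuous_on K g" "\<And>x. x \<in> rel_interior K \<Longrightarrow> g x = 0" "x \<in> K"
  shows "g x = 0"
proof -
  have c: "closure (rel_interior K) = K"
    using convex_closure_rel_interior[OF assms(1)] assms(2) by simp
  have "g ` closure (rel_interior K) \<subseteq> {0}"
    by (rule image_closure_subset) (use assms c in auto)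
  then show ?thesis using assms(5) c by auto
qed

context affine_coords
begin

definition face_bubble :: "'a set \<Rightarrow> 'a \<Rightarrow> real" where
  "face_bubble E x = (\<Prod>w\<in>E. bary w x)"

lemma bary_continuous [continuous_intros]: "continuous_on S (bary v)"
  unfolding bary_def[abs_def] by (intro continuous_intros)

lemma face_bubble_continuous [continuous_intros]: "continuous_on S (face_bubble E)"
  unfolding face_bubble_def[abs_def] by (intro continuous_intros)

lemma face_bubble_nonneg: "E \<subseteq> C \<Longrightarrow> x \<in> convex hull E \<Longrightarrow> face_bubble E x \<ge> 0"
  unfolding face_bubble_def by (intro prod_nonneg ballI) (simp add: mem_face_iff)

lemma face_bubble_pos:
  "E \<subseteq> C \<Longrightarrow> x \<in> rel_interior (convex hull E) \<Longrightarrow> face_bubble E x > 0"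
  unfolding face_bubble_def by (intro prod_pos ballI rel_interior_face_pos)

lemma face_bubble_zero:
  assumes "E \<subseteq> C" "E' \<subseteq> C" "\<not> E \<subseteq> E'" "x \<in> convex hull E'"
  shows "face_bubble E x = 0"
proof -
  obtain w where w: "w \<in> E" "w \<notin> E'" using assms(3) by blast
  then have "bary w x = 0" using mem_face_iff[OF assms(2), of x] assms(1,4) by blast
  then show ?thesis unfolding face_bubble_def
    using w(1) finite_subset[OF assms(1) finite_C] by (intro prod_zero) auto
qed

lemma compact_face: "E \<subseteq> C \<Longrightarrow> compact (convex hull E)"
  using finite_C finite_subset finite_imp_compact_convex_hull by blast

end

lemma deg_below_mult_bary:
  fixes C :: "(real^'n) set"
  assumes "affine_coords C G c" "deg_below k p"
  shows "deg_below (Suc k) (\<lambda>x. affine_coords.bary G c v x *\<^sub>R p x)"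
proof -
  interpret affine_coords C G c by fact
  have "linear (\<lambda>x. G v \<bullet> x)" by (simp add: linear_iff inner_add_right)
  from deg_below_mult_affine[OF this assms(2)] show ?thesis by (simp add: bary_def)
qed

lemma deg_below_mult_bubble:
  fixes C :: "(real^'n) set"
  assumes "affine_coords C G c" "deg_below k p" "finite E"
  shows "deg_below (k + card E) (\<lambda>x. affine_coords.face_bubble G c E x *\<^sub>R p x)"
proof -
  interpret affine_coords C G c by fact
  show ?thesis using assms(3)
  proof (induction E rule: finite_induct)
    case empty then show ?case using assms(2) by (simp add: face_bubble_def)
  next
    case (insert w E)
    from deg_below_mult_bary[OF assms(1) insert.IH, of w] insert.hyps show ?case
      by (simp add: face_bubble_def)
  qed
qed

text \<open>The barycentric coordinates are split off one at a time. The cofactor reached so far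
  vanishes on the facet opposite the next vertex \<open>w\<close>: the factors already removed are
  positive in its relative interior, and continuity does the rest. When \<open>card E\<close> is at
  least \<open>k\<close>, the truncated bound makes the cofactor zero.\<close>

lemma face_bubble_divides:
  fixes C :: "(real^'n) set" and u :: "real^'n \<Rightarrow> 'b::real_normed_vector"
  assumes co: "affine_coords C G c" and E: "E \<subseteq> C" "card E \<ge> 2" and u: "deg_below k u"
    and zero: "\<And>w x. w \<in> E \<Longrightarrow> x \<in> convex hull (E - {w}) \<Longrightarrow> u x = 0"
  shows "\<exists>g. deg_below (k - card E) g \<and>
    (\<forall>x\<in>convex hull E. u x = affine_coords.face_bubble G c E x *\<^sub>R g x)"
proof -
  interpret affine_coords C G c by fact
  have fin: "finite E" using E(1) finite_C finite_subset by blast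
  have "\<exists>g. deg_below (k - card D) g \<and> (\<forall>x\<in>convex hull E. u x = face_bubble D x *\<^sub>R g x)"
    if "finite D" "D \<subseteq> E" for D
    using that
  proof (induction D rule: finite_induct)
    case empty
    then show ?case using u by (intro exI[of _ u]) (simp add: face_bubble_def)
  next
    case (insert w D)
    obtain g where g: "deg_below (k - card D) g"
      "\<And>x. x \<in> convex hull E \<Longrightarrow> u x = face_bubble D x *\<^sub>R g x"
      using insert.IH insert.prems by (auto)
    have w: "w \<in> E" "w \<notin> D" using insert.prems insert.hyps by auto
    have Ew: "E - {w} \<subseteq> C" using E(1) by auto
    have gz: "g x = 0" if "x \<in> convex hull (E - {w})" for x
    proof (rule continuous_zero_on_rel_interior[OF convex_convex_hull _ _ _ that])
      show "closed (convex hull (E - {w}))" using compact_face[OF Ew] by (rule compact_imp_closed)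
      show "continuous_on (convex hull (E - {w})) g" by (rule deg_below_continuous[OF g(1)])
      fix y assume y: "y \<in> rel_interior (convex hull (E - {w}))"
      then have y': "y \<in> convex hull (E - {w})" using rel_interior_subset by blast
      then have "u y = 0" by (rule zero[OF w(1)])
      moreover have "y \<in> convex hull E" using y' hull_mono[of "E - {w}" E] by auto
      moreover have "face_bubble D y > 0" unfolding face_bubble_def
      proof (intro prod_pos ballI)
        fix v assume "v \<in> D"
        then have "v \<in> E - {w}" using insert.prems w by auto
        then show "0 < bary v y" by (rule rel_interior_face_pos[OF Ew y])
      qed
      ultimately show "g y = 0" using g(2)[of y] by simp
    qed
    have "\<not> E \<subseteq> {w}" using E(2) card_mono[of "{w}" E] by auto
    then obtain w' where w': "w' \<in> E" "w' \<noteq> w" by blast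
    have "linear (\<lambda>x. G w \<bullet> x)" by (simp add: linear_iff inner_add_right)
    \<comment> \<open>The form of \<open>w\<close> has slope 1 along \<open>w - w'\<close>. For a
      point of the face the shift passes the weight of \<open>w\<close> to \<open>w'\<close>, so it
      ends in the opposite facet, where \<open>g\<close> vanishes.\<close>
    from deg_below_divide_affine[OF this g(1), of "c w" "w - w'"] obtain q where
      q: "deg_below (k - card D - 1) q"
      "\<forall>x. g x = g (x - (G w \<bullet> x + c w) *\<^sub>R (w - w')) + (G w \<bullet> x + c w) *\<^sub>R q x"
      by (elim exE conjE)
    have gq: "g x = bary w x *\<^sub>R q x" if x: "x \<in> convex hull E" for x
    proof -
      define y where "y = x - bary w x *\<^sub>R (w - w')"
      have xE: "\<And>v. v \<in> E \<Longrightarrow> 0 \<le> bary v x" "\<And>v. v \<in> C - E \<Longrightarrow> bary v x = 0"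
        using x mem_face_iff[OF E(1)] by auto
      have bary_y: "bary v y = bary v x - bary w x * (bary v w - bary v w')" for v
        by (simp add: y_def bary_def inner_diff_right)
      have delta: "bary v z = (if z = v then 1 else 0)" if "v \<in> C" "z \<in> E" for v z
        using bary_vertex[of v z] that E(1) by auto
      have "y \<in> convex hull (E - {w})"
        unfolding mem_face_iff[OF Ew]
      proof (intro conjI ballI)
        fix v assume v: "v \<in> E - {w}"
        then have vC: "v \<in> C" using E(1) by auto
        show "0 \<le> bary v y"
          unfolding bary_y delta[OF vC w(1)] delta[OF vC w'(1)] using v xE(1)[of v] xE(1)[OF w(1)] by auto
      next
        fix v assume v: "v \<in> C - (E - {w})"
        then have vC: "v \<in> C" by auto
        show "bary v y = 0"
        proof (cases "v = w")
          case True
          then show ?thesis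
            unfolding bary_y delta[OF vC w(1)] delta[OF vC w'(1)] using w'(2) by simp
        next
          case False
          then have "v \<notin> E" using v by blast
          then have "bary v x = 0" "v \<noteq> w'" using xE(2)[of v] vC w'(1) by auto
          then show ?thesis
            unfolding bary_y delta[OF vC w(1)] delta[OF vC w'(1)] using False by simp
        qed
      qed
      then have "g y = 0" by (rule gz)
      moreover have "g x = g y + bary w x *\<^sub>R q x" unfolding y_def bary_def by (rule q(2)[rule_format])
      ultimately show ?thesis by simp
    qed
    show ?case
    proof (intro exI[of _ q] conjI ballI)
      show "deg_below (k - card (insert w D)) q" using q(1) insert.hyps by simp
      fix x assume x: "x \<in> convex hull E"
      show "u x = face_bubble (insert w D) x *\<^sub>R q x"
        unfolding g(2)[OF x] gq[OF x] using insert.hyps by (simp add: face_bubble_def mult.commute)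
    qed
  qed
  from this[OF fin subset_refl] show ?thesis .
qed

text \<open>Degree at most \<open>r - (l + 1)\<close> is \<open>deg_below (r - l)\<close>, and
  truncation for \<open>r \<le> l\<close> matches the trivial moment space of negative
  degree.\<close>

lemma moment_space_memI:
  assumes "deg_below (r - l) g"
  shows "(\<lambda>x. if x \<in> f then g x else 0) \<in> moment_space r l f"
proof (rule poly_space_memI)
  have "nat (int r - (int l + 1) + 1) = r - l" by simp
  then show "poly_deg_le (int r - (int l + 1)) g" unfolding poly_deg_le_iff using assms by (simp only:)
qed simp

lemma moment_space_memE:
  assumes "q \<in> moment_space r l f"
  obtains g where "deg_below (r - l) g" "q = (\<lambda>x. if x \<in> f then g x else 0)"
proof -
  obtain g where g: "poly_deg_le (int r - (int l + 1)) g" "\<forall>x\<in>f. g x \<in> UNIV" "q = (\<lambda>x. if x \<in> f then g x else 0)"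
    using assms by (rule poly_space_memE)
  have "nat (int r - (int l + 1) + 1) = r - l" by simp
  then have "deg_below (r - l) g" using g(1) unfolding poly_deg_le_iff by (simp only:)
  then show thesis using g(3) by (rule that)
qed

text \<open>Strong induction over the vertex sets of the faces. The degree of the cofactor on
  \<open>E\<close>, at most \<open>r - card E\<close>, is precisely what the moments over a face of
  dimension \<open>card E - 1\<close> test.\<close>

lemma moments_zero_imp_zero:
  fixes C :: "(real^'n) set" and u :: "real^'n \<Rightarrow> real^'n"
  assumes co: "affine_coords C G c" and E0: "E0 \<subseteq> C" and u: "deg_below (r + 1) u"
    and vert: "\<And>v. v \<in> E0 \<Longrightarrow> u v = 0"
    and mom: "\<And>E q. E \<subseteq> E0 \<Longrightarrow> card E \<ge> 2 \<Longrightarrow> q \<in> moment_space r (card E - 1) (convex hull E) \<Longrightarrow>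
      (LINT x:convex hull E|surface_measure (convex hull E). u x \<bullet> q x) = 0"
    and x: "x \<in> convex hull E0"
  shows "u x = 0"
proof -
  interpret affine_coords C G c by fact
  have fin0: "finite E0" using E0 finite_C finite_subset by blast
  have "\<forall>x\<in>convex hull E. u x = 0" if "E \<subseteq> E0" for E
    using finite_subset[OF that fin0] that
  proof (induction E rule: finite_psubset_induct)
    case (psubset E)
    have EC: "E \<subseteq> C" using psubset.prems E0 by auto
    consider "E = {}" | v where "E = {v}" | "card E \<ge> 2"
      using psubset.hyps by (metis One_nat_def Suc_leI card_1_singletonE card_gt_0_iff le_neq_implies_less numeral_2_eq_2)
    then show ?case
    proof cases
      case 1 then show ?thesis by simp
    next
      case 2
      then show ?thesis using vert psubset.prems by simp
    next
      case 3
      have zero: "u y = 0" if "w \<in> E" "y \<in> convex hull (E - {w})" for w y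
        using psubset.IH[of "E - {w}"] that psubset.prems by blast
      have "\<exists>g. deg_below (r + 1 - card E) g \<and> (\<forall>x\<in>convex hull E. u x = face_bubble E x *\<^sub>R g x)"
        by (rule face_bubble_divides[OF co EC 3 u]) (rule zero)
      then obtain g where
        g: "deg_below (r + 1 - card E) g" "\<forall>x\<in>convex hull E. u x = face_bubble E x *\<^sub>R g x"
        by (elim exE conjE)
      have "r + 1 - card E = r - (card E - 1)" using 3 by simp
      then have "deg_below (r - (card E - 1)) g" using g(1) by (simp only:)
      then have q: "(\<lambda>x. if x \<in> convex hull E then g x else 0) \<in> moment_space r (card E - 1) (convex hull E)"
        by (rule moment_space_memI)
      \<comment> \<open>Tested with its own cofactor, \<open>u\<close> gives a nonnegative
        integrand, which must vanish pointwise. At each point the bubble or the cofactor is then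
        zero, and \<open>u\<close> with it.\<close>
      have "(LINT x:convex hull E|surface_measure (convex hull E). face_bubble E x * (g x \<bullet> g x)) =
          (LINT x:convex hull E|surface_measure (convex hull E).
             u x \<bullet> (if x \<in> convex hull E then g x else 0))"
        by (rule set_lebesgue_integral_cong)
           (use g(2) borel_compact[OF compact_face[OF EC]] in auto)
      also have "\<dots> = 0" by (rule mom[OF psubset.prems 3 q])
      finally have int: "(LINT x:convex hull E|surface_measure (convex hull E).
          face_bubble E x * (g x \<bullet> g x)) = 0" .
      show ?thesis
      proof
        fix y assume y: "y \<in> convex hull E"
        have "face_bubble E y * (g y \<bullet> g y) = 0"
          by (rule surface_integral_eq_0[OF compact_face[OF EC] convex_convex_hull _ _ int y])
             (auto intro!: continuous_intros deg_below_continuous[OF g(1)] mult_nonneg_nonneg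
               face_bubble_nonneg[OF EC])
        then show "u y = 0" using g(2) y by auto
      qed
    qed
  qed
  then show ?thesis using x by blast
qed

section \<open>Dependence of the moments on the normal and on the field\<close>

lemma matrix_vector_add_scaleR:
  fixes A :: "real^'n^'m"
  shows "A *v (x + k *\<^sub>R y) = A *v x + k *\<^sub>R (A *v y)"
  by (simp add: matrix_vector_right_distrib scaleR_matrix_vector_assoc[symmetric] matrix_vector_mult_scaleR)

lemma linear_matrix_vector_left: "linear (\<lambda>A :: real^'n^'m. A *v x)"
  by (simp add: linear_iff matrix_vector_mult_add_rdistrib scaleR_matrix_vector_assoc)

lemma moment_integrable:
  fixes A :: "real^'n \<Rightarrow> real^'n^'n"
  assumes "compact f" "continuous_on f A" "continuous_on f q"
  shows "set_integrable (surface_measure f) f (\<lambda>x. (A x *v \<nu>) \<bullet> q x)"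
proof (rule surface_integrable[OF assms(1)])
  have "continuous_on f (\<lambda>x. A x *v \<nu>)"
    using linear_continuous_on_compose[OF assms(2) linear_matrix_vector_left] by simp
  then show "continuous_on f (\<lambda>x. (A x *v \<nu>) \<bullet> q x)"
    by (rule continuous_on_inner[OF _ assms(3)])
qed

lemma normal_moment_add_scale_normal:
  assumes "compact f" "continuous_on f A" "continuous_on f q"
  shows "normal_moment f (\<mu> + k *\<^sub>R \<nu>) A q = normal_moment f \<mu> A q + k * normal_moment f \<nu> A q"
  using set_integral_add(2)[OF moment_integrable[OF assms, of \<mu>]
      set_integrable_mult_right[of k, OF moment_integrable[OF assms, of \<nu>]]]
  unfolding normal_moment_def by (simp add: matrix_vector_add_scaleR inner_add_left)

lemma normal_moment_scale_normal:
  "normal_moment f (k *\<^sub>R \<nu>) A q = k * normal_moment f \<nu> A q"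
  by (simp add: normal_moment_def matrix_vector_mult_scaleR)

lemma normal_moment_add_scale_field:
  assumes "compact f" "continuous_on f A" "continuous_on f A'" "continuous_on f q"
  shows "normal_moment f \<nu> (\<lambda>x. A x + k *\<^sub>R A' x) q = normal_moment f \<nu> A q + k * normal_moment f \<nu> A' q"
  using set_integral_add(2)[OF moment_integrable[OF assms(1,2,4), of \<nu>]
      set_integrable_mult_right[of k, OF moment_integrable[OF assms(1,3,4), of \<nu>]]]
  unfolding normal_moment_def
  by (simp add: matrix_vector_mult_add_rdistrib scaleR_matrix_vector_assoc[symmetric] inner_add_left)

lemma normal_moment_cong:
  assumes "compact f" "\<And>x. x \<in> f \<Longrightarrow> A x = A' x"
  shows "normal_moment f \<nu> A q = normal_moment f \<nu> A' q"
  unfolding normal_moment_def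
  by (rule set_lebesgue_integral_cong) (use assms borel_compact in auto)

text \<open>The normal space of the face is spanned by the gradients of the vertices off
  \<open>E\<close>, so its dimension is at most \<open>card K\<close>, and an independent
  \<open>K\<close> of that size spans it. This passes from the prescribed normals of a small face to
  the normal of a facet containing it.\<close>

lemma normal_in_span:
  assumes co: "affine_coords C G c" and E: "E \<subseteq> C" "E \<noteq> {}"
    and K: "finite K" "independent K" "card K = card C - card E"
      "\<And>\<nu> t. \<nu> \<in> K \<Longrightarrow> t \<in> tangent_space (convex hull E) \<Longrightarrow> \<nu> \<bullet> t = 0"
    and \<mu>: "\<And>t. t \<in> tangent_space (convex hull E) \<Longrightarrow> \<mu> \<bullet> t = 0"
  shows "\<mu> \<in> span K"
proof -
  interpret affine_coords C G c by fact
  define V where "V = {\<nu>. \<forall>t\<in>tangent_space (convex hull E). \<nu> \<bullet> t = 0}"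
  obtain e where e: "e \<in> E" using E(2) by blast
  have "V \<subseteq> span (G ` (C - E))"
  proof
    fix \<nu> assume "\<nu> \<in> V"
    then have "\<nu> = (\<Sum>v\<in>C - E. (\<nu> \<bullet> (v - e)) *\<^sub>R G v)"
      by (intro normal_expand[OF E(1) e]) (simp add: V_def)
    also have "\<dots> \<in> span (G ` (C - E))"
      by (intro span_sum span_scale span_base imageI)
    finally show "\<nu> \<in> span (G ` (C - E))" .
  qed
  then have "dim V \<le> card (G ` (C - E))"
    using finite_C by (intro dim_le_card) auto
  also have "\<dots> \<le> card (C - E)" using finite_C by (intro card_image_le) auto
  also have "\<dots> = card K" using E(1) finite_C finite_subset K(3) by (metis card_Diff_subset)
  finally have "V \<subseteq> span K"
    using K(2,4) by (intro card_ge_dim_independent) (auto simp: V_def)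
  then show ?thesis using \<mu> by (auto simp: V_def)
qed

section \<open>Fields with prescribed moments\<close>

text \<open>A biorthogonal family: a functional is prescribed on the independent set and represented
  by a vector. Injectivity lets the vectors stand for their indices.\<close>

lemma dual_family:
  fixes N :: "'j \<Rightarrow> 'a::euclidean_space"
  assumes "inj_on N J" "independent (N ` J)"
  obtains M where "\<forall>j\<in>J. \<forall>j'\<in>J. N j \<bullet> M j' = (if j = j' then 1 else 0)"
proof -
  have "\<exists>y. \<forall>j\<in>J. N j \<bullet> y = (if j = j' then 1 else 0)" if j': "j' \<in> J" for j'
  proof -
    from linear_independent_extend[OF assms(2), of "\<lambda>b. if b = N j' then 1 else (0::real)"]
    obtain h :: "'a \<Rightarrow> real" where h: "linear h" "\<forall>b\<in>N ` J. h b = (if b = N j' then 1 else 0)"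
      by (elim exE conjE)
    have "N j \<bullet> adjoint h 1 = (if j = j' then 1 else 0)" if j: "j \<in> J" for j
    proof -
      have "N j \<bullet> adjoint h 1 = h (N j)" using adjoint_works[OF h(1), of "N j" 1] by simp
      also have "\<dots> = (if N j = N j' then 1 else 0)" using h(2) j by simp
      also have "\<dots> = (if j = j' then 1 else 0)" using inj_onD[OF assms(1) _ j j'] by auto
      finally show ?thesis .
    qed
    then show ?thesis by (intro exI[of _ "adjoint h 1"] ballI)
  qed
  then have "\<forall>j'\<in>J. \<exists>y. \<forall>j\<in>J. N j \<bullet> y = (if j = j' then 1 else 0)" by (intro ballI)
  from bchoice[OF this] obtain M
    where "\<forall>j'\<in>J. \<forall>j\<in>J. N j \<bullet> M j' = (if j = j' then 1 else 0)" by (rule exE)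
  then show thesis by (intro that[of M] ballI) simp
qed

definition outer :: "real^'n \<Rightarrow> real^'n \<Rightarrow> real^'n^'n" where
  "outer u w = (\<chi> i j. u $ i * w $ j)"

lemma outer_mult_vec: "outer u w *v x = (w \<bullet> x) *\<^sub>R u"
  by (simp add: outer_def matrix_vector_mult_def vec_eq_iff inner_vec_def sum_distrib_left
      sum_distrib_right mult_ac)

lemma trace_outer: "trace (outer u w) = u \<bullet> w"
  by (simp add: outer_def trace_def inner_vec_def)

lemma linear_outer: "linear (\<lambda>u. outer u w)"
  by (simp add: linear_iff outer_def vec_eq_iff algebra_simps)

lemma trace_linear: "linear (trace :: real^'n^'n \<Rightarrow> real)"
  by (simp add: linear_iff trace_def sum.distrib sum_distrib_left)

lemma subspace_trace_free: "subspace trace_free"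
  unfolding trace_free_def
  by (auto simp: subspace_def linear_0[OF trace_linear] linear_add[OF trace_linear] linear_scale[OF trace_linear])

text \<open>The multiple of \<open>t \<otimes> t\<close> corrects the trace without changing the action on the \<open>N j\<close>. This is why
  positive-dimensional faces, unlike vertices, admit arbitrary normal data.\<close>

lemma trace_free_field_with_normal_data:
  fixes N M :: "'j \<Rightarrow> real^'n" and u :: "'j \<Rightarrow> real^'n \<Rightarrow> real^'n"
  assumes J: "finite J" and dual: "\<And>j j'. j \<in> J \<Longrightarrow> j' \<in> J \<Longrightarrow> N j \<bullet> M j' = (if j = j' then 1 else 0)"
    and t: "t \<noteq> 0" "\<And>j. j \<in> J \<Longrightarrow> N j \<bullet> t = 0"
    and u: "\<And>j. j \<in> J \<Longrightarrow> deg_below k (u j)"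
  shows "\<exists>A. deg_below k A \<and> (\<forall>x. trace (A x) = 0) \<and> (\<forall>j\<in>J. \<forall>x. A x *v N j = u j x)"
proof -
  \<comment> \<open>The first term sends \<open>N j\<close> to \<open>v\<close>, kills the other
    members of the family and has trace \<open>v \<bullet> M j\<close>, which the second term
    removes.\<close>
  define L where "L j v = outer v (M j) - ((v \<bullet> M j) / (t \<bullet> t)) *\<^sub>R outer t t" for j v
  have L: "linear (L j)" for j
  proof -
    have "linear (\<lambda>v. ((v \<bullet> M j) / (t \<bullet> t)) *\<^sub>R outer t t)"
      by (auto simp: linear_iff inner_add_left add_divide_distrib scaleR_add_left)
    then show ?thesis unfolding L_def[abs_def] by (rule linear_compose_sub[OF linear_outer])
  qed
  define A where "A x = (\<Sum>j\<in>J. L j (u j x))" for x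
  have "deg_below k A" unfolding A_def[abs_def]
    by (intro deg_below_sum deg_below_linear[OF L] u)
  moreover have "trace (A x) = 0" for x
  proof -
    have "trace (L j v) = 0" for j v
      unfolding L_def linear_diff[OF trace_linear] linear_scale[OF trace_linear] trace_outer
      using t(1) by simp
    then show ?thesis unfolding A_def linear_sum[OF trace_linear] by simp
  qed
  moreover have "A x *v N j = u j x" if j: "j \<in> J" for j x
  proof -
    have "L j' v *v N j = (if j' = j then v else 0)" if j': "j' \<in> J" for j' v
    proof -
      have "L j' v *v N j = (M j' \<bullet> N j) *\<^sub>R v - ((v \<bullet> M j') / (t \<bullet> t)) *\<^sub>R ((t \<bullet> N j) *\<^sub>R t)"
        by (simp add: L_def matrix_vector_mult_diff_rdistrib scaleR_matrix_vector_assoc[symmetric] outer_mult_vec)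
      also have "t \<bullet> N j = 0" using t(2)[OF j] by (simp add: inner_commute)
      also have "M j' \<bullet> N j = (if j' = j then 1 else 0)"
        using dual[OF j j'] by (auto simp: inner_commute)
      finally show ?thesis by simp
    qed
    then have "(\<Sum>j'\<in>J. L j' (u j' x) *v N j) = (\<Sum>j'\<in>J. if j' = j then u j' x else 0)"
      by (intro sum.cong) auto
    also have "\<dots> = u j x" using J j by simp
    finally show ?thesis unfolding A_def
      using linear_sum[OF linear_matrix_vector_left[of "N j"], of "\<lambda>j. L j (u j x)" J] by simp
  qed
  ultimately show ?thesis by (intro exI[of _ A]) simp
qed

lemma surface_form_linear:
  fixes h :: "real^'n \<Rightarrow> real^'n"
  assumes f: "compact f" and h: "continuous_on f h"
  shows "linear_form_on (moment_space r l f) (\<lambda>q. LINT x:f|surface_measure f. h x \<bullet> q x)"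
proof -
  have int: "set_integrable (surface_measure f) f (\<lambda>x. h x \<bullet> q x)" if "q \<in> moment_space r l f" for q
    by (rule surface_integrable[OF f continuous_on_inner[OF h poly_space_continuous[OF that]]])
  show ?thesis unfolding linear_form_on_def
  proof (intro conjI ballI allI)
    fix p q assume "p \<in> moment_space r l f" "q \<in> moment_space r l f"
    from set_integral_add(2)[OF int[OF this(1)] int[OF this(2)]]
    show "(LINT x:f|surface_measure f. h x \<bullet> (p x + q x)) =
      (LINT x:f|surface_measure f. h x \<bullet> p x) + (LINT x:f|surface_measure f. h x \<bullet> q x)"
      by (simp add: inner_add_right)
  next
    fix p c assume "p \<in> moment_space r l f"
    show "(LINT x:f|surface_measure f. h x \<bullet> (c *\<^sub>R p x)) = c * (LINT x:f|surface_measure f. h x \<bullet> p x)"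
      by simp
  qed
qed

lemma normal_moment_linear:
  assumes "compact f" "continuous_on f A"
  shows "linear_form_on (moment_space r l f) (normal_moment f \<nu> A)"
proof -
  have "continuous_on f (\<lambda>x. A x *v \<nu>)"
    using linear_continuous_on_compose[OF assms(2) linear_matrix_vector_left] by simp
  from surface_form_linear[OF assms(1) this] show ?thesis
    unfolding normal_moment_def[abs_def] .
qed

lemma linear_form_on_diff:
  "linear_form_on S L \<Longrightarrow> linear_form_on S L' \<Longrightarrow> linear_form_on S (\<lambda>q. L q - L' q)"
  by (simp add: linear_form_on_def algebra_simps)

text \<open>The L2 product weighted by the bubble is definite on the moment space, since the bubble
  is positive in the relative interior and a continuous function that vanishes there vanishes on the
  face.\<close>

lemma bubble_moment_representation:
  fixes C :: "(real^'n) set"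
  assumes co: "affine_coords C G c" and E: "E \<subseteq> C"
    and L: "linear_form_on (moment_space r l (convex hull E)) L"
  shows "\<exists>u\<in>moment_space r l (convex hull E). \<forall>q\<in>moment_space r l (convex hull E).
    (LINT x:convex hull E|surface_measure (convex hull E). (affine_coords.face_bubble G c E x *\<^sub>R u x) \<bullet> q x) = L q"
proof -
  interpret affine_coords C G c by fact
  let ?f = "convex hull E" and ?S = "moment_space r l (convex hull E)"
  define B :: "(real^'n \<Rightarrow> real^'n) \<Rightarrow> (real^'n \<Rightarrow> real^'n) \<Rightarrow> real"
    where "B = (\<lambda>u q. LINT x:?f|surface_measure ?f. (face_bubble E x *\<^sub>R u x) \<bullet> q x)"
  note comp = compact_face[OF E]
  have cont: "continuous_on ?f (\<lambda>x. face_bubble E x *\<^sub>R u x)" if "u \<in> ?S" for u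
    by (rule continuous_on_scaleR[OF face_bubble_continuous poly_space_continuous[OF that]])
  have "inner_form_on ?S B" unfolding inner_form_on_def
  proof (intro conjI ballI impI)
    fix p q assume "p \<in> ?S" "q \<in> ?S"
    show "B p q = B q p" by (simp add: B_def inner_commute)
  next
    fix u assume "u \<in> ?S"
    show "linear_form_on ?S (B u)" unfolding B_def
      by (rule surface_form_linear[OF comp cont[OF \<open>u \<in> ?S\<close>]])
  next
    fix p assume p: "p \<in> ?S" and z: "B p p = 0"
    have c: "continuous_on ?f p" by (rule poly_space_continuous[OF p])
    have pz: "face_bubble E x * (p x \<bullet> p x) = 0" if "x \<in> ?f" for x
    proof (rule surface_integral_eq_0[OF comp convex_convex_hull _ _ _ that])
      show "(LINT x:?f|surface_measure ?f. face_bubble E x * (p x \<bullet> p x)) = 0"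
        using z by (simp add: B_def)
      show "continuous_on ?f (\<lambda>x. face_bubble E x * (p x \<bullet> p x))"
        by (intro continuous_intros c)
      show "0 \<le> face_bubble E x * (p x \<bullet> p x)" if "x \<in> ?f" for x
        using face_bubble_nonneg[OF E that] by simp
    qed
    have "p x = 0" for x
    proof (cases "x \<in> ?f")
      case True
      show ?thesis
      proof (rule continuous_zero_on_rel_interior[OF convex_convex_hull compact_imp_closed[OF comp] c _ True])
        fix y assume y: "y \<in> rel_interior ?f"
        then have "y \<in> ?f" using rel_interior_subset by blast
        from pz[OF this] face_bubble_pos[OF E y] show "p y = 0" by simp
      qed
    next
      case False
      then show ?thesis by (rule poly_space_outside[OF p])
    qed
    then show "p = (\<lambda>x. 0)" by (rule ext)
  qed
  from riesz_poly_space[OF poly_space_subspace[OF subspace_UNIV] order_refl this L]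
  show ?thesis unfolding B_def .
qed

text \<open>The bubble times a trace-free field whose normal components are the representers of the
  prescribed moments. The bubble confines the change to faces that contain \<open>E\<close>.\<close>

lemma face_correction:
  fixes C :: "(real^'n) set" and N M :: "'j \<Rightarrow> real^'n"
  assumes co: "affine_coords C G c" and E: "E \<subseteq> C" "card E \<ge> 2"
    and J: "finite J" and dual: "\<And>j j'. j \<in> J \<Longrightarrow> j' \<in> J \<Longrightarrow> N j \<bullet> M j' = (if j = j' then 1 else 0)"
    and N: "\<And>j t. j \<in> J \<Longrightarrow> t \<in> tangent_space (convex hull E) \<Longrightarrow> N j \<bullet> t = 0"
    and \<beta>: "\<And>j. j \<in> J \<Longrightarrow> linear_form_on (moment_space r (card E - 1) (convex hull E)) (\<beta> j)"
  shows "\<exists>A. deg_below (r + 1) A \<and> (\<forall>x. trace (A x) = 0) \<and>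
    (\<forall>E'\<subseteq>C. \<not> E \<subseteq> E' \<longrightarrow> (\<forall>x\<in>convex hull E'. A x = 0)) \<and>
    (\<forall>j\<in>J. \<forall>q\<in>moment_space r (card E - 1) (convex hull E). normal_moment (convex hull E) (N j) A q = \<beta> j q)"
proof -
  interpret affine_coords C G c by fact
  let ?f = "convex hull E" and ?l = "card E - 1"
  have finE: "finite E" using E finite_C finite_subset by blast
  have "\<exists>u. deg_below (r - ?l) u \<and> (\<forall>q\<in>moment_space r ?l ?f.
    (LINT x:?f|surface_measure ?f. (face_bubble E x *\<^sub>R u x) \<bullet> q x) = \<beta> j q)" if j: "j \<in> J" for j
  proof -
    from bubble_moment_representation[OF co E(1) \<beta>[OF j]]
    obtain u where u: "u \<in> moment_space r ?l ?f" "\<forall>q\<in>moment_space r ?l ?f.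
      (LINT x:?f|surface_measure ?f. (face_bubble E x *\<^sub>R u x) \<bullet> q x) = \<beta> j q" by (elim bexE)
    obtain g where g: "deg_below (r - ?l) g" "u = (\<lambda>x. if x \<in> ?f then g x else 0)"
      using u(1) by (rule moment_space_memE)
    have "(LINT x:?f|surface_measure ?f. (face_bubble E x *\<^sub>R u x) \<bullet> q x) =
      (LINT x:?f|surface_measure ?f. (face_bubble E x *\<^sub>R g x) \<bullet> q x)" for q
      by (rule set_lebesgue_integral_cong) (use g(2) borel_compact[OF compact_face[OF E(1)]] in auto)
    then show ?thesis using g(1) u(2) by (intro exI[of _ g]) simp
  qed
  then have "\<forall>j\<in>J. \<exists>u. deg_below (r - ?l) u \<and> (\<forall>q\<in>moment_space r ?l ?f.
    (LINT x:?f|surface_measure ?f. (face_bubble E x *\<^sub>R u x) \<bullet> q x) = \<beta> j q)" by (intro ballI)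
  from bchoice[OF this] obtain u where u: "\<forall>j\<in>J. deg_below (r - ?l) (u j) \<and> (\<forall>q\<in>moment_space r ?l ?f.
    (LINT x:?f|surface_measure ?f. (face_bubble E x *\<^sub>R u j x) \<bullet> q x) = \<beta> j q)" by (rule exE)
  have "\<not> E \<subseteq> {}" using E(2) by auto
  then obtain e where e: "e \<in> E" by blast
  have "\<not> E \<subseteq> {e}" using E(2) card_mono[of "{e}" E] by auto
  then obtain e' where e': "e' \<in> E" "e' \<noteq> e" by blast
  \<comment> \<open>Two distinct vertices give the nonzero tangent vector that the trace correction
    needs; this is where \<open>card E \<ge> 2\<close> enters.\<close>
  have t: "e' - e \<noteq> 0" "\<And>j. j \<in> J \<Longrightarrow> N j \<bullet> (e' - e) = 0"
    using e' N vertex_diff_tangent[OF e'(1) e] by auto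
  have uj: "\<And>j. j \<in> J \<Longrightarrow> deg_below (r - ?l) (u j)" using u by blast
  have "\<exists>A. deg_below (r - ?l) A \<and> (\<forall>x. trace (A x) = 0) \<and> (\<forall>j\<in>J. \<forall>x. A x *v N j = u j x)"
    by (rule trace_free_field_with_normal_data[OF J _ t(1)]) (fact dual t(2) uj)+
  then obtain A where A: "deg_below (r - ?l) A" "\<forall>x. trace (A x) = 0" "\<forall>j\<in>J. \<forall>x. A x *v N j = u j x"
    by (elim exE conjE)
  define A' where "A' = (\<lambda>x. face_bubble E x *\<^sub>R A x)"
  have "deg_below (r + 1) A'"
  \<comment> \<open>If the dimension of the face is at least \<open>r\<close>, the truncated bound
    \<open>r - ?l\<close> is 0 and the field is zero; otherwise the degrees of bubble and cofactor
    add up to at most \<open>r\<close>.\<close>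
  proof (cases "r < card E")
    case False
    have "deg_below (r - ?l + card E) A'" unfolding A'_def by (rule deg_below_mult_bubble[OF co A(1) finE])
    moreover have "r - ?l + card E = r + 1" using False E(2) by simp
    ultimately show ?thesis by simp
  next
    case True
    show ?thesis
    proof (cases "r - ?l = 0")
      case True
      then have "A = (\<lambda>x. 0)" using A(1) by (simp only: deg_below.simps)
      then show ?thesis by (simp add: A'_def)
    next
      case False
      have "deg_below (r - ?l + card E) A'" unfolding A'_def by (rule deg_below_mult_bubble[OF co A(1) finE])
      moreover have "r - ?l + card E = r + 1" using False E(2) by simp
      ultimately show ?thesis by simp
    qed
  qed
  moreover have "\<forall>x. trace (A' x) = 0" using A(2) by (simp add: A'_def linear_scale[OF trace_linear])
  moreover have "\<forall>E'\<subseteq>C. \<not> E \<subseteq> E' \<longrightarrow> (\<forall>x\<in>convex hull E'. A' x = 0)"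
    using face_bubble_zero[OF E(1)] by (auto simp: A'_def)
  moreover have "\<forall>j\<in>J. \<forall>q\<in>moment_space r ?l ?f. normal_moment ?f (N j) A' q = \<beta> j q"
  proof (intro ballI)
    fix j q assume j: "j \<in> J" and q: "q \<in> moment_space r ?l ?f"
    have "A' x *v N j = face_bubble E x *\<^sub>R u j x" for x
      using A(3) j by (simp add: A'_def scaleR_matrix_vector_assoc[symmetric])
    then show "normal_moment ?f (N j) A' q = \<beta> j q"
      using u j q by (simp add: normal_moment_def)
  qed
  ultimately show ?thesis by (intro exI[of _ A'] conjI)
qed

text \<open>Induction on the cardinality of the faces already treated. The corrections for faces of
  the next size vanish on all smaller faces and on each other's faces, so they are simply added,
  without a system to solve. The bound \<open>CARD('n)\<close> keeps the simplex itself out.\<close>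

lemma face_data_exists:
  fixes C :: "(real^'n) set" and N M :: "(real^'n) set \<Rightarrow> 'j \<Rightarrow> real^'n"
  assumes co: "affine_coords C G c" and r: "r \<ge> 1"
    and J: "\<And>E. E \<subseteq> C \<Longrightarrow> 2 \<le> card E \<Longrightarrow> card E \<le> CARD('n) \<Longrightarrow> finite (J E)"
    and dual: "\<And>E j j'. E \<subseteq> C \<Longrightarrow> 2 \<le> card E \<Longrightarrow> card E \<le> CARD('n) \<Longrightarrow> j \<in> J E \<Longrightarrow> j' \<in> J E \<Longrightarrow>
      N E j \<bullet> M E j' = (if j = j' then 1 else 0)"
    and N: "\<And>E j t. E \<subseteq> C \<Longrightarrow> 2 \<le> card E \<Longrightarrow> card E \<le> CARD('n) \<Longrightarrow> j \<in> J E \<Longrightarrow>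
      t \<in> tangent_space (convex hull E) \<Longrightarrow> N E j \<bullet> t = 0"
    and a: "\<And>v. v \<in> C \<Longrightarrow> trace (a v) = 0"
    and \<beta>: "\<And>E j. E \<subseteq> C \<Longrightarrow> 2 \<le> card E \<Longrightarrow> card E \<le> CARD('n) \<Longrightarrow> j \<in> J E \<Longrightarrow>
      linear_form_on (moment_space r (card E - 1) (convex hull E)) (\<beta> E j)"
  shows "k \<le> CARD('n) \<Longrightarrow> \<exists>A. deg_below (r + 1) A \<and> (\<forall>x. trace (A x) = 0) \<and> (\<forall>v\<in>C. A v = a v) \<and>
    (\<forall>E\<subseteq>C. 2 \<le> card E \<longrightarrow> card E \<le> k \<longrightarrow> (\<forall>j\<in>J E. \<forall>q\<in>moment_space r (card E - 1) (convex hull E).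
       normal_moment (convex hull E) (N E j) A q = \<beta> E j q))"
proof (induction k)
  case 0
  interpret affine_coords C G c by fact
  \<comment> \<open>Linear interpolation of the vertex values, admissible because \<open>r\<close>
    is at least 1.\<close>
  define A where "A x = (\<Sum>v\<in>C. bary v x *\<^sub>R a v)" for x
  have "deg_below (Suc (Suc 0)) A" unfolding A_def[abs_def]
    by (intro deg_below_sum deg_below_mult_bary[OF co] deg_below_const)
  then have "deg_below (r + 1) A" by (rule deg_below_mono) (use r in simp)
  moreover have "trace (A x) = 0" for x
    unfolding A_def linear_sum[OF trace_linear] linear_scale[OF trace_linear] using a by simp
  moreover have "A v = a v" if v: "v \<in> C" for v
  proof -
    have "A v = (\<Sum>w\<in>C. if w = v then a w else 0)" unfolding A_def
      by (rule sum.cong) (use v bary_vertex[of _ v] in auto)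
    then show ?thesis using v finite_C by simp
  qed
  ultimately show ?case by (intro exI[of _ A]) simp
next
  case (Suc k)
  interpret affine_coords C G c by fact
  obtain A where A: "deg_below (r + 1) A" "\<forall>x. trace (A x) = 0" "\<forall>v\<in>C. A v = a v"
    "\<forall>E\<subseteq>C. 2 \<le> card E \<longrightarrow> card E \<le> k \<longrightarrow> (\<forall>j\<in>J E. \<forall>q\<in>moment_space r (card E - 1) (convex hull E).
       normal_moment (convex hull E) (N E j) A q = \<beta> E j q)"
    using Suc.IH Suc.prems by (meson Suc_leD)
  \<comment> \<open>The condition \<open>2 \<le> card E\<close> leaves the family empty at the size
    of vertices, whose values were fixed in the base case.\<close>
  define \<F> where "\<F> = {E. E \<subseteq> C \<and> 2 \<le> card E \<and> card E = Suc k}"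
  have fin: "finite \<F>" unfolding \<F>_def using finite_C by auto
  \<comment> \<open>The data of a correction are the residuals of the field constructed so
    far.\<close>
  define P where "P E A' \<longleftrightarrow> deg_below (r + 1) A' \<and> (\<forall>x. trace (A' x) = 0) \<and>
    (\<forall>E'\<subseteq>C. \<not> E \<subseteq> E' \<longrightarrow> (\<forall>x\<in>convex hull E'. A' x = 0)) \<and>
    (\<forall>j\<in>J E. \<forall>q\<in>moment_space r (card E - 1) (convex hull E).
       normal_moment (convex hull E) (N E j) A' q = \<beta> E j q - normal_moment (convex hull E) (N E j) A q)"
    for E and A' :: "real^'n \<Rightarrow> real^'n^'n"
  have "\<exists>A'. P E A'" if E: "E \<in> \<F>" for E
  proof -
    have E': "E \<subseteq> C" "2 \<le> card E" "card E \<le> CARD('n)" using E Suc.prems by (auto simp: \<F>_def)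
    have "continuous_on (convex hull E) A" by (rule deg_below_continuous[OF A(1)])
    then have lin: "linear_form_on (moment_space r (card E - 1) (convex hull E))
        (\<lambda>q. \<beta> E j q - normal_moment (convex hull E) (N E j) A q)" if "j \<in> J E" for j
      by (intro linear_form_on_diff \<beta>[OF E' that] normal_moment_linear compact_face E')
    show ?thesis unfolding P_def
      by (rule face_correction[OF co E'(1,2) J[OF E'], of "N E" "M E"])
         (fact dual[OF E'] N[OF E'] lin)+
  qed
  then have "\<forall>E\<in>\<F>. \<exists>A'. P E A'" by (intro ballI)
  from bchoice[OF this] obtain A' where A': "\<forall>E\<in>\<F>. P E (A' E)" by (rule exE)
  define B where "B x = A x + (\<Sum>E\<in>\<F>. A' E x)" for x
  have "deg_below (r + 1) B" unfolding B_def[abs_def]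
    by (intro deg_below_add deg_below_sum A(1)) (use A' in \<open>simp add: P_def\<close>)
  moreover have "trace (B x) = 0" for x
    unfolding B_def linear_add[OF trace_linear] linear_sum[OF trace_linear]
    using A(2) A' by (simp add: P_def)
  moreover have B0: "B x = A x" if "E \<subseteq> C" "x \<in> convex hull E" "\<And>E'. E' \<in> \<F> \<Longrightarrow> \<not> E' \<subseteq> E" for x E
  proof -
    have "A' E' x = 0" if E': "E' \<in> \<F>" for E'
      using A'[rule_format, OF E'] \<open>E \<subseteq> C\<close> \<open>x \<in> convex hull E\<close> \<open>\<And>E'. E' \<in> \<F> \<Longrightarrow> \<not> E' \<subseteq> E\<close>[OF E']
      unfolding P_def by blast
    then show ?thesis by (simp add: B_def)
  qed
  moreover have "B v = a v" if v: "v \<in> C" for v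
  proof -
    have "\<not> E' \<subseteq> {v}" if "E' \<in> \<F>" for E'
      using that card_mono[of "{v}" E'] by (auto simp: \<F>_def)
    then have "B v = A v" using v by (intro B0[of "{v}"]) auto
    then show ?thesis using A(3) v by simp
  qed
  moreover have "normal_moment (convex hull E) (N E j) B q = \<beta> E j q"
    if E: "E \<subseteq> C" "2 \<le> card E" "card E \<le> Suc k" and j: "j \<in> J E"
      and q: "q \<in> moment_space r (card E - 1) (convex hull E)" for E j q
  proof (cases "E \<in> \<F>")
    case False
    then have k: "card E \<le> k" using E by (auto simp: \<F>_def)
    have "\<not> E' \<subseteq> E" if "E' \<in> \<F>" for E'
      using that k card_mono[OF finite_subset[OF E(1) finite_C], of E'] by (auto simp: \<F>_def)
    then have "normal_moment (convex hull E) (N E j) B q = normal_moment (convex hull E) (N E j) A q"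
      by (intro normal_moment_cong compact_face E(1) B0[OF E(1)])
    then show ?thesis using A(4) E k j q by simp
  next
    case True
    \<comment> \<open>Different sets of equal size are not nested, so on the face of
      \<open>E\<close> only its own correction survives.\<close>
    have only: "\<not> E' \<subseteq> E" if "E' \<in> \<F> - {E}" for E'
      using that True card_subset_eq[OF finite_subset[OF E(1) finite_C], of E'] by (auto simp: \<F>_def)
    have BE: "B x = A x + 1 *\<^sub>R A' E x" if x: "x \<in> convex hull E" for x
    proof -
      have "A' E' x = 0" if E': "E' \<in> \<F> - {E}" for E'
      proof -
        have "P E' (A' E')" using A' E' by blast
        then show ?thesis using only[OF E'] E(1) x unfolding P_def by blast
      qed
      then have "(\<Sum>E'\<in>\<F>. A' E' x) = (\<Sum>E'\<in>{E}. A' E' x)"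
        using True fin by (intro sum.mono_neutral_right) auto
      then show ?thesis by (simp add: B_def)
    qed
    have PE: "P E (A' E)" using A' True by blast
    have cont: "continuous_on (convex hull E) A" "continuous_on (convex hull E) (A' E)"
      using deg_below_continuous A(1) PE unfolding P_def by blast+
    have "normal_moment (convex hull E) (N E j) B q =
        normal_moment (convex hull E) (N E j) (\<lambda>x. A x + 1 *\<^sub>R A' E x) q"
      by (intro normal_moment_cong compact_face E(1) BE)
    also have "\<dots> = normal_moment (convex hull E) (N E j) A q + 1 * normal_moment (convex hull E) (N E j) (A' E) q"
      by (rule normal_moment_add_scale_field[OF compact_face[OF E(1)] cont poly_space_continuous[OF q]])
    also have "\<dots> = \<beta> E j q" using PE j q unfolding P_def by simp
    finally show ?thesis .
  qed
  ultimately show ?case by (intro exI[of _ B] conjI allI ballI impI)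
qed

text \<open>All moments of \<open>A x *v G v0\<close> over faces of the facet vanish: in dimension
  at most \<open>m\<close> because \<open>G v0\<close> is a combination of the prescribed normals,
  above that because the facet normal is a multiple of it. This is applied both to the difference of
  two candidates on one simplex and to the jump between two simplices.\<close>

lemma facet_trace_zero:
  fixes C :: "(real^'n) set"
  assumes co: "affine_coords C G c" and v0: "v0 \<in> C" and A: "deg_below (r + 1) A"
    and nf: "\<And>l E. 1 \<le> l \<Longrightarrow> l \<le> m \<Longrightarrow> E \<subseteq> C \<Longrightarrow> card E = l + 1 \<Longrightarrow>
      (\<forall>i\<in>{1..CARD('n) - l}. normal_vector (convex hull E) (nf (convex hull E) i)) \<and>
      inj_on (nf (convex hull E)) {1..CARD('n) - l} \<and> independent (nf (convex hull E) ` {1..CARD('n) - l})"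
    and \<nu>: "normal_vector (convex hull (C - {v0})) \<nu>"
    and vert: "\<And>v. v \<in> C - {v0} \<Longrightarrow> A v = 0"
    and low: "\<And>l E i q. 1 \<le> l \<Longrightarrow> l \<le> m \<Longrightarrow> E \<subseteq> C - {v0} \<Longrightarrow> card E = l + 1 \<Longrightarrow> i \<in> {1..CARD('n) - l} \<Longrightarrow>
      q \<in> moment_space r l (convex hull E) \<Longrightarrow> normal_moment (convex hull E) (nf (convex hull E) i) A q = 0"
    and high: "\<And>l E q. m + 1 \<le> l \<Longrightarrow> l \<le> CARD('n) - 1 \<Longrightarrow> E \<subseteq> C - {v0} \<Longrightarrow> card E = l + 1 \<Longrightarrow>
      q \<in> moment_space r l (convex hull E) \<Longrightarrow> normal_moment (convex hull E) \<nu> A q = 0"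
    and x: "x \<in> convex hull (C - {v0})"
  shows "A x *v G v0 = 0"
proof -
  interpret affine_coords C G c by fact
  have dim: "card C = CARD('n) + 1" using card_C by simp
  obtain k where k: "k \<noteq> 0" "\<nu> = k *\<^sub>R G v0" using facet_normal[OF v0 \<nu>] .
  have u: "deg_below (r + 1) (\<lambda>x. A x *v G v0)" by (rule deg_below_linear[OF linear_matrix_vector_left A])
  have sub: "C - {v0} \<subseteq> C" by blast
  show ?thesis
  proof (rule moments_zero_imp_zero[OF co sub u _ _ x])
    fix v assume "v \<in> C - {v0}"
    then show "A v *v G v0 = 0" using vert by simp
  next
    fix E q assume E: "E \<subseteq> C - {v0}" "2 \<le> card E" and q: "q \<in> moment_space r (card E - 1) (convex hull E)"
    define l where "l = card E - 1"
    have EC: "E \<subseteq> C" using E by blast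
    have l: "card E = l + 1" "1 \<le> l" using E(2) by (auto simp: l_def)
    have "card E \<le> card (C - {v0})" using E(1) finite_C by (intro card_mono) auto
    then have ln: "l \<le> CARD('n) - 1" using dim v0 finite_C l by simp
    have ql: "q \<in> moment_space r l (convex hull E)" using q by (simp add: l_def)
    have contA: "continuous_on (convex hull E) A" by (rule deg_below_continuous[OF A])
    have "normal_moment (convex hull E) (G v0) A q = 0"
    proof (cases "l \<le> m")
      case True
      let ?K = "nf (convex hull E) ` {1..CARD('n) - l}"
      note nfE = nf[OF l(2) True EC l(1)]
      have "card ?K = card C - card E" using nfE card_image dim l by fastforce
      moreover have "E \<noteq> {}" using l by auto
      ultimately have "G v0 \<in> span ?K"
        using nfE tangent_orthogonal[OF EC, of v0] v0 E(1)
        by (intro normal_in_span[OF co EC]) (auto simp: normal_vector_def)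
      then show ?thesis
      proof (induction rule: span_induct_alt)
        case base
        show ?case by (simp add: normal_moment_def)
      next
        case (step s y z)
        have "normal_moment (convex hull E) (z + s *\<^sub>R y) A q = normal_moment (convex hull E) z A q +
            s * normal_moment (convex hull E) y A q"
          by (rule normal_moment_add_scale_normal[OF compact_face[OF EC] contA poly_space_continuous[OF q]])
        also have "normal_moment (convex hull E) y A q = 0"
          using step(1) low[OF l(2) True E(1) l(1) _ ql] by blast
        finally show ?case using step(2) by (simp add: add.commute)
      qed
    next
      case False
      have "normal_moment (convex hull E) \<nu> A q = 0"
        by (rule high[OF _ ln E(1) l(1) ql]) (use False in simp)
      then show ?thesis using k by (simp add: normal_moment_scale_normal)
    qed
    then show "(LINT x:convex hull E|surface_measure (convex hull E). (A x *v G v0) \<bullet> q x) = 0"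
      by (simp add: normal_moment_def)
  qed
qed

section \<open>Unisolvence\<close>

text \<open>The part of the interior where \<open>h\<close> is nonzero is open and null, hence
  empty; the interior is dense in \<open>T\<close>.\<close>

lemma lborel_integral_eq_0:
  fixes h :: "'a::euclidean_space \<Rightarrow> real"
  assumes T: "compact T" "convex T" "interior T \<noteq> {}" and h: "continuous_on T h" "\<And>x. x \<in> T \<Longrightarrow> h x \<ge> 0"
    and int: "(LINT x:T|lborel. h x) = 0" and x: "x \<in> T"
  shows "h x = 0"
proof -
  have "set_integrable lborel T h" by (rule borel_integrable_compact[OF T(1) h(1), folded set_integrable_def])
  then have i: "integrable lborel (\<lambda>x. indicator T x *\<^sub>R h x)" by (simp add: set_integrable_def)
  have ae: "AE x in lborel. indicator T x *\<^sub>R h x = 0"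
  proof (subst integral_nonneg_eq_0_iff_AE[symmetric, OF i])
    show "AE x in lborel. 0 \<le> indicator T x *\<^sub>R h x"
      by (rule AE_I2) (use h(2) in \<open>auto simp: indicator_def\<close>)
    show "(LINT x|lborel. indicator T x *\<^sub>R h x) = 0" using int by (simp add: set_lebesgue_integral_def)
  qed
  define U where "U = {x \<in> interior T. h x \<noteq> 0}"
  have "open (interior T \<inter> h -` (- {0}))"
    using h(1) interior_subset by (intro continuous_open_preimage continuous_on_subset[OF h(1)]) auto
  moreover have "U = interior T \<inter> h -` (- {0})" by (auto simp: U_def)
  ultimately have op: "open U" by simp
  have "AE x in lborel. x \<notin> U"
    using ae by eventually_elim
      (auto simp: U_def indicator_def dest: interior_subset[THEN subsetD] split: if_splits)
  then have "U \<in> null_sets lborel" using AE_iff_null_sets[of U lborel] op by auto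
  then have "negligible U" unfolding negligible_iff_null_sets by (rule null_sets_completionI)
  then have "U = {}" using open_not_negligible[OF op] by blast
  then have z: "h y = 0" if "y \<in> interior T" for y using that by (auto simp: U_def)
  show ?thesis
    by (rule continuous_zero_on_rel_interior[OF T(2) compact_imp_closed[OF T(1)] h(1) _ x])
       (simp add: z interior_rel_interior_gen[symmetric] rel_interior_nonempty_interior[OF T(3)])
qed

lemma (in affine_coords) interior_nonempty: "interior (convex hull C) \<noteq> {}"
proof -
  have "C \<noteq> {}" using card_C by auto
  then have "rel_interior (convex hull C) \<noteq> {}" by (simp add: rel_interior_eq_empty)
  moreover have "affine hull (convex hull C) = UNIV" using affine_hull_C by simp
  ultimately show ?thesis using rel_interior_interior by metis
qed

lemma poly_space_of_deg_below:
  assumes "deg_below (r + 1) A" "\<And>x. x \<in> T \<Longrightarrow> A x \<in> V"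
  shows "(\<lambda>x. if x \<in> T then A x else 0) \<in> poly_space (int r) T V"
proof (rule poly_space_memI)
  have "nat (int r + 1) = r + 1" by simp
  then show "poly_deg_le (int r) A" using assms(1) by (simp only: poly_deg_le_iff)
qed (rule assms(2))

lemma poly_space_deg_belowE:
  assumes "A \<in> poly_space (int r) T V"
  obtains A' where "deg_below (r + 1) A'" "\<forall>x\<in>T. A' x = A x" "\<forall>x\<in>T. A' x \<in> V"
proof -
  obtain A' where A': "poly_deg_le (int r) A'" "\<forall>x\<in>T. A' x \<in> V" "A = (\<lambda>x. if x \<in> T then A' x else 0)"
    using assms by (rule poly_space_memE)
  have "nat (int r + 1) = r + 1" by simp
  then have "deg_below (r + 1) A'" using A'(1) by (simp only: poly_deg_le_iff)
  then show thesis using A'(2,3) by (intro that) auto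
qed

section \<open>Interior moments and the bubble space\<close>

lemma interior_moment_integrable:
  assumes "compact T" "p \<in> poly_space k T V" "q \<in> poly_space k T V"
  shows "set_integrable lborel T (\<lambda>x. p x \<bullet> q x)"
  unfolding set_integrable_def
  by (rule borel_integrable_compact[OF assms(1)])
     (intro continuous_on_inner poly_space_continuous[OF assms(2)] poly_space_continuous[OF assms(3)])

lemma interior_moment_commute: "interior_moment T p q = interior_moment T q p"
  by (simp add: interior_moment_def inner_commute)

lemma interior_moment_linear:
  assumes "compact T" "p \<in> poly_space k T V"
  shows "linear_form_on (poly_space k T V) (interior_moment T p)"
  unfolding linear_form_on_def
proof (intro conjI ballI allI)
  fix q s assume "q \<in> poly_space k T V" "s \<in> poly_space k T V"
  from set_integral_add(2)[OF interior_moment_integrable[OF assms this(1)] interior_moment_integrable[OF assms this(2)]]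
  show "interior_moment T p (\<lambda>x. q x + s x) = interior_moment T p q + interior_moment T p s"
    by (simp add: interior_moment_def inner_add_right)
next
  fix q c assume "q \<in> poly_space k T V"
  show "interior_moment T p (\<lambda>x. c *\<^sub>R q x) = c * interior_moment T p q"
    by (simp add: interior_moment_def)
qed

lemma interior_moment_inner_form:
  assumes "compact T" "convex T" "interior T \<noteq> {}"
  shows "inner_form_on (poly_space k T V) (interior_moment T)"
  unfolding inner_form_on_def
proof (intro conjI ballI impI)
  fix p assume p: "p \<in> poly_space k T V" and z: "interior_moment T p p = 0"
  have "p x \<bullet> p x = 0" if "x \<in> T" for x
    by (rule lborel_integral_eq_0[OF assms _ _ _ that])
       (use z in \<open>auto simp: interior_moment_def intro!: continuous_on_inner poly_space_continuous[OF p]\<close>)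
  then have "p x = 0" for x using poly_space_outside[OF p, of x] by (cases "x \<in> T") auto
  then show "p = (\<lambda>x. 0)" by (rule ext)
qed (rule interior_moment_commute interior_moment_linear[OF assms(1)]; assumption)+

lemma div_bubbles_subset: "div_bubbles k T \<subseteq> poly_space k T trace_free"
  by (auto simp: div_bubbles_def)

lemma div_bubbles_subspace: "fun_subspace (div_bubbles k T)"
proof -
  note sub = poly_space_subspace[OF subspace_trace_free, of k T]
  show ?thesis unfolding fun_subspace_def
  proof (intro conjI ballI allI)
    show "(\<lambda>x. 0) \<in> div_bubbles k T"
      using fun_subspace_zero[OF sub] by (simp add: div_bubbles_def)
  next
    fix p q assume "p \<in> div_bubbles k T" "q \<in> div_bubbles k T"
    then show "(\<lambda>x. p x + q x) \<in> div_bubbles k T"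
      using fun_subspace_add[OF sub, of p q]
      by (simp add: div_bubbles_def matrix_vector_mult_add_rdistrib)
  next
    fix p c assume "p \<in> div_bubbles k T"
    then show "(\<lambda>x. c *\<^sub>R p x) \<in> div_bubbles k T"
      using fun_subspace_scale[OF sub, of p c]
      by (simp add: div_bubbles_def scaleR_matrix_vector_assoc[symmetric])
  qed
qed

text \<open>A unit normal of the facet opposite \<open>v\<close> is a multiple of
  \<open>G v\<close>, so the boundary condition can be tested with one explicit vector per
  facet.\<close>

lemma div_bubbles_iff:
  fixes C :: "(real^'n) set"
  assumes co: "affine_coords C G c"
  shows "A \<in> div_bubbles k (convex hull C) \<longleftrightarrow> A \<in> poly_space k (convex hull C) trace_free \<and>
    (\<forall>v\<in>C. \<forall>x\<in>convex hull (C - {v}). A x *v G v = 0)"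
proof -
  interpret affine_coords C G c by fact
  have fac: "F \<in> subsimplices (CARD('n) - 1) (convex hull C) \<longleftrightarrow> (\<exists>v\<in>C. F = convex hull (C - {v}))" for F
    using facets_iff[of F] by simp
  show ?thesis
  proof (intro iffI conjI ballI)
    assume A: "A \<in> div_bubbles k (convex hull C)"
    then show "A \<in> poly_space k (convex hull C) trace_free" by (simp add: div_bubbles_def)
    fix v x assume v: "v \<in> C" and x: "x \<in> convex hull (C - {v})"
    have nz: "G v \<noteq> 0" by (rule G_nonzero[OF v])
    have F: "convex hull (C - {v}) \<in> subsimplices (CARD('n) - 1) (convex hull C)" using fac v by blast
    define \<nu> where "\<nu> = (1 / norm (G v)) *\<^sub>R G v"
    have "normal_vector (convex hull (C - {v})) (G v)" by (rule normal_vector_G) (use v in auto)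
    then have "norm \<nu> = 1 \<and> normal_vector (convex hull (C - {v})) \<nu>"
      using nz by (auto simp: \<nu>_def normal_vector_def)
    then have "A x *v \<nu> = 0" using A F x unfolding div_bubbles_def by blast
    then show "A x *v G v = 0" using nz by (simp add: \<nu>_def matrix_vector_mult_scaleR)
  next
    assume A: "A \<in> poly_space k (convex hull C) trace_free \<and>
      (\<forall>v\<in>C. \<forall>x\<in>convex hull (C - {v}). A x *v G v = 0)"
    have "A x *v \<nu> = 0" if F: "F \<in> subsimplices (CARD('n) - 1) (convex hull C)"
      and \<nu>: "normal_vector F \<nu>" and x: "x \<in> F" for F \<nu> x
    proof -
      obtain v where v: "v \<in> C" "F = convex hull (C - {v})" using fac F by blast
      obtain s where "\<nu> = s *\<^sub>R G v" using facet_normal[OF v(1) \<nu>[unfolded v(2)]] .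
      then show ?thesis using A v x by (simp add: matrix_vector_mult_scaleR)
    qed
    then show "A \<in> div_bubbles k (convex hull C)" using A unfolding div_bubbles_def by blast
  qed
qed

text \<open>A face lies in the facets opposite the vertices outside it, and the gradients belonging
  to these span its normals. A bubble therefore contributes to none of the data (a)-(c).\<close>

lemma bubble_normal_zero:
  fixes C :: "(real^'n) set"
  assumes co: "affine_coords C G c" and W: "W \<in> div_bubbles k (convex hull C)"
    and E: "E \<subseteq> C" "E \<noteq> {}" and x: "x \<in> convex hull E"
    and \<nu>: "\<And>t. t \<in> tangent_space (convex hull E) \<Longrightarrow> \<nu> \<bullet> t = 0"
  shows "W x *v \<nu> = 0"
proof -
  interpret affine_coords C G c by fact
  obtain e where e: "e \<in> E" using E(2) by blast
  have W0: "W x *v G v = 0" if "v \<in> C - E" for v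
  proof -
    have "x \<in> convex hull (C - {v})" using x hull_mono[of E "C - {v}"] E(1) that by blast
    then show ?thesis using W that unfolding div_bubbles_iff[OF co] by blast
  qed
  have "W x *v (\<Sum>v\<in>C - E. (\<nu> \<bullet> (v - e)) *\<^sub>R G v) = (\<Sum>v\<in>C - E. (\<nu> \<bullet> (v - e)) *\<^sub>R (W x *v G v))"
    by (simp add: linear_sum[OF matrix_vector_mul_linear] matrix_vector_mult_scaleR)
  also have "\<dots> = 0" using W0 by simp
  finally show ?thesis using normal_expand[OF E(1) e, of \<nu>] \<nu> by simp
qed

text \<open>For existence the two kinds of moments become one family indexed by
  \<open>nat + real^'n\<close>: \<open>Inl i\<close> for a face of dimension at most
  \<open>m\<close> with its own normals, \<open>Inr v\<close> for a larger face seen from the facet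
  opposite \<open>v\<close>. All faces are then treated alike by
  \<open>face_data_exists\<close>.\<close>

lemma unisolvent_simplex:
  fixes C :: "(real^'n) set"
  assumes co: "affine_coords C G c" and n: "CARD('n) \<ge> 2" and m: "m \<le> CARD('n) - 2" and r: "r \<ge> 1"
    and nf: "\<And>l E. l \<le> m \<Longrightarrow> E \<subseteq> C \<Longrightarrow> card E = l + 1 \<Longrightarrow>
      (\<forall>i\<in>{1..CARD('n) - l}. normal_vector (convex hull E) (nf (convex hull E) i)) \<and>
      inj_on (nf (convex hull E)) {1..CARD('n) - l} \<and> independent (nf (convex hull E) ` {1..CARD('n) - l})"
    and nF: "\<And>v. v \<in> C \<Longrightarrow> normal_vector (convex hull (C - {v})) (nF (convex hull (C - {v})))"
  shows "unisolvent m r nf nF (convex hull C)"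
  unfolding unisolvent_def
proof (intro allI impI, elim conjE)
  fix a :: "real^'n \<Rightarrow> real^'n^'n" and b :: "(real^'n) set \<Rightarrow> nat \<Rightarrow> (real^'n \<Rightarrow> real^'n) \<Rightarrow> real"
    and cc :: "(real^'n) set \<Rightarrow> (real^'n) set \<Rightarrow> (real^'n \<Rightarrow> real^'n) \<Rightarrow> real"
    and d :: "(real^'n \<Rightarrow> real^'n^'n) \<Rightarrow> real"
  let ?T = "convex hull C"
  assume a: "\<forall>v. {v} \<in> subsimplices 0 ?T \<longrightarrow> a v \<in> trace_free"
    and b: "\<forall>l\<in>{1..m}. \<forall>f\<in>subsimplices l ?T. \<forall>i\<in>{1..CARD('n) - l}.
          linear_form_on (moment_space r l f) (b f i)"
    and cc: "\<forall>F\<in>subsimplices (CARD('n) - 1) ?T. \<forall>l\<in>{m+1..CARD('n) - 1}. \<forall>f\<in>subsimplices l F.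
          linear_form_on (moment_space r l f) (cc F f)"
    and d: "linear_form_on (div_bubbles (int r) ?T) d"
  interpret affine_coords C G c by fact
  have compT: "compact ?T" by (rule compact_face[OF subset_refl])
  have fac: "F \<in> subsimplices (CARD('n) - 1) ?T \<longleftrightarrow> (\<exists>v\<in>C. F = convex hull (C - {v}))" for F
    using facets_iff[of F] by simp
  have facI: "convex hull (C - {v}) \<in> subsimplices (CARD('n) - 1) ?T" if "v \<in> C" for v
    unfolding fac using that by (intro bexI[of _ v] refl)
  have faceT: "convex hull E \<in> subsimplices l ?T" if "E \<subseteq> C" "card E = l + 1" for E l
    by (rule subsimplicesI[OF subset_refl that])
  have faceF: "convex hull E \<in> subsimplices l (convex hull (C - {v}))" if "E \<subseteq> C - {v}" "card E = l + 1" for E l v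
    by (rule subsimplicesI[OF Diff_subset that])
  have dim: "card C = CARD('n) + 1" using card_C by simp
  have inT: "x \<in> ?T" if "E \<subseteq> C" "x \<in> convex hull E" for x E using hull_mono[OF that(1)] that(2) by blast
  define dofs where "dofs A \<longleftrightarrow> A \<in> poly_space (int r) ?T trace_free \<and>
         (\<forall>v. {v} \<in> subsimplices 0 ?T \<longrightarrow> A v = a v) \<and>
         (\<forall>l\<in>{1..m}. \<forall>f\<in>subsimplices l ?T. \<forall>i\<in>{1..CARD('n) - l}. \<forall>q\<in>moment_space r l f.
            normal_moment f (nf f i) A q = b f i q) \<and>
         (\<forall>F\<in>subsimplices (CARD('n) - 1) ?T. \<forall>l\<in>{m+1..CARD('n) - 1}. \<forall>f\<in>subsimplices l F.
            \<forall>q\<in>moment_space r l f. normal_moment f (nF F) A q = cc F f q) \<and>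
         (\<forall>q\<in>div_bubbles (int r) ?T. interior_moment ?T A q = d q)" for A
  have dofs_low: "normal_moment f (nf f i) A q = b f i q"
    if h: "dofs A" "l \<in> {1..m}" "f \<in> subsimplices l ?T" "i \<in> {1..CARD('n) - l}" "q \<in> moment_space r l f" for A l f i q
    by (rule h(1)[unfolded dofs_def, THEN conjunct2, THEN conjunct2, THEN conjunct1, rule_format, OF h(2-5)])
  have dofs_high: "normal_moment f (nF F) A q = cc F f q"
    if h: "dofs A" "F \<in> subsimplices (CARD('n) - 1) ?T" "l \<in> {m+1..CARD('n) - 1}"
      "f \<in> subsimplices l F" "q \<in> moment_space r l f" for A F l f q
    by (rule h(1)[unfolded dofs_def, THEN conjunct2, THEN conjunct2, THEN conjunct2, THEN conjunct1,
          rule_format, OF h(2-5)])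
  have dofs_int: "interior_moment ?T A q = d q" if h: "dofs A" "q \<in> div_bubbles (int r) ?T" for A q
    by (rule h(1)[unfolded dofs_def, THEN conjunct2, THEN conjunct2, THEN conjunct2, THEN conjunct2,
          rule_format, OF h(2)])
  have "\<exists>!A. dofs A"
  proof (rule ex_ex1I)
    define J :: "(real^'n) set \<Rightarrow> (nat + real^'n) set"
      where "J E = (if card E - 1 \<le> m then Inl ` {1..CARD('n) - (card E - 1)} else Inr ` (C - E))" for E
    define N :: "(real^'n) set \<Rightarrow> nat + real^'n \<Rightarrow> real^'n"
      where "N E j = (case j of Inl i \<Rightarrow> nf (convex hull E) i | Inr v \<Rightarrow> nF (convex hull (C - {v})))" for E j
    define \<beta> :: "(real^'n) set \<Rightarrow> nat + real^'n \<Rightarrow> (real^'n \<Rightarrow> real^'n) \<Rightarrow> real"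
      where "\<beta> E j = (case j of Inl i \<Rightarrow> b (convex hull E) i | Inr v \<Rightarrow> cc (convex hull (C - {v})) (convex hull E))" for E j
    have nFk: "\<exists>k. k \<noteq> 0 \<and> nF (convex hull (C - {v})) = k *\<^sub>R G v" if v: "v \<in> C" for v
      by (rule facet_normal[OF v nF[OF v]]) (intro exI conjI)
    have finJ: "finite (J E)" for E using finite_C by (simp add: J_def)
    have exM: "\<exists>M. \<forall>j\<in>J E. \<forall>j'\<in>J E. N E j \<bullet> M j' = (if j = j' then 1 else 0)"
      if E: "E \<subseteq> C" "2 \<le> card E" "card E \<le> CARD('n)" for E
    proof (cases "card E - 1 \<le> m")
      case True
      have cE: "card E = (card E - 1) + 1" using E by simp
      note nfE = nf[OF True E(1) cE]
      have J: "J E = Inl ` {1..CARD('n) - (card E - 1)}" using True by (simp add: J_def)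
      have im: "N E ` J E = nf (convex hull E) ` {1..CARD('n) - (card E - 1)}"
        unfolding J image_image by (simp add: N_def)
      have "inj_on (N E) (J E)" using nfE unfolding J by (auto simp: inj_on_def N_def)
      moreover have "independent (N E ` J E)" unfolding im using nfE by blast
      ultimately obtain M where "\<forall>j\<in>J E. \<forall>j'\<in>J E. N E j \<bullet> M j' = (if j = j' then 1 else 0)"
        by (rule dual_family)
      then show ?thesis by (intro exI[of _ M])
    next
      case False
      then have J: "J E = Inr ` (C - E)" by (simp add: J_def)
      have "\<forall>v\<in>C. \<exists>k. k \<noteq> 0 \<and> nF (convex hull (C - {v})) = k *\<^sub>R G v" using nFk by (intro ballI)
      from bchoice[OF this] obtain k where k: "\<forall>v\<in>C. k v \<noteq> 0 \<and> nF (convex hull (C - {v})) = k v *\<^sub>R G v"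
        by (rule exE)
      have "\<not> E \<subseteq> {}" using E(2) by auto
      then obtain e where e: "e \<in> E" by blast
      \<comment> \<open>The gradients of the vertices off the face are dual to vertex differences:
        \<open>G v \<bullet> (v' - e)\<close> is 1 for \<open>v' = v\<close> and 0 otherwise. The
        factor \<open>k v\<close> is the scale of the facet normal.\<close>
      define M where "M j = (case j of Inl (i::nat) \<Rightarrow> 0 | Inr v \<Rightarrow> (1 / k v) *\<^sub>R (v - e))" for j
      have "N E (Inr v) \<bullet> M (Inr v') = (if v = v' then 1 else 0)" if v: "v \<in> C - E" "v' \<in> C - E" for v v'
      proof -
        have "bary v v' = (if v' = v then 1 else 0)" "bary v e = 0"
          using v e E(1) bary_vertex[of v] by auto
        then have "G v \<bullet> (v' - e) = (if v' = v then 1 else 0)"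
          by (simp add: bary_def inner_diff_right)
        then show ?thesis using k v by (auto simp: N_def M_def)
      qed
      then show ?thesis unfolding J by (intro exI[of _ M]) auto
    qed
    then have "\<forall>E\<in>{E. E \<subseteq> C \<and> 2 \<le> card E \<and> card E \<le> CARD('n)}. \<exists>M. \<forall>j\<in>J E. \<forall>j'\<in>J E.
      N E j \<bullet> M j' = (if j = j' then 1 else 0)" by (intro ballI exM) simp_all
    from bchoice[OF this] obtain M where M: "\<forall>E\<in>{E. E \<subseteq> C \<and> 2 \<le> card E \<and> card E \<le> CARD('n)}. \<forall>j\<in>J E. \<forall>j'\<in>J E.
      N E j \<bullet> M E j' = (if j = j' then 1 else 0)" by (rule exE)
    have low: "j \<in> J E \<Longrightarrow> card E - 1 \<le> m \<Longrightarrow> \<exists>i\<in>{1..CARD('n) - (card E - 1)}. j = Inl i" for E j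
      by (auto simp: J_def)
    have high: "j \<in> J E \<Longrightarrow> \<not> card E - 1 \<le> m \<Longrightarrow> \<exists>v\<in>C - E. j = Inr v" for E j
      by (auto simp: J_def)
    have Nt: "N E j \<bullet> t = 0" if E: "E \<subseteq> C" "2 \<le> card E" "card E \<le> CARD('n)" and j: "j \<in> J E"
      and t: "t \<in> tangent_space (convex hull E)" for E j t
    proof (cases "card E - 1 \<le> m")
      case True
      obtain i where i: "i \<in> {1..CARD('n) - (card E - 1)}" "j = Inl i" using low[OF j True] by blast
      have cE: "card E = (card E - 1) + 1" using E by simp
      show ?thesis using nf[OF True E(1) cE] i t by (auto simp: N_def normal_vector_def)
    next
      case False
      obtain v where v: "v \<in> C - E" "j = Inr v" using high[OF j False] by blast
      obtain k where "nF (convex hull (C - {v})) = k *\<^sub>R G v"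
        using nFk[of v] v(1) by (elim exE conjE DiffE) auto
      then show ?thesis using tangent_orthogonal[OF E(1) v(1) t] v by (simp add: N_def)
    qed
    have linb: "linear_form_on (moment_space r (card E - 1) (convex hull E)) (\<beta> E j)"
      if E: "E \<subseteq> C" "2 \<le> card E" "card E \<le> CARD('n)" and j: "j \<in> J E" for E j
    proof -
      have cE: "card E = (card E - 1) + 1" using E by simp
      show ?thesis
      proof (cases "card E - 1 \<le> m")
        case True
        obtain i where i: "i \<in> {1..CARD('n) - (card E - 1)}" "j = Inl i" using low[OF j True] by blast
        have "card E - 1 \<in> {1..m}" using True E by simp
        from b[rule_format, OF this faceT[OF E(1) cE] i(1)] show ?thesis using i by (simp add: \<beta>_def)
      next
        case False
        obtain v where v: "v \<in> C - E" "j = Inr v" using high[OF j False] by blast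
        have l: "card E - 1 \<in> {m+1..CARD('n) - 1}" using False E by simp
        have F: "convex hull (C - {v}) \<in> subsimplices (CARD('n) - 1) ?T" using v by (intro facI) blast
        have "E \<subseteq> C - {v}" using v E by blast
        from cc[rule_format, OF F l faceF[OF this cE]] show ?thesis using v by (simp add: \<beta>_def)
      qed
    qed
    have atr: "trace (a v) = 0" if "v \<in> C" for v
      using a that vertices_iff by (simp add: trace_free_def)
    have "\<exists>A. deg_below (r + 1) A \<and> (\<forall>x. trace (A x) = 0) \<and> (\<forall>v\<in>C. A v = a v) \<and>
      (\<forall>E\<subseteq>C. 2 \<le> card E \<longrightarrow> card E \<le> CARD('n) \<longrightarrow> (\<forall>j\<in>J E. \<forall>q\<in>moment_space r (card E - 1) (convex hull E).
         normal_moment (convex hull E) (N E j) A q = \<beta> E j q))"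
    proof (rule face_data_exists[OF co r, where J=J and N=N and M=M and \<beta>=\<beta> and a=a])
      show "N E j \<bullet> M E j' = (if j = j' then 1 else 0)"
        if h: "E \<subseteq> C" "2 \<le> card E" "card E \<le> CARD('n)" "j \<in> J E" "j' \<in> J E" for E j j'
      proof -
        have "E \<in> {E. E \<subseteq> C \<and> 2 \<le> card E \<and> card E \<le> CARD('n)}" using h(1-3) by simp
        from M[rule_format, OF this h(4,5)] show ?thesis .
      qed
    qed (rule finJ Nt linb atr order_refl; assumption)+
    then obtain A0 where A0: "deg_below (r + 1) A0" "\<forall>x. trace (A0 x) = 0" "\<forall>v\<in>C. A0 v = a v"
      "\<forall>E\<subseteq>C. 2 \<le> card E \<longrightarrow> card E \<le> CARD('n) \<longrightarrow> (\<forall>j\<in>J E. \<forall>q\<in>moment_space r (card E - 1) (convex hull E).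
         normal_moment (convex hull E) (N E j) A0 q = \<beta> E j q)"
      by (elim exE conjE)
    define A1 where "A1 = (\<lambda>x. if x \<in> ?T then A0 x else 0)"
    have A1: "A1 \<in> poly_space (int r) ?T trace_free" unfolding A1_def
      by (rule poly_space_of_deg_below[OF A0(1)]) (use A0(2) in \<open>simp add: trace_free_def\<close>)
    note bub = div_bubbles_subset[of "int r" ?T]
    have "linear_form_on (div_bubbles (int r) ?T) (\<lambda>q. d q - interior_moment ?T A1 q)"
      by (rule linear_form_on_diff[OF d linear_form_mono[OF interior_moment_linear[OF compT A1] bub]])
    from riesz_poly_space[OF div_bubbles_subspace bub
        inner_form_mono[OF interior_moment_inner_form[OF compT convex_convex_hull interior_nonempty] bub] this]
    \<comment> \<open>The final correction represents, on the bubble space, the residual of the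
      interior moments.\<close>
    obtain W where W: "W \<in> div_bubbles (int r) ?T"
      "\<forall>q\<in>div_bubbles (int r) ?T. interior_moment ?T W q = d q - interior_moment ?T A1 q" by (elim bexE)
    have Wp: "W \<in> poly_space (int r) ?T trace_free" using W(1) bub by blast
    define A where "A = (\<lambda>x. A1 x + W x)"
    have Ap: "A \<in> poly_space (int r) ?T trace_free" unfolding A_def
      by (rule fun_subspace_add[OF poly_space_subspace[OF subspace_trace_free] A1 Wp])
    have moment: "normal_moment (convex hull E) \<nu> A q = normal_moment (convex hull E) \<nu> A0 q"
      if E: "E \<subseteq> C" "E \<noteq> {}" and \<nu>: "\<And>t. t \<in> tangent_space (convex hull E) \<Longrightarrow> \<nu> \<bullet> t = 0" for E \<nu> q
      unfolding normal_moment_def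
    proof (rule set_lebesgue_integral_cong)
      show "convex hull E \<in> sets (surface_measure (convex hull E))"
        using borel_compact[OF compact_face[OF E(1)]] by simp
      show "\<forall>x. x \<in> convex hull E \<longrightarrow> (A x *v \<nu>) \<bullet> q x = (A0 x *v \<nu>) \<bullet> q x"
      proof (intro allI impI)
        fix x assume x: "x \<in> convex hull E"
        have "W x *v \<nu> = 0" by (rule bubble_normal_zero[OF co W(1) E x \<nu>])
        then show "(A x *v \<nu>) \<bullet> q x = (A0 x *v \<nu>) \<bullet> q x"
          using inT[OF E(1) x] by (simp add: A_def A1_def matrix_vector_mult_add_rdistrib)
      qed
    qed
    have "dofs A" unfolding dofs_def
    proof (intro conjI allI ballI impI)
      fix v assume "{v} \<in> subsimplices 0 ?T"
      then have v: "v \<in> C" by (simp add: vertices_iff)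
      \<comment> \<open>The tangent space of a vertex is zero, so every vector is normal there and
        the whole matrix vanishes.\<close>
      have "W v *v x = 0" for x
        by (rule bubble_normal_zero[OF co W(1), of "{v}"]) (use v in \<open>auto simp: tangent_space_def\<close>)
      then have "W v = 0" using matrix_eq[of "W v" 0] by simp
      then show "A v = a v" using A0(3) v inT[of "{v}" v] by (simp add: A_def A1_def)
    next
      fix l f i q assume l: "l \<in> {1..m}" and f: "f \<in> subsimplices l ?T"
        and i: "i \<in> {1..CARD('n) - l}" and q: "q \<in> moment_space r l f"
      obtain E where E: "E \<subseteq> C" "card E = l + 1" "f = convex hull E"
        by (rule subsimplicesE[OF subset_refl f])
      have j: "Inl i \<in> J E" using l i E(2) by (simp add: J_def)
      have E': "2 \<le> card E" "card E \<le> CARD('n)" using l m n E(2) by auto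
      have "normal_moment (convex hull E) (N E (Inl i)) A q = normal_moment (convex hull E) (N E (Inl i)) A0 q"
        by (rule moment[OF E(1)]) (use E' Nt[OF E(1) E' j] in auto)
      also have "\<dots> = \<beta> E (Inl i) q"
        by (rule A0(4)[rule_format, OF E(1) E' j]) (use q E in simp)
      finally show "normal_moment f (nf f i) A q = b f i q" using E(3) by (simp add: N_def \<beta>_def)
    next
      fix F l f q assume F: "F \<in> subsimplices (CARD('n) - 1) ?T" and l: "l \<in> {m+1..CARD('n) - 1}"
        and f: "f \<in> subsimplices l F" and q: "q \<in> moment_space r l f"
      obtain v where v: "v \<in> C" "F = convex hull (C - {v})" using F unfolding fac by (elim bexE)
      obtain E where E: "E \<subseteq> C - {v}" "card E = l + 1" "f = convex hull E"
        by (rule subsimplicesE[OF Diff_subset f[unfolded v(2)]])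
      have EC: "E \<subseteq> C" using E(1) by blast
      have j: "Inr v \<in> J E" using l v E(1,2) by (auto simp: J_def)
      have E': "2 \<le> card E" "card E \<le> CARD('n)" using l n E(2) by auto
      have "normal_moment (convex hull E) (N E (Inr v)) A q = normal_moment (convex hull E) (N E (Inr v)) A0 q"
        by (rule moment[OF EC]) (use E' Nt[OF EC E' j] in auto)
      also have "\<dots> = \<beta> E (Inr v) q"
        by (rule A0(4)[rule_format, OF EC E' j]) (use q E in simp)
      finally show "normal_moment f (nF F) A q = cc F f q" using E(3) v(2) by (simp add: N_def \<beta>_def)
    next
      fix q assume q: "q \<in> div_bubbles (int r) ?T"
      have qp: "q \<in> poly_space (int r) ?T trace_free" using q bub by blast
      have "interior_moment ?T q (\<lambda>x. A1 x + W x) = interior_moment ?T q A1 + interior_moment ?T q W"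
        by (rule linear_form_add[OF interior_moment_linear[OF compT qp] A1 Wp])
      then have "interior_moment ?T A q = interior_moment ?T A1 q + interior_moment ?T W q"
        by (simp only: A_def interior_moment_commute[of ?T q])
      then show "interior_moment ?T A q = d q" using W(2) q by simp
    qed (rule Ap)
    then show "\<exists>A. dofs A" by (intro exI[of _ A])
  next
    fix A B assume A: "dofs A" and B: "dofs B"
    have Ap: "A \<in> poly_space (int r) ?T trace_free" and Bp: "B \<in> poly_space (int r) ?T trace_free"
      using A B by (simp_all add: dofs_def)
    define D where "D = (\<lambda>x. A x - B x)"
    have Dp: "D \<in> poly_space (int r) ?T trace_free" unfolding D_def
      by (rule fun_subspace_diff[OF poly_space_subspace[OF subspace_trace_free] Ap Bp])
    obtain D' where D': "deg_below (r + 1) D'" "\<forall>x\<in>?T. D' x = D x" "\<forall>x\<in>?T. D' x \<in> trace_free"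
      using Dp by (rule poly_space_deg_belowE)
    have moment: "normal_moment (convex hull E) \<nu> D' q = normal_moment (convex hull E) \<nu> A q - normal_moment (convex hull E) \<nu> B q"
      if E: "E \<subseteq> C" and q: "q \<in> moment_space r l (convex hull E)" for E \<nu> l q
    proof -
      have sub: "convex hull E \<subseteq> ?T" by (rule hull_mono[OF E])
      note cA = continuous_on_subset[OF poly_space_continuous[OF Ap] sub]
        and cB = continuous_on_subset[OF poly_space_continuous[OF Bp] sub]
      have "normal_moment (convex hull E) \<nu> D' q = normal_moment (convex hull E) \<nu> (\<lambda>x. A x + (-1) *\<^sub>R B x) q"
        by (rule normal_moment_cong[OF compact_face[OF E]]) (use D'(2) inT[OF E] in \<open>simp add: D_def\<close>)
      also have "\<dots> = normal_moment (convex hull E) \<nu> A q + (-1) * normal_moment (convex hull E) \<nu> B q"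
        by (rule normal_moment_add_scale_field[OF compact_face[OF E] cA cB poly_space_continuous[OF q]])
      finally show ?thesis by simp
    qed
    have tr: "D' x *v G v0 = 0" if v0: "v0 \<in> C" and x: "x \<in> convex hull (C - {v0})" for v0 x
    proof (rule facet_trace_zero[OF co v0 D'(1) _ nF[OF v0] _ _ _ x])
      show "(\<forall>i\<in>{1..CARD('n) - l}. normal_vector (convex hull E) (nf (convex hull E) i)) \<and>
        inj_on (nf (convex hull E)) {1..CARD('n) - l} \<and> independent (nf (convex hull E) ` {1..CARD('n) - l})"
        if "1 \<le> l" "l \<le> m" "E \<subseteq> C" "card E = l + 1" for l E
        by (rule nf[OF that(2,3,4)])
      show "D' v = 0" if "v \<in> C - {v0}" for v
      proof -
        have "A v = a v" "B v = a v" using A B that vertices_iff[of v] by (simp_all add: dofs_def)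
        then show ?thesis using D'(2) inT[of "{v}" v] that by (simp add: D_def)
      qed
      show "normal_moment (convex hull E) (nf (convex hull E) i) D' q = 0"
        if h: "1 \<le> l" "l \<le> m" "E \<subseteq> C - {v0}" "card E = l + 1" "i \<in> {1..CARD('n) - l}"
          "q \<in> moment_space r l (convex hull E)" for l E i q
      proof -
        have EC: "E \<subseteq> C" using h(3) by blast
        have l: "l \<in> {1..m}" using h by simp
        have "normal_moment (convex hull E) (nf (convex hull E) i) A q = b (convex hull E) i q"
          "normal_moment (convex hull E) (nf (convex hull E) i) B q = b (convex hull E) i q"
          by (rule dofs_low[OF A l faceT[OF EC h(4)] h(5,6)] dofs_low[OF B l faceT[OF EC h(4)] h(5,6)])+
        then show ?thesis using moment[OF EC h(6)] by simp
      qed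
      show "normal_moment (convex hull E) (nF (convex hull (C - {v0}))) D' q = 0"
        if h: "m + 1 \<le> l" "l \<le> CARD('n) - 1" "E \<subseteq> C - {v0}" "card E = l + 1"
          "q \<in> moment_space r l (convex hull E)" for l E q
      proof -
        have EC: "E \<subseteq> C" using h(3) by blast
        have l: "l \<in> {m+1..CARD('n) - 1}" using h by simp
        have F: "convex hull (C - {v0}) \<in> subsimplices (CARD('n) - 1) ?T" by (rule facI[OF v0])
        have "normal_moment (convex hull E) (nF (convex hull (C - {v0}))) A q = cc (convex hull (C - {v0})) (convex hull E) q"
          "normal_moment (convex hull E) (nF (convex hull (C - {v0}))) B q = cc (convex hull (C - {v0})) (convex hull E) q"
          by (rule dofs_high[OF A F l faceF[OF h(3,4)] h(5)] dofs_high[OF B F l faceF[OF h(3,4)] h(5)])+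
        then show ?thesis using moment[OF EC h(5)] by simp
      qed
    qed
    have "D x *v G v = 0" if v: "v \<in> C" "x \<in> convex hull (C - {v})" for v x
      using tr[OF v] D'(2) inT[of "C - {v}" x] v by simp
    \<comment> \<open>The difference is a bubble, hence an admissible test function in (d); tested
      with itself it has L2 norm zero.\<close>
    then have Db: "D \<in> div_bubbles (int r) ?T" using Dp by (simp add: div_bubbles_iff[OF co])
    have "interior_moment ?T A D = d D" "interior_moment ?T B D = d D"
      by (rule dofs_int[OF A Db] dofs_int[OF B Db])+
    then have "interior_moment ?T D A = d D" "interior_moment ?T D B = d D"
      by (simp_all only: interior_moment_commute[of ?T D])
    moreover have "interior_moment ?T D (\<lambda>x. A x - B x) = interior_moment ?T D A - interior_moment ?T D B"
      by (rule linear_form_diff[OF poly_space_subspace[OF subspace_trace_free] interior_moment_linear[OF compT Dp] Ap Bp])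
    ultimately have "interior_moment ?T D D = 0" unfolding D_def[symmetric] by simp
    then have "D = (\<lambda>x. 0)"
      by (rule interior_moment_inner_form[OF compT convex_convex_hull interior_nonempty, unfolded inner_form_on_def,
            THEN conjunct2, THEN conjunct2, rule_format, OF Dp])
    then show "A = B" by (simp add: D_def fun_eq_iff)
  qed
  then show "\<exists>!A. A \<in> poly_space (int r) ?T trace_free \<and>
         (\<forall>v. {v} \<in> subsimplices 0 ?T \<longrightarrow> A v = a v) \<and>
         (\<forall>l\<in>{1..m}. \<forall>f\<in>subsimplices l ?T. \<forall>i\<in>{1..CARD('n) - l}. \<forall>q\<in>moment_space r l f.
            normal_moment f (nf f i) A q = b f i q) \<and>
         (\<forall>F\<in>subsimplices (CARD('n) - 1) ?T. \<forall>l\<in>{m+1..CARD('n) - 1}. \<forall>f\<in>subsimplices l F.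
            \<forall>q\<in>moment_space r l f. normal_moment f (nF F) A q = cc F f q) \<and>
         (\<forall>q\<in>div_bubbles (int r) ?T. interior_moment ?T A q = d q)"
    unfolding dofs_def .
qed

section \<open>Gradients\<close>

text \<open>Continuous differentiability on the whole space, with the gradient as an explicit vector
  field because gradients appear under the integrals.\<close>

definition has_grad :: "('a::euclidean_space \<Rightarrow> real) \<Rightarrow> ('a \<Rightarrow> 'a) \<Rightarrow> bool" where
  "has_grad h g \<longleftrightarrow> (\<forall>x. (h has_derivative (\<lambda>v. g x \<bullet> v)) (at x)) \<and> continuous_on UNIV g"

lemma has_gradD: "has_grad h g \<Longrightarrow> (h has_derivative (\<lambda>v. g x \<bullet> v)) (at x)"
  and has_grad_continuous_grad: "has_grad h g \<Longrightarrow> continuous_on UNIV g"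
  by (auto simp: has_grad_def)

lemma has_grad_continuous: "has_grad h g \<Longrightarrow> continuous_on S h"
  by (meson has_gradD has_derivative_continuous continuous_at_imp_continuous_on)

lemma has_grad_const: "has_grad (\<lambda>x. c) (\<lambda>x. 0)"
  by (simp add: has_grad_def)

lemma has_grad_inner: "has_grad (\<lambda>x. a \<bullet> x + c) (\<lambda>x. a)"
proof -
  have "((\<lambda>x. a \<bullet> x + c) has_derivative (\<lambda>v. a \<bullet> v)) (at x)" for x
    by (auto intro!: derivative_eq_intros)
  then show ?thesis by (simp add: has_grad_def)
qed

lemma has_grad_add:
  assumes "has_grad h g" "has_grad h' g'"
  shows "has_grad (\<lambda>x. h x + h' x) (\<lambda>x. g x + g' x)"
  unfolding has_grad_def
proof (intro conjI allI)
  fix x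
  have "((\<lambda>x. h x + h' x) has_derivative (\<lambda>v. g x \<bullet> v + g' x \<bullet> v)) (at x)"
    by (rule has_derivative_add[OF has_gradD[OF assms(1)] has_gradD[OF assms(2)]])
  then show "((\<lambda>x. h x + h' x) has_derivative (\<lambda>v. (g x + g' x) \<bullet> v)) (at x)"
    by (simp add: inner_add_left)
  show "continuous_on UNIV (\<lambda>x. g x + g' x)"
    by (intro continuous_on_add has_grad_continuous_grad[OF assms(1)] has_grad_continuous_grad[OF assms(2)])
qed

lemma has_grad_mult:
  assumes "has_grad h g" "has_grad h' g'"
  shows "has_grad (\<lambda>x. h x * h' x) (\<lambda>x. h x *\<^sub>R g' x + h' x *\<^sub>R g x)"
  unfolding has_grad_def
proof (intro conjI allI)
  fix x
  have "((\<lambda>x. h x * h' x) has_derivative (\<lambda>v. h x * (g' x \<bullet> v) + (g x \<bullet> v) * h' x)) (at x)"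
    by (rule has_derivative_mult[OF has_gradD[OF assms(1)] has_gradD[OF assms(2)]])
  moreover have "(\<lambda>v. h x * (g' x \<bullet> v) + (g x \<bullet> v) * h' x) = (\<lambda>v. (h x *\<^sub>R g' x + h' x *\<^sub>R g x) \<bullet> v)"
    by (auto simp: inner_add_left mult.commute)
  ultimately show "((\<lambda>x. h x * h' x) has_derivative (\<lambda>v. (h x *\<^sub>R g' x + h' x *\<^sub>R g x) \<bullet> v)) (at x)"
    by (simp only:)
  show "continuous_on UNIV (\<lambda>x. h x *\<^sub>R g' x + h' x *\<^sub>R g x)"
    by (intro continuous_intros has_grad_continuous[OF assms(1)] has_grad_continuous[OF assms(2)]
      has_grad_continuous_grad[OF assms(1)] has_grad_continuous_grad[OF assms(2)])
qed

lemma has_grad_cmult: "has_grad h g \<Longrightarrow> has_grad (\<lambda>x. c * h x) (\<lambda>x. c *\<^sub>R g x)"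
  using has_grad_mult[OF has_grad_const[of c], of h g] by simp

lemma has_grad_sum:
  assumes "\<And>i. i \<in> I \<Longrightarrow> has_grad (h i) (g i)"
  shows "has_grad (\<lambda>x. \<Sum>i\<in>I. h i x) (\<lambda>x. \<Sum>i\<in>I. g i x)"
  using assms
  by (induction I rule: infinite_finite_induct) (simp_all add: has_grad_const has_grad_add)

lemma has_grad_prod:
  assumes "finite I" "\<And>i. i \<in> I \<Longrightarrow> has_grad (h i) (g i)"
  shows "has_grad (\<lambda>x. \<Prod>i\<in>I. h i x) (\<lambda>x. \<Sum>i\<in>I. (\<Prod>j\<in>I - {i}. h j x) *\<^sub>R g i x)"
  using assms
proof (induction I rule: finite_induct)
  case empty then show ?case by (simp add: has_grad_const)
next
  case (insert a I)
  have IH: "has_grad (\<lambda>x. \<Prod>i\<in>I. h i x) (\<lambda>x. \<Sum>i\<in>I. (\<Prod>j\<in>I - {i}. h j x) *\<^sub>R g i x)"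
    using insert by simp
  have "h a x *\<^sub>R (\<Sum>i\<in>I. (\<Prod>j\<in>I - {i}. h j x) *\<^sub>R g i x) = (\<Sum>i\<in>I. (\<Prod>j\<in>insert a I - {i}. h j x) *\<^sub>R g i x)" for x
    unfolding scaleR_sum_right
  proof (rule sum.cong[OF refl])
    fix i assume i: "i \<in> I"
    then have "insert a I - {i} = insert a (I - {i})" using insert.hyps by auto
    then show "h a x *\<^sub>R ((\<Prod>j\<in>I - {i}. h j x) *\<^sub>R g i x) = (\<Prod>j\<in>insert a I - {i}. h j x) *\<^sub>R g i x"
      using insert.hyps by simp
  qed
  moreover have "insert a I - {a} = I" using insert.hyps by auto
  ultimately show ?case
    using has_grad_mult[OF insert.prems[of a] IH] insert.hyps by (simp add: add.commute)
qed

lemma has_grad_compose_real: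
  assumes "has_grad h g" "\<And>t. (s has_real_derivative s' t) (at t)" "continuous_on UNIV s'"
  shows "has_grad (\<lambda>x. s (h x)) (\<lambda>x. s' (h x) *\<^sub>R g x)"
  unfolding has_grad_def
proof (intro conjI allI)
  fix x
  have "(s has_derivative (*) (s' (h x))) (at (h x))"
    using assms(2) by (simp add: has_field_derivative_def)
  from has_derivative_compose[OF has_gradD[OF assms(1)] this]
  show "((\<lambda>x. s (h x)) has_derivative (\<lambda>v. (s' (h x) *\<^sub>R g x) \<bullet> v)) (at x)" by simp
  have "continuous_on UNIV (\<lambda>x. s' (h x))"
    by (rule continuous_on_compose2[OF assms(3) has_grad_continuous[OF assms(1)]]) simp
  then show "continuous_on UNIV (\<lambda>x. s' (h x) *\<^sub>R g x)"
    by (intro continuous_on_scaleR has_grad_continuous_grad[OF assms(1)])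
qed

text \<open>The gradient is transported by the adjoint of the derivative, which sends v to
  \<open>v + (a \<bullet> v) *\<^sub>R u\<close>. It is used for fields composed with
  \<open>vertex_move\<close>.\<close>

lemma has_grad_compose_rank_one:
  assumes "has_grad h g"
  shows "has_grad (\<lambda>x. h (x + (a \<bullet> x + c) *\<^sub>R u))
    (\<lambda>x. g (x + (a \<bullet> x + c) *\<^sub>R u) + (g (x + (a \<bullet> x + c) *\<^sub>R u) \<bullet> u) *\<^sub>R a)"
  unfolding has_grad_def
proof (intro conjI allI)
  fix x
  let ?y = "x + (a \<bullet> x + c) *\<^sub>R u"
  have "((\<lambda>x. x + (a \<bullet> x + c) *\<^sub>R u) has_derivative (\<lambda>v. v + (a \<bullet> v) *\<^sub>R u)) (at x)"
    by (auto intro!: derivative_eq_intros)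
  from has_derivative_compose[OF this has_gradD[OF assms]]
  have "((\<lambda>x. h (x + (a \<bullet> x + c) *\<^sub>R u)) has_derivative (\<lambda>v. g ?y \<bullet> (v + (a \<bullet> v) *\<^sub>R u))) (at x)" .
  moreover have "(\<lambda>v. g ?y \<bullet> (v + (a \<bullet> v) *\<^sub>R u)) = (\<lambda>v. (g ?y + (g ?y \<bullet> u) *\<^sub>R a) \<bullet> v)"
    by (auto simp: inner_add_left inner_add_right)
  ultimately show "((\<lambda>x. h (x + (a \<bullet> x + c) *\<^sub>R u)) has_derivative (\<lambda>v. (g ?y + (g ?y \<bullet> u) *\<^sub>R a) \<bullet> v)) (at x)"
    by (simp only:)
next
  have "continuous_on UNIV (\<lambda>x. g (x + (a \<bullet> x + c) *\<^sub>R u))"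
    by (rule continuous_on_compose2[OF has_grad_continuous_grad[OF assms]]) (auto intro!: continuous_intros)
  then show "continuous_on UNIV (\<lambda>x. g (x + (a \<bullet> x + c) *\<^sub>R u) + (g (x + (a \<bullet> x + c) *\<^sub>R u) \<bullet> u) *\<^sub>R a)"
    by (intro continuous_intros)
qed

lemma deg_below_has_grad:
  fixes p :: "real^'n \<Rightarrow> real"
  shows "deg_below k p \<Longrightarrow> \<exists>g. has_grad p g"
proof (induction k arbitrary: p)
  case 0
  then have "p = (\<lambda>x. 0)" by (simp only: deg_below.simps)
  then show ?case using has_grad_const[of 0] by (intro exI[of _ "\<lambda>x. 0"]) simp
next
  case (Suc k)
  obtain c q where q: "\<forall>i. deg_below k (q i)" "p = (\<lambda>x. c + (\<Sum>i\<in>UNIV. (x $ i) *\<^sub>R q i x))"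
    using Suc.prems unfolding deg_below.simps by (elim exE conjE)
  have "\<forall>i. \<exists>g. has_grad (q i) g" using Suc.IH q(1) by simp
  from choice[OF this] obtain g where g: "\<forall>i. has_grad (q i) (g i)" by (rule exE)
  have co: "has_grad (\<lambda>x :: real^'n. x $ i) (\<lambda>x. axis i 1)" for i
    using has_grad_inner[of "axis i 1 :: real^'n" 0] by (simp add: inner_axis' inner_real_def)
  have "has_grad (\<lambda>x. c + (\<Sum>i\<in>UNIV. (x $ i) * q i x))
     (\<lambda>x. 0 + (\<Sum>i\<in>UNIV. (x $ i) *\<^sub>R g i x + q i x *\<^sub>R axis i 1))"
    by (intro has_grad_add has_grad_const has_grad_sum has_grad_mult co g[rule_format])
  then show ?case unfolding q(2) real_scaleR_def
    by (intro exI[of _ "\<lambda>x. 0 + (\<Sum>i\<in>UNIV. (x $ i) *\<^sub>R g i x + q i x *\<^sub>R axis i 1)"])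
qed

lemma C_k_has_grad:
  assumes "\<forall>k. C_k k \<phi>"
  shows "has_grad \<phi> (gradient \<phi>)"
  unfolding has_grad_def
proof (intro conjI allI)
  have 1: "C_k (Suc 0) \<phi>" using assms by blast
  fix x
  have "\<phi> differentiable (at x)" using 1 by (simp add: differentiable_on_def)
  then have d: "(\<phi> has_derivative frechet_derivative \<phi> (at x)) (at x)"
    by (simp add: frechet_derivative_works)
  then have lin: "linear (frechet_derivative \<phi> (at x))" by (rule has_derivative_linear)
  have "frechet_derivative \<phi> (at x) v = gradient \<phi> x \<bullet> v" for v
    unfolding affine_form_expand[OF lin, of v]
    by (simp add: gradient_def partial_deriv_def inner_vec_def mult.commute)
  then have "frechet_derivative \<phi> (at x) = (\<lambda>v. gradient \<phi> x \<bullet> v)" by (rule ext)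
  then show "(\<phi> has_derivative (\<lambda>v. gradient \<phi> x \<bullet> v)) (at x)" using d by simp
  have "continuous_on UNIV (partial_deriv i \<phi>)" for i using 1 by simp
  then show "continuous_on UNIV (gradient \<phi>)"
    unfolding gradient_def[abs_def] by (intro continuous_on_vec_lambda)
qed

section \<open>The integral of a compactly supported derivative\<close>

lemma has_grad_mvt:
  assumes h: "has_grad h g" and t: "t > 0"
  obtains \<xi> where "0 < \<xi>" "\<xi> < t" "h (x + t *\<^sub>R e) - h x = t * (g (x + \<xi> *\<^sub>R e) \<bullet> e)"
proof -
  have d: "((\<lambda>s. h (x + s *\<^sub>R e)) has_real_derivative (g (x + s *\<^sub>R e) \<bullet> e)) (at s)" for s
  proof -
    have "((\<lambda>s. x + s *\<^sub>R e) has_derivative (\<lambda>s. s *\<^sub>R e)) (at s)"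
      by (auto intro!: derivative_eq_intros)
    from has_derivative_compose[OF this has_gradD[OF h]] show ?thesis
      unfolding has_field_derivative_def
      by (rule has_derivative_eq_rhs) (auto simp: mult.commute)
  qed
  from MVT2[OF t, of "\<lambda>s. h (x + s *\<^sub>R e)", OF d] obtain \<xi> where
    "\<xi> > 0" "\<xi> < t" "h (x + t *\<^sub>R e) - h (x + 0 *\<^sub>R e) = (t - 0) * (g (x + \<xi> *\<^sub>R e) \<bullet> e)" by blast
  then show thesis by (intro that[of \<xi>]) auto
qed

lemma has_grad_quotient_tendsto:
  assumes h: "has_grad h g"
  shows "(\<lambda>m. (h (x + (1 / real (Suc m)) *\<^sub>R e) - h x) * real (Suc m)) \<longlonglongrightarrow> g x \<bullet> e"
proof -
  have "\<forall>m. \<exists>\<xi>. 0 < \<xi> \<and> \<xi> < 1 / real (Suc m) \<and>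
    h (x + (1 / real (Suc m)) *\<^sub>R e) - h x = (1 / real (Suc m)) * (g (x + \<xi> *\<^sub>R e) \<bullet> e)"
  proof
    fix m
    have "1 / real (Suc m) > 0" by simp
    from has_grad_mvt[OF h this, of x e] show "\<exists>\<xi>. 0 < \<xi> \<and> \<xi> < 1 / real (Suc m) \<and>
      h (x + (1 / real (Suc m)) *\<^sub>R e) - h x = (1 / real (Suc m)) * (g (x + \<xi> *\<^sub>R e) \<bullet> e)" by metis
  qed
  from choice[OF this] obtain \<xi> where \<xi>: "\<forall>m. 0 < \<xi> m \<and> \<xi> m < 1 / real (Suc m) \<and>
    h (x + (1 / real (Suc m)) *\<^sub>R e) - h x = (1 / real (Suc m)) * (g (x + \<xi> m *\<^sub>R e) \<bullet> e)" by (rule exE)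
  have "\<xi> \<longlonglongrightarrow> 0"
    by (rule tendsto_sandwich[OF _ _ tendsto_const lim_inverse_n'[THEN LIMSEQ_Suc]])
       (use \<xi> in \<open>auto intro!: always_eventually less_imp_le simp: inverse_eq_divide\<close>)
  then have "(\<lambda>m. x + \<xi> m *\<^sub>R e) \<longlonglongrightarrow> x + 0 *\<^sub>R e" by (intro tendsto_intros)
  moreover have "isCont g x" using has_grad_continuous_grad[OF h] by (simp add: continuous_on_eq_continuous_at)
  ultimately have "(\<lambda>m. g (x + \<xi> m *\<^sub>R e)) \<longlonglongrightarrow> g x"
    using isCont_tendsto_compose[of x g] by simp
  then have "(\<lambda>m. g (x + \<xi> m *\<^sub>R e) \<bullet> e) \<longlonglongrightarrow> g x \<bullet> e" by (intro tendsto_intros)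
  moreover have "g (x + \<xi> m *\<^sub>R e) \<bullet> e = (h (x + (1 / real (Suc m)) *\<^sub>R e) - h x) * real (Suc m)" for m
    using \<xi>[rule_format, of m] by simp
  ultimately show ?thesis by simp
qed

lemma lborel_integral_translate:
  fixes h :: "'a::euclidean_space \<Rightarrow> real"
  assumes "h \<in> borel_measurable borel"
  shows "(LINT x|lborel. h (x + a)) = (LINT x|lborel. h x)"
proof -
  have "(LINT x|lborel. h x) = (LINT x|distr lborel borel ((+) a). h x)" by (simp add: lborel_distr_plus)
  also have "\<dots> = (LINT x|lborel. h (a + x))" by (rule integral_distr) (use assms in auto)
  finally show ?thesis by (simp add: add.commute)
qed

lemma continuous_bounded_support_integrable:
  fixes h :: "'a::euclidean_space \<Rightarrow> real"
  assumes "continuous_on UNIV h" "compact K" "\<And>x. x \<notin> K \<Longrightarrow> h x = 0"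
  shows "integrable lborel h"
proof -
  have "integrable lborel (\<lambda>x. indicator K x *\<^sub>R h x)"
    by (rule borel_integrable_compact[OF assms(2)]) (rule continuous_on_subset[OF assms(1)], simp)
  moreover have "(\<lambda>x. indicator K x *\<^sub>R h x) = h" by (auto simp: indicator_def fun_eq_iff assms(3))
  ultimately show ?thesis by simp
qed

text \<open>Difference quotients have integral zero by translation invariance, and they converge to
  the directional derivative with a common bound on a compact set.\<close>

lemma integral_gradient_eq_0:
  fixes h :: "'a::euclidean_space \<Rightarrow> real"
  assumes h: "has_grad h g" and K: "compact K" "\<And>x. x \<notin> K \<Longrightarrow> h x = 0"
  shows "(LINT x|lborel. g x \<bullet> e) = 0"
proof -
  have hc: "continuous_on UNIV h" by (rule has_grad_continuous[OF h])
  have gc: "continuous_on UNIV g" by (rule has_grad_continuous_grad[OF h])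
  have hm: "h \<in> borel_measurable borel" by (rule borel_measurable_continuous_onI[OF hc])
  obtain R where R: "\<And>x. x \<in> K \<Longrightarrow> norm x \<le> R" using compact_imp_bounded[OF K(1)] bounded_iff by blast
  \<comment> \<open>Outside \<open>Q\<close> all the difference quotients vanish; \<open>Q'\<close>
    is enlarged to contain the intermediate points of the mean value theorem that belong to points
    of \<open>Q\<close>.\<close>
  define Q where "Q = cball (0::'a) (R + norm e)"
  define Q' where "Q' = cball (0::'a) (R + 2 * norm e)"
  have "compact ((\<lambda>x. g x \<bullet> e) ` Q')"
    by (rule compact_continuous_image) (auto simp: Q'_def intro!: continuous_intros continuous_on_subset[OF gc])
  then have "\<exists>M. \<forall>y\<in>(\<lambda>x. g x \<bullet> e) ` Q'. norm y \<le> M"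
    by (simp only: bounded_iff[symmetric] compact_imp_bounded)
  then obtain M where M: "\<And>x. x \<in> Q' \<Longrightarrow> \<bar>g x \<bullet> e\<bar> \<le> M" by auto
  define D where "D m x = (h (x + (1 / real (Suc m)) *\<^sub>R e) - h x) * real (Suc m)" for m x
  have D0: "(LINT x|lborel. D m x) = 0" for m
  proof -
    have i: "integrable lborel h" by (rule continuous_bounded_support_integrable[OF hc K])
    have i2: "integrable lborel (\<lambda>x. h (x + (1 / real (Suc m)) *\<^sub>R e))"
    proof (rule continuous_bounded_support_integrable[where K="(\<lambda>y. y - (1 / real (Suc m)) *\<^sub>R e) ` K"])
      show "continuous_on UNIV (\<lambda>x. h (x + (1 / real (Suc m)) *\<^sub>R e))"
        by (rule continuous_on_compose2[OF hc]) (auto intro!: continuous_intros)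
      show "compact ((\<lambda>y. y - (1 / real (Suc m)) *\<^sub>R e) ` K)"
        by (rule compact_continuous_image[OF _ K(1)]) (intro continuous_intros)
      show "h (x + (1 / real (Suc m)) *\<^sub>R e) = 0" if "x \<notin> (\<lambda>y. y - (1 / real (Suc m)) *\<^sub>R e) ` K" for x
      proof (rule K(2), rule notI)
        assume "x + (1 / real (Suc m)) *\<^sub>R e \<in> K"
        then have "(x + (1 / real (Suc m)) *\<^sub>R e) - (1 / real (Suc m)) *\<^sub>R e \<in> (\<lambda>y. y - (1 / real (Suc m)) *\<^sub>R e) ` K"
          by (rule imageI)
        then show False using that by simp
      qed
    qed
    have "(LINT x|lborel. D m x) = (LINT x|lborel. h (x + (1 / real (Suc m)) *\<^sub>R e) - h x) * real (Suc m)"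
      unfolding D_def by (rule integral_mult_left_zero)
    also have "(LINT x|lborel. h (x + (1 / real (Suc m)) *\<^sub>R e) - h x) = 0"
      unfolding Bochner_Integration.integral_diff[OF i2 i] lborel_integral_translate[OF hm] by simp
    finally show ?thesis by simp
  qed
  have "(\<lambda>m. LINT x|lborel. D m x) \<longlonglongrightarrow> (LINT x|lborel. g x \<bullet> e)"
  proof (rule integral_dominated_convergence[where w="\<lambda>x. M * indicator Q x"])
    show "(\<lambda>x. g x \<bullet> e) \<in> borel_measurable lborel"
      using borel_measurable_continuous_onI[of "\<lambda>x. g x \<bullet> e"] gc by (simp add: continuous_on_inner)
    show "D m \<in> borel_measurable lborel" for m
    proof -
      have "continuous_on UNIV (D m)" unfolding D_def[abs_def]
        by (intro continuous_intros hc continuous_on_compose2[OF hc]) auto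
      then show ?thesis using borel_measurable_continuous_onI by simp
    qed
    show "integrable lborel (\<lambda>x. M * indicator Q x)"
      using emeasure_compact_finite[of Q]
      by (intro integrable_mult_right integrable_real_indicator) (simp_all add: Q_def)
    show "AE x in lborel. (\<lambda>m. D m x) \<longlonglongrightarrow> g x \<bullet> e"
      unfolding D_def by (rule AE_I2) (rule has_grad_quotient_tendsto[OF h])
    show "AE x in lborel. norm (D m x) \<le> M * indicator Q x" for m
    proof (rule AE_I2)
      fix x
      have t: "1 / real (Suc m) > 0" "1 / real (Suc m) \<le> 1" by simp_all
      show "norm (D m x) \<le> M * indicator Q x"
      proof (cases "x \<in> Q")
        case True
        obtain \<xi> where \<xi>: "0 < \<xi>" "\<xi> < 1 / real (Suc m)"
          "h (x + (1 / real (Suc m)) *\<^sub>R e) - h x = (1 / real (Suc m)) * (g (x + \<xi> *\<^sub>R e) \<bullet> e)"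
          by (rule has_grad_mvt[OF h t(1)])
        have "norm (x + \<xi> *\<^sub>R e) \<le> norm x + \<xi> * norm e"
          using norm_triangle_ineq[of x "\<xi> *\<^sub>R e"] \<xi>(1) by simp
        also have "\<dots> \<le> (R + norm e) + 1 * norm e"
        proof (intro add_mono mult_right_mono)
          show "norm x \<le> R + norm e" using True by (simp add: Q_def)
          show "\<xi> \<le> 1" using \<xi>(2) t(2) by linarith
        qed simp
        finally have "x + \<xi> *\<^sub>R e \<in> Q'" by (simp add: Q'_def)
        from M[OF this] have "\<bar>D m x\<bar> \<le> M" unfolding D_def \<xi>(3) by simp
        then show ?thesis using True by simp
      next
        case False
        then have n: "norm x > R + norm e" by (simp add: Q_def)
        have "norm ((1 / real (Suc m)) *\<^sub>R e) \<le> 1 * norm e"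
          unfolding norm_scaleR using t by (intro mult_right_mono) auto
        then have "norm (x + (1 / real (Suc m)) *\<^sub>R e) > R"
          using n norm_diff_triangle_ineq[of x "(1 / real (Suc m)) *\<^sub>R e" 0 "(1 / real (Suc m)) *\<^sub>R e"]
            norm_triangle_ineq4[of "x + (1 / real (Suc m)) *\<^sub>R e" "(1 / real (Suc m)) *\<^sub>R e"] by simp
        then have "h (x + (1 / real (Suc m)) *\<^sub>R e) = 0" using K(2) R by (meson not_less)
        moreover have "norm x > R" using n norm_ge_zero[of e] by linarith
        then have "h x = 0" using K(2) R by (meson not_less)
        ultimately show ?thesis using False by (simp add: D_def)
      qed
    qed
  qed
  then show ?thesis unfolding D0 using LIMSEQ_unique tendsto_const by metis
qed

section \<open>Cutoff functions\<close>

text \<open>The square makes the function continuously differentiable at 0. The rational form has an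
  explicit derivative, tends to 1 for every positive \<open>t\<close>, and for such \<open>t\<close>
  depends on \<open>k * t\<^sup>2\<close> alone.\<close>

definition smooth_step :: "nat \<Rightarrow> real \<Rightarrow> real" where
  "smooth_step k t = real k * (max 0 t)\<^sup>2 / (1 + real k * (max 0 t)\<^sup>2)"

definition smooth_step' :: "nat \<Rightarrow> real \<Rightarrow> real" where
  "smooth_step' k t = 2 * real k * max 0 t / (1 + real k * (max 0 t)\<^sup>2)\<^sup>2"

lemma smooth_step_denom: "1 + real k * (max 0 t)\<^sup>2 > 0"
  by (intro add_pos_nonneg) simp_all

lemma DERIV_max_sq: "((\<lambda>t. (max 0 t)\<^sup>2) has_real_derivative 2 * max 0 t) (at (t::real))"
proof -
  consider "t > 0" | "t < 0" | "t = 0" by linarith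
  then show ?thesis
  proof cases
    case 1
    have "((\<lambda>t. t\<^sup>2) has_real_derivative 2 * max 0 t) (at t)"
      using 1 by (auto intro!: derivative_eq_intros)
    then show ?thesis
      by (rule has_field_derivative_transform_within_open[where S="{0<..}"]) (use 1 in auto)
  next
    case 2
    have "((\<lambda>t. 0) has_real_derivative 2 * max 0 t) (at t)"
      using 2 by (auto intro!: derivative_eq_intros)
    then show ?thesis
      by (rule has_field_derivative_transform_within_open[where S="{..<0}"]) (use 2 in auto)
  next
    case 3
    have "(\<lambda>h::real. (max 0 h)\<^sup>2 / h) \<midarrow>0\<rightarrow> 0"
    proof (rule tendsto_0_le[where K=1 and f="\<lambda>h. h"])
      show "\<forall>\<^sub>F h in at 0. norm ((max 0 h)\<^sup>2 / h) \<le> norm (h::real) * 1"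
        by (rule always_eventually) (auto simp: max_def power2_eq_square)
    qed (rule tendsto_ident_at)
    then show ?thesis unfolding 3 DERIV_def by simp
  qed
qed

lemma DERIV_smooth_step: "(smooth_step k has_real_derivative smooth_step' k t) (at t)"
proof -
  let ?m = "(max 0 t)\<^sup>2"
  have d: "((\<lambda>t. real k * (max 0 t)\<^sup>2) has_real_derivative real k * (2 * max 0 t)) (at t)"
    by (rule DERIV_cmult[OF DERIV_max_sq])
  have "((\<lambda>t. real k * (max 0 t)\<^sup>2 / (1 + real k * (max 0 t)\<^sup>2)) has_real_derivative
    ((real k * (2 * max 0 t)) * (1 + real k * ?m) - (real k * ?m) * (0 + real k * (2 * max 0 t))) /
      ((1 + real k * ?m) * (1 + real k * ?m))) (at t)"
    by (rule DERIV_divide[OF d DERIV_add[OF DERIV_const d]]) (use smooth_step_denom[of k t] in simp)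
  moreover have "((real k * (2 * max 0 t)) * (1 + real k * ?m) - (real k * ?m) * (0 + real k * (2 * max 0 t))) =
    2 * real k * max 0 t" by (simp add: algebra_simps)
  ultimately show ?thesis unfolding smooth_step_def[abs_def] smooth_step'_def by (simp add: power2_eq_square)
qed

lemma continuous_smooth_step': "continuous_on S (smooth_step' k)"
  unfolding smooth_step'_def[abs_def]
  by (intro continuous_intros) (use smooth_step_denom in \<open>auto simp: less_imp_neq[symmetric]\<close>)

lemma smooth_step_nonpos: "t \<le> 0 \<Longrightarrow> smooth_step k t = 0"
  and smooth_step'_nonpos: "t \<le> 0 \<Longrightarrow> smooth_step' k t = 0"
  by (simp_all add: smooth_step_def smooth_step'_def)

lemma smooth_step_range: "0 \<le> smooth_step k t" "smooth_step k t \<le> 1"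
  using smooth_step_denom[of k t] by (simp_all add: smooth_step_def)

lemma smooth_step_tendsto:
  assumes "t > 0"
  shows "(\<lambda>k. smooth_step k t) \<longlonglongrightarrow> 1"
proof -
  have "(\<lambda>k. real k * t\<^sup>2 / (1 + real k * t\<^sup>2)) \<longlonglongrightarrow> 1"
    using assms by real_asymp
  then show ?thesis using assms by (simp add: smooth_step_def)
qed

text \<open>For positive \<open>t\<close> and \<open>y = k * t\<^sup>2\<close> the product is
  \<open>2 * y / (1 + y)\<^sup>2\<close>, a function of \<open>y\<close> alone. This gives a bound
  uniform in \<open>k\<close>, although the derivative itself grows like the square root of
  \<open>k\<close>.\<close>

lemma smooth_step'_mult_range: "0 \<le> t * smooth_step' k t" "t * smooth_step' k t \<le> 1"
proof -
  have "0 \<le> t * smooth_step' k t \<and> t * smooth_step' k t \<le> 1"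
  proof (cases "t \<le> 0")
    case True then show ?thesis by (simp add: smooth_step'_nonpos)
  next
    case False
    define y where "y = real k * t\<^sup>2"
    have y: "y \<ge> 0" by (simp add: y_def)
    have "t * smooth_step' k t = 2 * y / (1 + y)\<^sup>2"
      using False by (simp add: smooth_step'_def y_def power2_eq_square)
    moreover have "2 * y \<le> (1 + y)\<^sup>2" by (simp add: power2_sum)
    ultimately show ?thesis using y by (simp add: divide_le_eq_1)
  qed
  then show "0 \<le> t * smooth_step' k t" "t * smooth_step' k t \<le> 1" by auto
qed

lemma smooth_step'_mult_tendsto: "(\<lambda>k. t * smooth_step' k t) \<longlonglongrightarrow> 0"
proof (cases "t \<le> 0")
  case True then show ?thesis by (simp add: smooth_step'_nonpos)
next
  case False
  then have "t > 0" by simp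
  then have "(\<lambda>k. t * (2 * real k * t / (1 + real k * t\<^sup>2)\<^sup>2)) \<longlonglongrightarrow> 0" by real_asymp
  then show ?thesis using False by (simp add: smooth_step'_def)
qed

section \<open>Cutoffs of a simplex and their gradient layers\<close>

context affine_coords
begin

definition cutoff :: "nat \<Rightarrow> 'a \<Rightarrow> real" where
  "cutoff k x = (\<Prod>v\<in>C. smooth_step k (bary v x))"

text \<open>The coefficient of \<open>G v\<close> in the gradient of
  \<open>cutoff k\<close>.\<close>

definition cutoff_layer :: "nat \<Rightarrow> 'a \<Rightarrow> 'a \<Rightarrow> real" where
  "cutoff_layer k v x = (\<Prod>w\<in>C - {v}. smooth_step k (bary w x)) * smooth_step' k (bary v x)"

lemma has_grad_bary: "has_grad (bary v) (\<lambda>x. G v)"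
  unfolding bary_def[abs_def] by (rule has_grad_inner)

lemma has_grad_cutoff: "has_grad (cutoff k) (\<lambda>x. \<Sum>v\<in>C. cutoff_layer k v x *\<^sub>R G v)"
  using has_grad_prod[OF finite_C has_grad_compose_real[OF has_grad_bary DERIV_smooth_step[of k] continuous_smooth_step']]
  unfolding cutoff_def[abs_def] cutoff_layer_def[abs_def] scaleR_scaleR .

lemma cutoff_range: "0 \<le> cutoff k x" "cutoff k x \<le> 1"
  unfolding cutoff_def by (intro prod_nonneg prod_le_1 ballI conjI smooth_step_range)+

lemma outside_bary_neg:
  assumes "x \<notin> convex hull C"
  obtains v where "v \<in> C" "bary v x < 0"
  using assms unfolding mem_face_iff[OF subset_refl] by force

lemma cutoff_outside: "x \<notin> convex hull C \<Longrightarrow> cutoff k x = 0"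
  unfolding cutoff_def
  by (erule outside_bary_neg) (use finite_C smooth_step_nonpos in \<open>auto intro!: prod_zero bexI simp: less_imp_le\<close>)

lemma cutoff_layer_outside:
  assumes "x \<notin> convex hull C"
  shows "cutoff_layer k v x = 0"
proof -
  obtain w where w: "w \<in> C" "bary w x < 0" using assms by (rule outside_bary_neg)
  show ?thesis
  proof (cases "w = v")
    case True
    then show ?thesis using w smooth_step'_nonpos[of "bary v x" k] by (simp add: cutoff_layer_def)
  next
    case False
    then have "(\<Prod>w\<in>C - {v}. smooth_step k (bary w x)) = 0"
      using w finite_C smooth_step_nonpos[of "bary w x" k] by (intro prod_zero) auto
    then show ?thesis by (simp add: cutoff_layer_def)
  qed
qed

lemma cutoff_layer_bound: "bary v x \<ge> 0 \<Longrightarrow> \<bar>cutoff_layer k v x\<bar> * bary v x \<le> bary v x * smooth_step' k (bary v x)"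
proof -
  assume b: "bary v x \<ge> 0"
  have p: "0 \<le> (\<Prod>w\<in>C - {v}. smooth_step k (bary w x))" "(\<Prod>w\<in>C - {v}. smooth_step k (bary w x)) \<le> 1"
    by (intro prod_nonneg prod_le_1 ballI conjI smooth_step_range)+
  have s: "smooth_step' k (bary v x) \<ge> 0" using b smooth_step_denom[of k "bary v x"] by (simp add: smooth_step'_def)
  have "\<bar>cutoff_layer k v x\<bar> * bary v x = (\<Prod>w\<in>C - {v}. smooth_step k (bary w x)) * (bary v x * smooth_step' k (bary v x))"
    using p s by (simp add: cutoff_layer_def abs_mult)
  also have "\<dots> \<le> 1 * (bary v x * smooth_step' k (bary v x))"
    using p smooth_step'_mult_range(1)[of "bary v x" k] by (intro mult_right_mono)
  finally show ?thesis by simp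
qed

lemma continuous_cutoff_layer: "continuous_on S (cutoff_layer k v)"
proof -
  have "continuous_on UNIV (smooth_step k)"
    using DERIV_smooth_step[of k] by (intro continuous_at_imp_continuous_on ballI) (rule DERIV_isCont)
  then have "continuous_on S (\<lambda>x. smooth_step k (bary w x))" for w
    by (rule continuous_on_compose2[OF _ bary_continuous subset_UNIV])
  moreover have "continuous_on S (\<lambda>x. smooth_step' k (bary v x))"
    by (rule continuous_on_compose2[OF continuous_smooth_step' bary_continuous subset_UNIV])
  ultimately show ?thesis unfolding cutoff_layer_def[abs_def] by (intro continuous_intros)
qed

lemma negligible_bary_zero: "v \<in> C \<Longrightarrow> negligible {x. bary v x = 0}"
proof -
  assume "v \<in> C"
  then have "negligible {x. G v \<bullet> x = - c v}" by (intro negligible_hyperplane) (simp add: G_nonzero)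
  moreover have "{x. bary v x = 0} = {x. G v \<bullet> x = - c v}" by (auto simp: bary_def)
  ultimately show ?thesis by simp
qed

lemma AE_bary_nonzero: "AE x in lborel. \<forall>v\<in>C. bary v x \<noteq> 0"
proof -
  have "AE x in lborel. bary v x \<noteq> 0" if "v \<in> C" for v
  proof -
    have "closed {x. bary v x = 0}"
      unfolding bary_def by (intro closed_Collect_eq continuous_intros)
    then have "{x. bary v x = 0} \<in> null_sets lborel"
      using negligible_bary_zero[OF that] by (simp add: negligible_iff_null_sets null_sets_completion_iff)
    from AE_not_in[OF this] show ?thesis by simp
  qed
  then show ?thesis using finite_C by (simp add: AE_finite_all)
qed

lemma cutoff_tendsto:
  assumes "\<forall>v\<in>C. bary v x > 0"
  shows "(\<lambda>k. cutoff k x) \<longlonglongrightarrow> 1"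
proof -
  have "(\<lambda>k. \<Prod>v\<in>C. smooth_step k (bary v x)) \<longlonglongrightarrow> (\<Prod>v\<in>C. 1)"
    by (intro tendsto_prod smooth_step_tendsto) (use assms in auto)
  then show ?thesis by (simp add: cutoff_def[abs_def])
qed

lemma integral_cutoff_tendsto:
  assumes "continuous_on UNIV f"
  shows "(\<lambda>k. LINT x|lborel. cutoff k x * f x) \<longlonglongrightarrow> (LINT x:convex hull C|lborel. f x)"
  unfolding set_lebesgue_integral_def
proof (rule integral_dominated_convergence)
  let ?T = "convex hull C"
  have comp: "compact ?T" by (rule compact_face[OF subset_refl])
  have "integrable lborel (\<lambda>x. indicator ?T x *\<^sub>R \<bar>f x\<bar>)"
    by (rule borel_integrable_compact[OF comp]) (intro continuous_intros continuous_on_subset[OF assms], simp)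
  then show "integrable lborel (\<lambda>x. indicator ?T x *\<^sub>R \<bar>f x\<bar>)" .
  show "(\<lambda>x. indicator ?T x *\<^sub>R f x) \<in> borel_measurable lborel"
    using borel_measurable_continuous_on_indicator[OF borel_compact[OF comp] continuous_on_subset[OF assms]] by simp
  show "(\<lambda>x. cutoff k x * f x) \<in> borel_measurable lborel" for k
  proof -
    have "continuous_on UNIV (\<lambda>x. cutoff k x * f x)"
      by (intro continuous_intros assms has_grad_continuous[OF has_grad_cutoff])
    then show ?thesis using borel_measurable_continuous_onI by simp
  qed
  show "AE x in lborel. (\<lambda>k. cutoff k x * f x) \<longlonglongrightarrow> indicator ?T x *\<^sub>R f x"
    using AE_bary_nonzero
  proof eventually_elim
    case (elim x)
    show ?case
    proof (cases "x \<in> ?T")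
      case True
      then have "\<forall>v\<in>C. bary v x > 0"
        using elim mem_face_iff[OF subset_refl, of x] by (auto simp: less_le)
      from tendsto_mult[OF cutoff_tendsto[OF this] tendsto_const[of "f x"]] True show ?thesis by simp
    next
      case False
      then show ?thesis by (simp add: cutoff_outside)
    qed
  qed
  show "AE x in lborel. norm (cutoff k x * f x) \<le> indicator ?T x *\<^sub>R \<bar>f x\<bar>" for k
  proof (rule AE_I2)
    fix x
    show "norm (cutoff k x * f x) \<le> indicator ?T x *\<^sub>R \<bar>f x\<bar>"
    proof (cases "x \<in> ?T")
      case True
      have "\<bar>cutoff k x\<bar> * \<bar>f x\<bar> \<le> 1 * \<bar>f x\<bar>"
        using cutoff_range[of k x] by (intro mult_right_mono) auto
      then show ?thesis using True by (simp add: abs_mult)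
    next
      case False
      then show ?thesis by (simp add: cutoff_outside)
    qed
  qed
qed

lemma integrable_cutoff_mult:
  assumes "continuous_on UNIV f"
  shows "integrable lborel (\<lambda>x. cutoff k x * f x)"
  by (rule continuous_bounded_support_integrable[where K="convex hull C"])
     (auto intro!: continuous_intros has_grad_continuous[OF has_grad_cutoff] assms compact_face simp: cutoff_outside)

lemma integrable_cutoff_layer_mult:
  assumes "continuous_on UNIV f"
  shows "integrable lborel (\<lambda>x. cutoff_layer k v x * f x)"
  by (rule continuous_bounded_support_integrable[where K="convex hull C"])
     (auto intro!: continuous_intros continuous_cutoff_layer assms compact_face simp: cutoff_layer_outside)

text \<open>The layers concentrate on the facet opposite \<open>v\<close>, with a mass that stays bounded when weighted
  by the distance to the facet.\<close>

lemma integral_cutoff_layer_tendsto_0: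
  assumes f: "continuous_on UNIV f" and L: "\<And>x. x \<in> convex hull C \<Longrightarrow> \<bar>f x\<bar> \<le> L * bary v x" and v: "v \<in> C"
  shows "(\<lambda>k. LINT x|lborel. cutoff_layer k v x * f x) \<longlonglongrightarrow> 0"
proof -
  let ?T = "convex hull C"
  have comp: "compact ?T" by (rule compact_face[OF subset_refl])
  have L0: "0 \<le> L" using L[OF hull_inc[OF v]] bary_vertex[OF v v] by simp
  \<comment> \<open>The factor \<open>bary v x\<close> turns the unbounded derivative into the
    bounded product \<open>t * smooth_step' k t\<close>, which also tends to 0 pointwise.\<close>
  have bound: "\<bar>cutoff_layer k v x * f x\<bar> \<le> L * (bary v x * smooth_step' k (bary v x))" if x: "x \<in> ?T" for k x
  proof -
    have b: "bary v x \<ge> 0" using x v mem_face_iff[OF subset_refl] by blast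
    have "\<bar>cutoff_layer k v x\<bar> * \<bar>f x\<bar> \<le> \<bar>cutoff_layer k v x\<bar> * (L * bary v x)"
      using L[OF x] by (intro mult_left_mono) auto
    also have "\<dots> = L * (\<bar>cutoff_layer k v x\<bar> * bary v x)" by simp
    also have "\<dots> \<le> L * (bary v x * smooth_step' k (bary v x))"
      by (rule mult_left_mono[OF cutoff_layer_bound[OF b] L0])
    finally show ?thesis by (simp add: abs_mult)
  qed
  have "(\<lambda>k. LINT x|lborel. cutoff_layer k v x * f x) \<longlonglongrightarrow> (LINT (x::'a)|lborel. 0)"
  proof (rule integral_dominated_convergence[where w="\<lambda>x. L * indicator ?T x"])
    show "integrable lborel (\<lambda>x. L * indicator ?T x)"
      using emeasure_compact_finite[OF comp] borel_compact[OF comp]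
      by (intro integrable_mult_right integrable_real_indicator) simp_all
    show "(\<lambda>x. cutoff_layer k v x * f x) \<in> borel_measurable lborel" for k
      using integrable_cutoff_layer_mult[OF f] by (rule borel_measurable_integrable)
    show "AE x in lborel. (\<lambda>k. cutoff_layer k v x * f x) \<longlonglongrightarrow> 0"
    proof (rule AE_I2)
      fix x
      show "(\<lambda>k. cutoff_layer k v x * f x) \<longlonglongrightarrow> 0"
      proof (cases "x \<in> ?T")
        case True
        show ?thesis
        proof (rule tendsto_0_le[where K=L])
          show "(\<lambda>k. bary v x * smooth_step' k (bary v x)) \<longlonglongrightarrow> 0" by (rule smooth_step'_mult_tendsto)
          show "\<forall>\<^sub>F k in sequentially. norm (cutoff_layer k v x * f x) \<le> norm (bary v x * smooth_step' k (bary v x)) * L"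
            using bound[OF True] smooth_step'_mult_range(1)[of "bary v x"]
            by (intro always_eventually allI) (simp add: mult.commute)
        qed
      next
        case False
        then show ?thesis by (simp add: cutoff_layer_outside)
      qed
    qed
    show "AE x in lborel. norm (cutoff_layer k v x * f x) \<le> L * indicator ?T x" for k
    proof (rule AE_I2)
      fix x
      show "norm (cutoff_layer k v x * f x) \<le> L * indicator ?T x"
      proof (cases "x \<in> ?T")
        case True
        have "L * (bary v x * smooth_step' k (bary v x)) \<le> L * 1"
          by (rule mult_left_mono[OF smooth_step'_mult_range(2) L0])
        then show ?thesis using bound[OF True, of k] True by simp
      next
        case False
        then show ?thesis by (simp add: cutoff_layer_outside)
      qed
    qed
  qed simp
  then show ?thesis by simp
qed

text \<open>A point is moved into the facet by passing its weight at \<open>v\<close> to another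
  vertex \<open>e\<close>. The distance is \<open>bary v x\<close> times an edge length, and the
  gradient is bounded on the simplex.\<close>

lemma has_grad_zero_on_facet_bound:
  assumes H: "has_grad H g" and v: "v \<in> C" and z: "\<And>x. x \<in> convex hull (C - {v}) \<Longrightarrow> H x = 0"
  obtains L where "\<And>x. x \<in> convex hull C \<Longrightarrow> \<bar>H x\<bar> \<le> L * bary v x"
proof -
  let ?T = "convex hull C"
  have comp: "compact ?T" by (rule compact_face[OF subset_refl])
  have "compact (g ` ?T)"
    by (rule compact_continuous_image[OF continuous_on_subset[OF has_grad_continuous_grad[OF H]] comp]) simp
  then have "\<exists>M. \<forall>y\<in>g ` ?T. norm y \<le> M"
    by (simp only: bounded_iff[symmetric] compact_imp_bounded)
  then obtain M where M: "\<And>x. x \<in> ?T \<Longrightarrow> norm (g x) \<le> M" by auto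
  have "card C \<ge> 2" using card_C DIM_positive[where 'a='a] by linarith
  then have "\<not> C \<subseteq> {v}" using card_mono[of "{v}" C] by auto
  then obtain e where e: "e \<in> C" "e \<noteq> v" by blast
  show thesis
  proof (rule that)
    fix x assume x: "x \<in> ?T"
    then have b: "bary w x \<ge> 0" if "w \<in> C" for w using that mem_face_iff[OF subset_refl] by blast
    define y where "y = x + bary v x *\<^sub>R (e - v)"
    have bary_y: "bary w y = bary w x + bary v x * (bary w e - bary w v)" for w
      by (simp add: y_def bary_def inner_add_right inner_diff_right)
    have "y \<in> convex hull (C - {v})"
      unfolding mem_face_iff[OF Diff_subset]
    proof (intro conjI ballI)
      fix w assume "w \<in> C - {v}"
      then have w: "w \<in> C" "w \<noteq> v" by auto
      then show "0 \<le> bary w y"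
        unfolding bary_y bary_vertex[OF w(1) e(1)] bary_vertex[OF w(1) v] using b[OF w(1)] b[OF v] by simp
    next
      fix w assume "w \<in> C - (C - {v})"
      then have w: "w = v" by auto
      show "bary w y = 0" unfolding w bary_y bary_vertex[OF v e(1)] bary_vertex[OF v v] using e(2) by simp
    qed
    note yF = this
    have yT: "y \<in> ?T" using yF hull_mono[of "C - {v}" C] by blast
    have "norm (H x - H y) \<le> M * norm (x - y)"
    proof (rule differentiable_bound[of ?T, OF convex_convex_hull])
      show "(H has_derivative (\<lambda>v. g z \<bullet> v)) (at z within ?T)" for z
        by (rule has_derivative_at_withinI[OF has_gradD[OF H]])
      show "onorm (\<lambda>v. g z \<bullet> v) \<le> M" if z: "z \<in> ?T" for z
      proof (rule onorm_le)
        fix w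
        have "\<bar>g z \<bullet> w\<bar> \<le> norm (g z) * norm w" by (rule Cauchy_Schwarz_ineq2)
        also have "\<dots> \<le> M * norm w" by (rule mult_right_mono[OF M[OF z]]) simp
        finally show "norm (g z \<bullet> w) \<le> M * norm w" by simp
      qed
    qed (rule x yT)+
    moreover have "norm (x - y) = bary v x * norm (e - v)"
      using b[OF v] by (simp add: y_def)
    ultimately show "\<bar>H x\<bar> \<le> (M * norm (e - v)) * bary v x"
      unfolding z[OF yF] by (simp only: diff_zero real_norm_def mult_ac)
  qed
qed

end

section \<open>Affine changes of variables\<close>

text \<open>Change of variables with a constant Jacobian factor \<kappa>. Stated for nonnegative
  integrands it needs no integrability, and the factors multiply under composition.\<close>

definition scales_lborel :: "('a::euclidean_space \<Rightarrow> 'a) \<Rightarrow> real \<Rightarrow> bool" where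
  "scales_lborel S \<kappa> \<longleftrightarrow> S \<in> borel_measurable borel \<and> \<kappa> \<ge> 0 \<and>
    (\<forall>f\<in>borel_measurable borel. (\<integral>\<^sup>+x. f x \<partial>lborel) = ennreal \<kappa> * (\<integral>\<^sup>+x. f (S x) \<partial>lborel))"

lemma scales_lborelD:
  assumes "scales_lborel S \<kappa>"
  shows "S \<in> borel_measurable borel" "\<kappa> \<ge> 0"
    "f \<in> borel_measurable borel \<Longrightarrow> (\<integral>\<^sup>+x. f x \<partial>lborel) = ennreal \<kappa> * (\<integral>\<^sup>+x. f (S x) \<partial>lborel)"
  using assms unfolding scales_lborel_def by blast+

lemma scales_lborel_id: "scales_lborel (\<lambda>x. x) 1"
  by (simp add: scales_lborel_def)

lemma scales_lborel_compose:
  assumes "scales_lborel S \<kappa>" "scales_lborel S' \<kappa>'"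
  shows "scales_lborel (\<lambda>x. S (S' x)) (\<kappa> * \<kappa>')"
  unfolding scales_lborel_def
proof (intro conjI ballI)
  note S = scales_lborelD[OF assms(1)] and S' = scales_lborelD[OF assms(2)]
  note [measurable] = S(1) S'(1)
  show "(\<lambda>x. S (S' x)) \<in> borel_measurable borel" by measurable
  show "\<kappa> * \<kappa>' \<ge> 0" using S(2) S'(2) by simp
  fix f :: "'a \<Rightarrow> ennreal" assume [measurable]: "f \<in> borel_measurable borel"
  have m: "(\<lambda>x. f (S x)) \<in> borel_measurable borel" by measurable
  have "(\<integral>\<^sup>+x. f x \<partial>lborel) = ennreal \<kappa> * (\<integral>\<^sup>+x. f (S x) \<partial>lborel)"
    by (rule S(3)) measurable
  also have "(\<integral>\<^sup>+x. f (S x) \<partial>lborel) = ennreal \<kappa>' * (\<integral>\<^sup>+x. f (S (S' x)) \<partial>lborel)"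
    by (rule S'(3)[OF m])
  finally show "(\<integral>\<^sup>+x. f x \<partial>lborel) = ennreal (\<kappa> * \<kappa>') * (\<integral>\<^sup>+x. f (S (S' x)) \<partial>lborel)"
    using S(2) S'(2) by (simp add: ennreal_mult mult.assoc)
qed

text \<open>Indicators in the defining identity exhibit \<open>lborel\<close> as \<kappa> times its
  image under \<open>S\<close>, which yields the formula for real integrands.\<close>

lemma scales_lborel_integral:
  fixes f :: "'a::euclidean_space \<Rightarrow> real"
  assumes S: "scales_lborel S \<kappa>" and f: "f \<in> borel_measurable borel"
  shows "(LINT x|lborel. f x) = \<kappa> * (LINT x|lborel. f (S x))"
proof -
  note S' = scales_lborelD[OF S]
  have m: "S \<in> measurable lborel borel" using S'(1) by simp
  have "lborel = density (distr lborel borel S) (\<lambda>_. ennreal \<kappa>)"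
  proof (rule measure_eqI)
    fix A :: "'a set" assume A: "A \<in> sets lborel"
    then have [measurable]: "A \<in> sets borel" by simp
    have "emeasure lborel A = (\<integral>\<^sup>+x. indicator A x \<partial>lborel)" using A by (rule nn_integral_indicator[symmetric])
    also have "\<dots> = ennreal \<kappa> * (\<integral>\<^sup>+x. indicator A (S x) \<partial>lborel)"
      by (rule S'(3)) measurable
    also have "(\<integral>\<^sup>+x. indicator A (S x) \<partial>lborel) = (\<integral>\<^sup>+x. indicator A x \<partial>distr lborel borel S)"
      by (rule nn_integral_distr[OF m, symmetric]) simp
    also have "ennreal \<kappa> * \<dots> = emeasure (density (distr lborel borel S) (\<lambda>_. ennreal \<kappa>)) A"
      by (subst emeasure_density) (simp_all add: nn_integral_cmult)
    finally show "emeasure lborel A = emeasure (density (distr lborel borel S) (\<lambda>_. ennreal \<kappa>)) A" .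
  qed simp
  then have "(LINT x|lborel. f x) = (LINT x|density (distr lborel borel S) (\<lambda>_. ennreal \<kappa>). f x)" by simp
  also have "\<dots> = (LINT x|distr lborel borel S. \<kappa> *\<^sub>R f x)"
    by (rule integral_density) (use f S'(1,2) in auto)
  also have "\<dots> = (LINT x|lborel. \<kappa> *\<^sub>R f (S x))"
    by (rule integral_distr[OF m]) (use f in auto)
  finally show ?thesis by simp
qed

text \<open>By Fubini: with the other coordinates fixed, the map is affine in the coordinate along
  \<open>b\<close>, with slope \<open>1 + a \<bullet> b\<close>.\<close>

lemma scales_lborel_coordinate:
  fixes b :: "'a::euclidean_space"
  assumes b: "b \<in> Basis" and nz: "1 + a \<bullet> b \<noteq> 0"
  shows "scales_lborel (\<lambda>x. x + (a \<bullet> x + c) *\<^sub>R b) \<bar>1 + a \<bullet> b\<bar>"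
  unfolding scales_lborel_def
proof (intro conjI ballI)
  have "continuous_on UNIV (\<lambda>x. x + (a \<bullet> x + c) *\<^sub>R b)" by (intro continuous_intros)
  then show Sm: "(\<lambda>x. x + (a \<bullet> x + c) *\<^sub>R b) \<in> borel_measurable borel"
    by (rule borel_measurable_continuous_onI)
  fix f :: "'a \<Rightarrow> ennreal" assume f[measurable]: "f \<in> borel_measurable borel"
  define I where "I = Basis - {b}"
  have I: "Basis = insert b I" "finite I" "b \<notin> I" using b by (auto simp: I_def)
  define X where "X t = (\<Sum>i\<in>I. t i *\<^sub>R i)" for t :: "'a \<Rightarrow> real"
  have Xm[measurable]: "X \<in> borel_measurable (Pi\<^sub>M I (\<lambda>_. lborel))" unfolding X_def[abs_def] by measurable
  have split: "(\<Sum>i\<in>Basis. (t(b := y)) i *\<^sub>R i) = X t + y *\<^sub>R b" for t y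
  proof -
    have "(\<Sum>i\<in>I. (t(b := y)) i *\<^sub>R i) = X t" unfolding X_def
      by (rule sum.cong) (use I in auto)
    then show ?thesis
      by (subst I(1), subst sum.insert[OF I(2,3)]) (simp add: add.commute)
  qed
  have Fub: "(\<integral>\<^sup>+x. h x \<partial>lborel) = (\<integral>\<^sup>+t. (\<integral>\<^sup>+y. h (X t + y *\<^sub>R b) \<partial>lborel) \<partial>Pi\<^sub>M I (\<lambda>_. lborel))"
    if h: "h \<in> borel_measurable borel" for h :: "'a \<Rightarrow> ennreal"
  proof -
    have m: "(\<lambda>t. \<Sum>i\<in>Basis. t i *\<^sub>R i) \<in> measurable (Pi\<^sub>M Basis (\<lambda>_. lborel)) (borel :: 'a measure)" by measurable
    have "(\<integral>\<^sup>+x. h x \<partial>lborel) = (\<integral>\<^sup>+t. h (\<Sum>i\<in>Basis. t i *\<^sub>R i) \<partial>Pi\<^sub>M Basis (\<lambda>_. lborel))"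
      by (subst lborel_eq, rule nn_integral_distr) (use m h in simp_all)
    also have "\<dots> = (\<integral>\<^sup>+t. h (\<Sum>i\<in>Basis. t i *\<^sub>R i) \<partial>Pi\<^sub>M (insert b I) (\<lambda>_. lborel))"
      by (simp only: I(1)[symmetric])
    also have "\<dots> = (\<integral>\<^sup>+t. (\<integral>\<^sup>+y. h (\<Sum>i\<in>Basis. (t(b := y)) i *\<^sub>R i) \<partial>lborel) \<partial>Pi\<^sub>M I (\<lambda>_. lborel))"
      by (rule lborel_product.product_nn_integral_insert[OF I(2,3)])
         (use measurable_comp[OF m h] in \<open>simp add: I(1)[symmetric] o_def\<close>)
    finally show ?thesis unfolding split .
  qed
  let ?S = "\<lambda>x. x + (a \<bullet> x + c) *\<^sub>R b" and ?k = "\<bar>1 + a \<bullet> b\<bar>"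
  have inner: "(\<integral>\<^sup>+y. f (X t + y *\<^sub>R b) \<partial>lborel) = ennreal ?k * (\<integral>\<^sup>+y. f (?S (X t + y *\<^sub>R b)) \<partial>lborel)" for t
  proof -
    have m: "(\<lambda>y. f (X t + y *\<^sub>R b)) \<in> borel_measurable borel" by measurable
    have eq: "X t + ((a \<bullet> X t + c) + (1 + a \<bullet> b) * y) *\<^sub>R b = ?S (X t + y *\<^sub>R b)" for y
      by (simp add: inner_add_right algebra_simps)
    show ?thesis
      using nn_integral_real_affine[OF m nz, of "a \<bullet> X t + c"] unfolding eq .
  qed
  have fS: "(\<lambda>x. f (?S x)) \<in> borel_measurable borel" using measurable_comp[OF Sm f] by (simp add: o_def)
  have "(\<lambda>t. \<integral>\<^sup>+y. f (?S (X t + y *\<^sub>R b)) \<partial>lborel) \<in> borel_measurable (Pi\<^sub>M I (\<lambda>_. lborel))"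
  proof (rule lborel.borel_measurable_nn_integral)
    have "(\<lambda>(t, y). X t + y *\<^sub>R b) \<in> measurable (Pi\<^sub>M I (\<lambda>_. lborel) \<Otimes>\<^sub>M lborel) borel" by measurable
    from measurable_comp[OF this fS] show "(\<lambda>(t, y). f (?S (X t + y *\<^sub>R b))) \<in> borel_measurable (Pi\<^sub>M I (\<lambda>_. lborel) \<Otimes>\<^sub>M lborel)"
      by (simp add: o_def case_prod_unfold)
  qed
  from nn_integral_cmult[OF this, of "ennreal ?k"]
  show "(\<integral>\<^sup>+x. f x \<partial>lborel) = ennreal ?k * (\<integral>\<^sup>+x. f (?S x) \<partial>lborel)"
    unfolding Fub[OF f] Fub[OF fS] inner .
qed simp

text \<open>The affine map that fixes the zero set of the form \<open>l\<close> pointwise and sends \<open>v\<close> to \<open>w\<close> is a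
  composition of maps changing one coordinate each, obtained by moving \<open>w\<close> along the axes. On the way
  the zero set of \<open>l\<close> must be avoided.\<close>

lemma scales_lborel_rank_one:
  fixes a v w :: "'a::euclidean_space" and c :: real
  defines "l \<equiv> \<lambda>x. a \<bullet> x + c"
  assumes v: "l v = 1" and w: "l w \<noteq> 0" and a: "a \<noteq> 0"
  shows "scales_lborel (\<lambda>x. x + l x *\<^sub>R (w - v)) \<bar>l w\<bar>"
proof -
  define Q where "Q p \<longleftrightarrow> scales_lborel (\<lambda>x. x + l x *\<^sub>R (p - v)) \<bar>l p\<bar>" for p
  have ladd: "l (x + s *\<^sub>R y) = l x + s * (a \<bullet> y)" for x s y by (simp add: l_def inner_add_right)
  have Qv: "Q v" using scales_lborel_id by (simp add: Q_def v)
  have step: "Q (p + s *\<^sub>R b)" if Q: "Q p" and p: "l p \<noteq> 0" "l (p + s *\<^sub>R b) \<noteq> 0" and b: "b \<in> Basis" for p s b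
  proof -
    \<comment> \<open>The map belonging to \<open>p\<close> multiplies the form \<open>l\<close> by
      \<open>l p\<close>. The factor \<open>s / l p\<close> undoes this, so the coordinate map adds
      exactly \<open>s * l x\<close> in the direction \<open>b\<close>.\<close>
    let ?a = "(s / l p) *\<^sub>R a" and ?c = "(s / l p) * c"
    have k: "1 + ?a \<bullet> b = l (p + s *\<^sub>R b) / l p" using p(1) by (simp add: ladd field_simps)
    then have "1 + ?a \<bullet> b \<noteq> 0" using p by simp
    from scales_lborel_compose[OF scales_lborel_coordinate[OF b this, of ?c] Q[unfolded Q_def]]
    have "scales_lborel (\<lambda>x. (x + l x *\<^sub>R (p - v)) + (?a \<bullet> (x + l x *\<^sub>R (p - v)) + ?c) *\<^sub>R b) (\<bar>1 + ?a \<bullet> b\<bar> * \<bar>l p\<bar>)" .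
    moreover have "\<bar>1 + ?a \<bullet> b\<bar> * \<bar>l p\<bar> = \<bar>l (p + s *\<^sub>R b)\<bar>" using p(1) unfolding k by simp
    moreover have "(x + l x *\<^sub>R (p - v)) + (?a \<bullet> (x + l x *\<^sub>R (p - v)) + ?c) *\<^sub>R b = x + l x *\<^sub>R ((p + s *\<^sub>R b) - v)" for x
    proof -
      have pv: "a \<bullet> (p - v) = l p - 1" using v by (simp add: l_def inner_diff_right)
      have "l (x + l x *\<^sub>R (p - v)) = l x * l p" unfolding ladd pv by (simp add: right_diff_distrib)
      moreover have "?a \<bullet> z + ?c = (s / l p) * l z" for z
        unfolding inner_scaleR_left distrib_left[symmetric] by (simp add: l_def)
      ultimately have "?a \<bullet> (x + l x *\<^sub>R (p - v)) + ?c = (s / l p) * (l x * l p)" by simp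
      also have "\<dots> = s * l x" using p(1) by simp
      finally show ?thesis by (simp add: algebra_simps)
    qed
    ultimately show ?thesis unfolding Q_def by (simp only:)
  qed
  \<comment> \<open>The form varies along \<open>b0\<close>, so shifts in this direction can leave
    its zero set. This coordinate stays free throughout the induction; \<open>B\<close> collects the
    other coordinates in which \<open>p\<close> may differ from \<open>v\<close>.\<close>
  obtain b0 where b0: "b0 \<in> Basis" "a \<bullet> b0 \<noteq> 0" using a euclidean_all_zero_iff by blast
  have "\<forall>p. (\<forall>b\<in>Basis - {b0} - B. p \<bullet> b = v \<bullet> b) \<longrightarrow> l p \<noteq> 0 \<longrightarrow> Q p" if "finite B" "B \<subseteq> Basis - {b0}" for B
    using that
  proof (induction B rule: finite_induct)
    case empty
    show ?case
    proof (intro allI impI)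
      fix p assume p: "\<forall>b\<in>Basis - {b0} - {}. p \<bullet> b = v \<bullet> b" "l p \<noteq> 0"
      have "p = v + ((p - v) \<bullet> b0) *\<^sub>R b0"
      proof (rule euclidean_eqI)
        fix b :: 'a assume "b \<in> Basis"
        then show "p \<bullet> b = (v + ((p - v) \<bullet> b0) *\<^sub>R b0) \<bullet> b"
          using p(1) b0(1) by (cases "b = b0") (auto simp: inner_add_left inner_Basis algebra_simps)
      qed
      then show "Q p" using step[OF Qv _ _ b0(1), of "(p - v) \<bullet> b0"] p(2) v by simp
    qed
  next
    case (insert b B)
    have bB: "b \<in> Basis" "b \<noteq> b0" using insert.prems by auto
    have IH: "Q p" if "\<forall>i\<in>Basis - {b0} - B. p \<bullet> i = v \<bullet> i" "l p \<noteq> 0" for p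
      using insert.IH insert.prems that by simp
    show ?case
    proof (intro allI impI)
      fix p assume p: "\<forall>i\<in>Basis - {b0} - insert b B. p \<bullet> i = v \<bullet> i" "l p \<noteq> 0"
      define s where "s = (p - v) \<bullet> b"
      define p0 where "p0 = p - s *\<^sub>R b"
      have p0: "(p0 + t *\<^sub>R b0) \<bullet> i = v \<bullet> i" if "i \<in> Basis - {b0} - B" for i t
        using that p(1) bB b0(1)
        by (cases "i = b") (auto simp: p0_def s_def inner_add_left inner_diff_left inner_Basis)
      have pp: "p0 + s *\<^sub>R b = p" by (simp add: p0_def)
      show "Q p"
      proof (cases "l p0 = 0")
        case False
        have "Q p0" by (rule IH) (use p0[of _ 0] False in auto)
        from step[OF this False _ bB(1), of s] show ?thesis using p(2) pp by simp
      next
        case True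
        \<comment> \<open>Detour around the zero set: a shift along \<open>b0\<close> raises
          \<open>l\<close> by \<open>l p\<close>, so the path has the values \<open>l p\<close>,
          then \<open>2 * l p\<close> and, after shifting back, \<open>l p\<close>.\<close>
        define t where "t = l p / (a \<bullet> b0)"
        have t: "t * (a \<bullet> b0) = l p" using b0 by (simp add: t_def)
        have l1: "l (p0 + t *\<^sub>R b0) = l p" using True by (simp add: ladd t)
        have l2: "l (p + t *\<^sub>R b0) = 2 * l p" by (simp add: ladd t)
        have q1: "Q (p0 + t *\<^sub>R b0)" by (rule IH) (use p0 l1 p(2) in auto)
        have e: "(p0 + t *\<^sub>R b0) + s *\<^sub>R b = p + t *\<^sub>R b0" by (simp add: p0_def)
        have "Q ((p0 + t *\<^sub>R b0) + s *\<^sub>R b)"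
          by (rule step[OF q1 _ _ bB(1)]) (unfold e, use l1 l2 p(2) in simp_all)
        then have "Q (p + t *\<^sub>R b0)" unfolding e .
        from step[OF this _ _ b0(1), of "- t"] show ?thesis using l2 p(2) by simp
      qed
    qed
  qed
  from this[of "Basis - {b0}"] have "Q w" using w by simp
  then show ?thesis by (simp add: Q_def)
qed

context affine_coords
begin

text \<open>The affine map that sends the vertex \<open>v\<close> to \<open>v'\<close> and fixes the
  other vertices, hence the hyperplane of the facet opposite \<open>v\<close>.\<close>

definition vertex_move :: "'a \<Rightarrow> 'a \<Rightarrow> 'a \<Rightarrow> 'a" where
  "vertex_move v v' x = x + bary v x *\<^sub>R (v' - v)"

lemma vertex_move_scales:
  assumes "v \<in> C" "bary v v' \<noteq> 0"
  shows "scales_lborel (vertex_move v v') \<bar>bary v v'\<bar>"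
  using scales_lborel_rank_one[where a="G v" and c="c v" and v=v and w=v'] assms bary_vertex[of v v] G_nonzero[of v]
  by (simp add: vertex_move_def[abs_def] bary_def)

lemma has_grad_vertex_move:
  assumes "has_grad h g"
  shows "\<exists>g'. has_grad (\<lambda>x. h (vertex_move v v' x)) g'"
  using has_grad_compose_rank_one[OF assms, of "G v" "c v" "v' - v"]
  by (auto simp: vertex_move_def[abs_def] bary_def)

end

text \<open>An affine function that vanishes on \<open>D\<close> is a multiple of the coordinate of
  \<open>v'\<close>, with the factor read off at \<open>v'\<close>. The move keeps the weights on
  \<open>D\<close> and passes the weight of \<open>v\<close> to \<open>v'\<close>, so it identifies
  the coordinates of the two simplices and thereby their cutoff layers.\<close>

lemma opposite_coords:
  assumes co: "affine_coords (insert v D) G c" and co': "affine_coords (insert v' D) G' c'"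
    and v: "v \<notin> D" and v': "v' \<notin> D"
  shows "affine_coords.bary G c v x = affine_coords.bary G c v v' * affine_coords.bary G' c' v' x"
    and "G v = affine_coords.bary G c v v' *\<^sub>R G' v'"
    and "w \<in> D \<Longrightarrow> affine_coords.bary G' c' w (affine_coords.vertex_move G c v v' x) = affine_coords.bary G c w x"
    and "affine_coords.bary G' c' v' (affine_coords.vertex_move G c v v' x) = affine_coords.bary G c v x"
proof -
  interpret A: affine_coords "insert v D" G c by fact
  interpret B: affine_coords "insert v' D" G' c' by fact
  have fin: "finite D" using A.finite_C by simp
  have 1: "A.bary v x = A.bary v v' * B.bary v' x" for x
  proof -
    have "A.bary v x = A.bary v (\<Sum>w\<in>insert v' D. B.bary w x *\<^sub>R w)" by (simp only: B.bary_repr)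
    also have "\<dots> = (\<Sum>w\<in>insert v' D. B.bary w x * A.bary v w)"
      by (rule A.bary_affine_comb[OF B.bary_sum])
    also have "\<dots> = B.bary v' x * A.bary v v' + (\<Sum>w\<in>D. B.bary w x * A.bary v w)"
      using fin v' by simp
    also have "(\<Sum>w\<in>D. B.bary w x * A.bary v w) = 0"
    proof (rule sum.neutral, rule ballI)
      fix w assume "w \<in> D"
      then have "A.bary v w = 0" using A.bary_vertex[of v w] v by auto
      then show "B.bary w x * A.bary v w = 0" by simp
    qed
    finally show ?thesis by simp
  qed
  then show "A.bary v x = A.bary v v' * B.bary v' x" .
  show "G v = A.bary v v' *\<^sub>R G' v'"
  proof (rule vector_eq_rdot[THEN iffD1], rule allI)
    fix y
    have "A.bary v y - A.bary v 0 = A.bary v v' * (B.bary v' y - B.bary v' 0)"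
      unfolding right_diff_distrib 1[symmetric] ..
    moreover have "A.bary v y - A.bary v 0 = G v \<bullet> y" by (simp add: A.bary_def)
    moreover have "B.bary v' y - B.bary v' 0 = G' v' \<bullet> y" by (simp add: B.bary_def)
    ultimately show "G v \<bullet> y = (A.bary v v' *\<^sub>R G' v') \<bullet> y" by simp
  qed
  \<comment> \<open>The weights of \<open>x\<close> with \<open>v\<close> renamed to
    \<open>v'\<close>; by uniqueness they are the coordinates of the image point in the second
    simplex.\<close>
  define u where "u w = (if w = v' then A.bary v x else A.bary w x)" for w
  have uD: "(\<Sum>w\<in>D. F w (u w)) = (\<Sum>w\<in>D. F w (A.bary w x))" for F :: "'a \<Rightarrow> real \<Rightarrow> 'z::comm_monoid_add"
    by (rule sum.cong) (use v' in \<open>auto simp: u_def\<close>)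
  have s1: "sum u (insert v' D) = 1"
    using A.bary_sum[of x] uD[of "\<lambda>w y. y"] fin v v' by (simp add: u_def)
  have s2: "(\<Sum>w\<in>insert v' D. u w *\<^sub>R w) = A.vertex_move v v' x"
  proof -
    have "(\<Sum>w\<in>insert v' D. u w *\<^sub>R w) = A.bary v x *\<^sub>R v' + (\<Sum>w\<in>D. A.bary w x *\<^sub>R w)"
      using uD[of "\<lambda>w y. y *\<^sub>R w"] fin v' by (simp add: u_def)
    moreover have "x = A.bary v x *\<^sub>R v + (\<Sum>w\<in>D. A.bary w x *\<^sub>R w)"
      using A.bary_repr[of x] fin v by simp
    ultimately show ?thesis unfolding A.vertex_move_def by (simp add: algebra_simps)
  qed
  have 3: "B.bary w (A.vertex_move v v' x) = u w" if "w \<in> insert v' D" for w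
    using B.bary_affine_comb_vertex[OF s1 that] unfolding s2 .
  show "B.bary w (A.vertex_move v v' x) = A.bary w x" if "w \<in> D"
    using 3[of w] that v' by (auto simp: u_def)
  show "B.bary v' (A.vertex_move v v' x) = A.bary v x"
    using 3[of v'] by (simp add: u_def)
qed

section \<open>Fluxes through facets\<close>

text \<open>The number \<open>bary v v'\<close> relates the two gradients and its absolute value is
  the Jacobian. It is negative since \<open>v\<close> and \<open>v'\<close> lie on opposite sides,
  and the cancellation leaves the minus sign.\<close>

lemma flux_transfer:
  fixes V :: "'a::euclidean_space \<Rightarrow> 'a"
  assumes co: "affine_coords (insert v D) G c" and co': "affine_coords (insert v' D) G' c'"
    and v: "v \<notin> D" and v': "v' \<notin> D" and opp: "affine_coords.bary G c v v' < 0"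
    and V: "continuous_on UNIV V"
  shows "(LINT x|lborel. affine_coords.cutoff_layer (insert v' D) G' c' k v' x * (V x \<bullet> G' v')) =
    - (LINT x|lborel. affine_coords.cutoff_layer (insert v D) G c k v x *
         (V (affine_coords.vertex_move G c v v' x) \<bullet> G v))"
proof -
  interpret A: affine_coords "insert v D" G c by fact
  interpret B: affine_coords "insert v' D" G' c' by fact
  let ?S = "A.vertex_move v v'" and ?\<beta> = "A.bary v v'"
  have D: "insert v D - {v} = D" "insert v' D - {v'} = D" using v v' by auto
  have "continuous_on UNIV (\<lambda>x. B.cutoff_layer k v' x * (V x \<bullet> G' v'))"
    by (intro continuous_intros B.continuous_cutoff_layer V)
  then have m: "(\<lambda>x. B.cutoff_layer k v' x * (V x \<bullet> G' v')) \<in> borel_measurable borel"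
    by (rule borel_measurable_continuous_onI)
  have "scales_lborel ?S \<bar>?\<beta>\<bar>" by (rule A.vertex_move_scales) (use opp in auto)
  from scales_lborel_integral[OF this m]
  have "(LINT x|lborel. B.cutoff_layer k v' x * (V x \<bullet> G' v')) =
    - ?\<beta> * (LINT x|lborel. B.cutoff_layer k v' (?S x) * (V (?S x) \<bullet> G' v'))" using opp by simp
  also have "\<dots> = (LINT x|lborel. - ?\<beta> * (B.cutoff_layer k v' (?S x) * (V (?S x) \<bullet> G' v')))"
    by simp
  also have "\<dots> = (LINT x|lborel. - (A.cutoff_layer k v x * (V (?S x) \<bullet> G v)))"
  proof (rule Bochner_Integration.integral_cong[OF refl])
    fix x
    have "B.cutoff_layer k v' (?S x) = A.cutoff_layer k v x"
      unfolding A.cutoff_layer_def B.cutoff_layer_def D opposite_coords(4)[OF co co' v v']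
      using opposite_coords(3)[OF co co' v v', of _ x] by simp
    then show "- ?\<beta> * (B.cutoff_layer k v' (?S x) * (V (?S x) \<bullet> G' v')) = - (A.cutoff_layer k v x * (V (?S x) \<bullet> G v))"
      unfolding opposite_coords(2)[OF co co' v v'] by simp
  qed
  finally show ?thesis by simp
qed

text \<open>Since \<open>g b\<close> is the gradient of the component along \<open>b\<close>, the
  divergence is the sum of \<open>g b x \<bullet> b\<close> over \<open>Basis\<close>.\<close>

definition smooth_field :: "('a::euclidean_space \<Rightarrow> 'a) \<Rightarrow> ('a \<Rightarrow> 'a \<Rightarrow> 'a) \<Rightarrow> bool" where
  "smooth_field V g \<longleftrightarrow> (\<forall>b\<in>Basis. has_grad (\<lambda>x. V x \<bullet> b) (g b))"

lemma smooth_field_inner: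
  assumes "smooth_field V g"
  shows "has_grad (\<lambda>x. V x \<bullet> u) (\<lambda>x. \<Sum>b\<in>Basis. (u \<bullet> b) *\<^sub>R g b x)"
proof -
  have "has_grad (\<lambda>x. \<Sum>b\<in>Basis. (u \<bullet> b) * (V x \<bullet> b)) (\<lambda>x. \<Sum>b\<in>Basis. (u \<bullet> b) *\<^sub>R g b x)"
    by (intro has_grad_sum has_grad_cmult) (use assms in \<open>simp add: smooth_field_def\<close>)
  moreover have "(\<Sum>b\<in>Basis. (u \<bullet> b) * (V x \<bullet> b)) = V x \<bullet> u" for x
    by (subst euclidean_inner[of "V x" u]) (simp add: mult.commute)
  ultimately show ?thesis by simp
qed

lemma smooth_field_continuous:
  assumes "smooth_field V g"
  shows "continuous_on UNIV V"
proof (rule continuous_on_componentwise[THEN iffD2], rule ballI)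
  fix b :: 'a assume "b \<in> Basis"
  then have "has_grad (\<lambda>x. V x \<bullet> b) (g b)" using assms by (simp add: smooth_field_def)
  then show "continuous_on UNIV (\<lambda>x. V x \<bullet> b)" by (rule has_grad_continuous)
qed

lemma flux_pair_tendsto_0:
  fixes V V' :: "'a::euclidean_space \<Rightarrow> 'a"
  assumes co: "affine_coords (insert v D) G c" and co': "affine_coords (insert v' D) G' c'"
    and v: "v \<notin> D" and v': "v' \<notin> D" and opp: "affine_coords.bary G c v v' < 0"
    and V: "smooth_field V g" "smooth_field V' g'"
    and eq: "\<And>x. x \<in> convex hull D \<Longrightarrow> V x \<bullet> G v = V' x \<bullet> G v"
  shows "(\<lambda>k. (LINT x|lborel. affine_coords.cutoff_layer (insert v D) G c k v x * (V x \<bullet> G v)) +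
    (LINT x|lborel. affine_coords.cutoff_layer (insert v' D) G' c' k v' x * (V' x \<bullet> G' v'))) \<longlonglongrightarrow> 0"
proof -
  interpret A: affine_coords "insert v D" G c by fact
  let ?S = "A.vertex_move v v'"
  \<comment> \<open>The second field is pulled back to the first simplex. The move fixes the common
    facet, where the normal components agree, so \<open>H\<close> vanishes there and its layer
    integrals tend to 0.\<close>
  define H where "H x = V x \<bullet> G v + (-1) * (V' (?S x) \<bullet> G v)" for x
  obtain h' where h': "has_grad (\<lambda>x. V' (?S x) \<bullet> G v) h'"
    using A.has_grad_vertex_move[OF smooth_field_inner[OF V(2), of "G v"], of v v'] by (elim exE)
  have h: "has_grad H (\<lambda>x. (\<Sum>b\<in>Basis. (G v \<bullet> b) *\<^sub>R g b x) + (-1) *\<^sub>R h' x)"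
    unfolding H_def[abs_def] by (intro has_grad_add smooth_field_inner V(1) has_grad_cmult h')
  have D: "insert v D - {v} = D" using v by auto
  have zero: "H x = 0" if x: "x \<in> convex hull (insert v D - {v})" for x
  proof -
    have "A.bary v x = 0" using x A.mem_face_iff[of D x] D v by auto
    then show ?thesis using eq[of x] x D by (simp add: H_def A.vertex_move_def)
  qed
  obtain L where L: "\<And>x. x \<in> convex hull (insert v D) \<Longrightarrow> \<bar>H x\<bar> \<le> L * A.bary v x"
    by (rule A.has_grad_zero_on_facet_bound[OF h _ zero]) auto
  have "(\<lambda>k. LINT x|lborel. A.cutoff_layer k v x * H x) \<longlonglongrightarrow> 0"
    by (rule A.integral_cutoff_layer_tendsto_0[OF has_grad_continuous[OF h] L]) simp_all
  moreover have "(LINT x|lborel. A.cutoff_layer k v x * H x) =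
    (LINT x|lborel. A.cutoff_layer k v x * (V x \<bullet> G v)) +
    (LINT x|lborel. affine_coords.cutoff_layer (insert v' D) G' c' k v' x * (V' x \<bullet> G' v'))" for k
  proof -
    have i1: "integrable lborel (\<lambda>x. A.cutoff_layer k v x * (V x \<bullet> G v))"
      by (rule A.integrable_cutoff_layer_mult[OF has_grad_continuous[OF smooth_field_inner[OF V(1)]]])
    have i2: "integrable lborel (\<lambda>x. A.cutoff_layer k v x * (V' (?S x) \<bullet> G v))"
      by (rule A.integrable_cutoff_layer_mult[OF has_grad_continuous[OF h']])
    have "(LINT x|lborel. A.cutoff_layer k v x * H x) =
      (LINT x|lborel. A.cutoff_layer k v x * (V x \<bullet> G v) - A.cutoff_layer k v x * (V' (?S x) \<bullet> G v))"
      by (simp add: H_def right_diff_distrib)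
    also have "\<dots> = (LINT x|lborel. A.cutoff_layer k v x * (V x \<bullet> G v)) -
      (LINT x|lborel. A.cutoff_layer k v x * (V' (?S x) \<bullet> G v))"
      by (rule Bochner_Integration.integral_diff[OF i1 i2])
    finally show ?thesis
      unfolding flux_transfer[OF co co' v v' opp smooth_field_continuous[OF V(2)]] by simp
  qed
  ultimately show ?thesis by simp
qed

lemma (in affine_coords) flux_boundary_tendsto_0:
  assumes v: "v \<in> C" and V: "smooth_field V g" and z: "\<And>x. x \<in> convex hull (C - {v}) \<Longrightarrow> V x \<bullet> G v = 0"
  shows "(\<lambda>k. LINT x|lborel. cutoff_layer k v x * (V x \<bullet> G v)) \<longlonglongrightarrow> 0"
proof -
  note h = smooth_field_inner[OF V, of "G v"]
  obtain L where L: "\<And>x. x \<in> convex hull C \<Longrightarrow> \<bar>V x \<bullet> G v\<bar> \<le> L * bary v x"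
    by (rule has_grad_zero_on_facet_bound[OF h v z]) auto
  show ?thesis by (rule integral_cutoff_layer_tendsto_0[OF has_grad_continuous[OF h] L v])
qed

text \<open>The cutoff times the field has compact support, so its divergence integrates to zero for
  each \<open>k\<close>; the product rule separates the layers from the divergence of the
  field.\<close>

lemma (in affine_coords) simplex_divergence:
  assumes V: "smooth_field V g"
  shows "(\<lambda>k. \<Sum>v\<in>C. LINT x|lborel. cutoff_layer k v x * (V x \<bullet> G v)) \<longlonglongrightarrow>
    - (LINT x:convex hull C|lborel. \<Sum>b\<in>Basis. g b x \<bullet> b)"
proof -
  have hb: "has_grad (\<lambda>x. V x \<bullet> b) (g b)" if "b \<in> Basis" for b using V that by (simp add: smooth_field_def)
  have dc: "continuous_on UNIV (\<lambda>x. \<Sum>b\<in>Basis. g b x \<bullet> b)"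
    by (intro continuous_intros has_grad_continuous_grad[OF hb])
  have Vc: "continuous_on UNIV (\<lambda>x. V x \<bullet> u)" for u
    by (rule has_grad_continuous[OF smooth_field_inner[OF V]])
  have id: "(\<Sum>v\<in>C. LINT x|lborel. cutoff_layer k v x * (V x \<bullet> G v)) =
    - (LINT x|lborel. cutoff k x * (\<Sum>b\<in>Basis. g b x \<bullet> b))" for k
  proof -
    have Vb: "(LINT x|lborel. cutoff k x * (g b x \<bullet> b)) +
      (LINT x|lborel. (\<Sum>v\<in>C. cutoff_layer k v x * ((V x \<bullet> b) * (G v \<bullet> b)))) = 0" if b: "b \<in> Basis" for b
    proof -
      have i1: "integrable lborel (\<lambda>x. cutoff k x * (g b x \<bullet> b))"
        by (intro integrable_cutoff_mult continuous_intros has_grad_continuous_grad[OF hb[OF b]])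
      have i2: "integrable lborel (\<lambda>x. \<Sum>v\<in>C. cutoff_layer k v x * ((V x \<bullet> b) * (G v \<bullet> b)))"
        by (intro Bochner_Integration.integrable_sum integrable_cutoff_layer_mult continuous_intros Vc)
      have "(LINT x|lborel. (cutoff k x *\<^sub>R g b x + (V x \<bullet> b) *\<^sub>R (\<Sum>v\<in>C. cutoff_layer k v x *\<^sub>R G v)) \<bullet> b) = 0"
        by (rule integral_gradient_eq_0[OF has_grad_mult[OF has_grad_cutoff hb[OF b]] compact_face[OF subset_refl]])
           (simp add: cutoff_outside)
      moreover have "(cutoff k x *\<^sub>R g b x + (V x \<bullet> b) *\<^sub>R (\<Sum>v\<in>C. cutoff_layer k v x *\<^sub>R G v)) \<bullet> b =
        cutoff k x * (g b x \<bullet> b) + (\<Sum>v\<in>C. cutoff_layer k v x * ((V x \<bullet> b) * (G v \<bullet> b)))" for x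
        by (simp add: inner_add_left inner_sum_left sum_distrib_left mult_ac)
      ultimately show ?thesis using Bochner_Integration.integral_add[OF i1 i2] by simp
    qed
    have "(LINT x|lborel. cutoff k x * (\<Sum>b\<in>Basis. g b x \<bullet> b)) = (\<Sum>b\<in>Basis. LINT x|lborel. cutoff k x * (g b x \<bullet> b))"
      unfolding sum_distrib_left
      by (rule Bochner_Integration.integral_sum)
         (intro integrable_cutoff_mult continuous_intros has_grad_continuous_grad[OF hb])
    also have "\<dots> = (\<Sum>b\<in>Basis. - (LINT x|lborel. (\<Sum>v\<in>C. cutoff_layer k v x * ((V x \<bullet> b) * (G v \<bullet> b)))))"
      by (rule sum.cong[OF refl]) (use Vb in \<open>simp add: eq_neg_iff_add_eq_0\<close>)
    also have "\<dots> = - (\<Sum>b\<in>Basis. \<Sum>v\<in>C. LINT x|lborel. cutoff_layer k v x * ((V x \<bullet> b) * (G v \<bullet> b)))"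
      unfolding sum_negf
      by (intro arg_cong[where f=uminus] sum.cong refl Bochner_Integration.integral_sum
        integrable_cutoff_layer_mult continuous_intros Vc)
    also have "(\<Sum>b\<in>Basis. \<Sum>v\<in>C. LINT x|lborel. cutoff_layer k v x * ((V x \<bullet> b) * (G v \<bullet> b))) =
      (\<Sum>v\<in>C. \<Sum>b\<in>Basis. LINT x|lborel. cutoff_layer k v x * ((V x \<bullet> b) * (G v \<bullet> b)))"
      by (rule sum.swap)
    also have "\<dots> = (\<Sum>v\<in>C. LINT x|lborel. cutoff_layer k v x * (V x \<bullet> G v))"
    proof (rule sum.cong[OF refl])
      fix v
      have "(\<Sum>b\<in>Basis. LINT x|lborel. cutoff_layer k v x * ((V x \<bullet> b) * (G v \<bullet> b))) =
        (LINT x|lborel. (\<Sum>b\<in>Basis. cutoff_layer k v x * ((V x \<bullet> b) * (G v \<bullet> b))))"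
        by (rule Bochner_Integration.integral_sum[symmetric])
           (intro integrable_cutoff_layer_mult continuous_intros Vc)
      then show "(\<Sum>b\<in>Basis. LINT x|lborel. cutoff_layer k v x * ((V x \<bullet> b) * (G v \<bullet> b))) =
        (LINT x|lborel. cutoff_layer k v x * (V x \<bullet> G v))"
        by (simp add: sum_distrib_left[symmetric] euclidean_inner[symmetric])
    qed
    finally show ?thesis by simp
  qed
  show ?thesis unfolding id by (rule tendsto_minus[OF integral_cutoff_tendsto[OF dc]])
qed

section \<open>Divergence on a mesh\<close>

locale mesh_coords =
  fixes \<T> :: "'a::euclidean_space set set" and Cs :: "'a set \<Rightarrow> 'a set"
    and Gs :: "'a set \<Rightarrow> 'a \<Rightarrow> 'a" and cs :: "'a set \<Rightarrow> 'a \<Rightarrow> real"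
  assumes tri: "triangulation \<T>"
    and coords: "T \<in> \<T> \<Longrightarrow> affine_coords (Cs T) (Gs T) (cs T)"
    and hull: "T \<in> \<T> \<Longrightarrow> T = convex hull (Cs T)"
begin

definition facet :: "'a set \<Rightarrow> 'a \<Rightarrow> 'a set" where
  "facet T v = convex hull (Cs T - {v})"

definition vbary :: "'a set \<Rightarrow> 'a \<Rightarrow> 'a \<Rightarrow> real" where
  "vbary T = affine_coords.bary (Gs T) (cs T)"

lemma finite_mesh: "finite \<T>"
  using tri by (simp add: triangulation_def)

lemma mesh_face: "T \<in> \<T> \<Longrightarrow> T' \<in> \<T> \<Longrightarrow> (T \<inter> T') face_of T"
  using tri by (simp add: triangulation_def)

lemma mesh_face': "T \<in> \<T> \<Longrightarrow> T' \<in> \<T> \<Longrightarrow> (T \<inter> T') face_of T'"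
  using mesh_face[of T' T] by (simp add: Int_commute)

lemma mesh_compact:
  assumes "T \<in> \<T>"
  shows "compact T"
  by (subst hull[OF assms]) (rule affine_coords.compact_face[OF coords[OF assms] subset_refl])

text \<open>A proper face contains no interior point, so the common face
  \<open>T \<inter> T'\<close> must be all of \<open>T'\<close> and then all of
  \<open>T\<close>.\<close>

lemma mesh_mem_interior_eq:
  assumes "T \<in> \<T>" "T' \<in> \<T>" "x \<in> T" "x \<in> interior T'"
  shows "T = T'"
proof -
  have "x \<in> T'" using assms(4) interior_subset by blast
  have "T \<inter> T' = T'"
  proof (rule ccontr)
    assume "T \<inter> T' \<noteq> T'"
    from face_of_disjoint_interior[OF mesh_face'[OF assms(1,2)] this] show False
      using assms \<open>x \<in> T'\<close> by blast
  qed
  then have sub: "T' \<subseteq> T" by blast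
  then have "interior T' \<subseteq> interior T" by (rule interior_mono)
  then have xi: "x \<in> interior T" using assms(4) by blast
  have "T \<inter> T' = T"
  proof (rule ccontr)
    assume "T \<inter> T' \<noteq> T"
    from face_of_disjoint_interior[OF mesh_face[OF assms(1,2)] this] show False
      using xi \<open>x \<in> T'\<close> assms(3) by blast
  qed
  then show ?thesis using sub by blast
qed

lemma vbary_pos_interior:
  assumes "T \<in> \<T>" "\<And>w. w \<in> Cs T \<Longrightarrow> vbary T w x > 0"
  shows "x \<in> interior T"
proof -
  interpret affine_coords "Cs T" "Gs T" "cs T" by (rule coords[OF assms(1)])
  have o: "open (\<Inter>w\<in>Cs T. {y. bary w y > 0})"
    unfolding bary_def by (intro open_INT finite_C ballI open_Collect_less continuous_intros)
  have s: "(\<Inter>w\<in>Cs T. {y. bary w y > 0}) \<subseteq> T"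
    by (subst hull[OF assms(1)]) (auto simp: mem_face_iff[OF subset_refl] less_imp_le)
  have "x \<in> (\<Inter>w\<in>Cs T. {y. bary w y > 0})" using assms(2) by (simp add: vbary_def)
  then show ?thesis by (rule interiorI[OF o _ s])
qed

text \<open>A facet as a point set determines its vertices, namely its extreme points.\<close>

lemma shared_facet_vertices:
  assumes "T \<in> \<T>" "T' \<in> \<T>" "facet T v = facet T' v'"
  shows "Cs T - {v} = Cs T' - {v'}"
proof -
  have "\<not> affine_dependent (Cs S - {w})" if "S \<in> \<T>" for S w
    using affine_coords.not_affine_dependent_C[OF coords[OF that]] affine_dependent_subset by blast
  then have "x \<in> Cs S - {w} \<longleftrightarrow> x extreme_point_of (facet S w)" if "S \<in> \<T>" for x S w
    unfolding facet_def using extreme_point_of_convex_hull_affine_independent that by blast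
  then show ?thesis using assms by (intro set_eqI) simp
qed

lemma facet_vertex_unique:
  assumes "T \<in> \<T>" "v \<in> Cs T" "v' \<in> Cs T" "facet T v = facet T v'"
  shows "v = v'"
  using shared_facet_vertices[OF assms(1,1,4)] assms(2,3) by blast

lemma facet_nonempty: "T \<in> \<T> \<Longrightarrow> v \<in> Cs T \<Longrightarrow> Cs T - {v} \<noteq> {}"
proof
  assume T: "T \<in> \<T>" "v \<in> Cs T" and e: "Cs T - {v} = {}"
  then have "Cs T = {v}" by blast
  then show False using affine_coords.card_C[OF coords[OF T(1)]] DIM_positive[where 'a='a] by simp
qed

text \<open>If \<open>v'\<close> were on the side of \<open>v\<close>, a short step from the
  relative interior of the facet towards \<open>v'\<close> would reach the interior of
  \<open>T\<close> while staying in \<open>T'\<close>, which forces \<open>T = T'\<close>.\<close>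

lemma opposite_sides:
  assumes T: "T \<in> \<T>" "T' \<in> \<T>" "T \<noteq> T'" and v: "v \<in> Cs T" "v' \<in> Cs T'" and F: "facet T v = facet T' v'"
  shows "vbary T v v' < 0"
proof -
  define D where "D = Cs T - {v}"
  have D: "Cs T = insert v D" "Cs T' = insert v' D" "v \<notin> D" "v' \<notin> D"
    using v shared_facet_vertices[OF T(1,2) F] by (auto simp: D_def)
  have co: "affine_coords (insert v D) (Gs T) (cs T)" and co': "affine_coords (insert v' D) (Gs T') (cs T')"
    using coords[OF T(1)] coords[OF T(2)] D by simp_all
  interpret A: affine_coords "insert v D" "Gs T" "cs T" by fact
  interpret B: affine_coords "insert v' D" "Gs T'" "cs T'" by fact
  note opp = opposite_coords(1)[OF co co' D(3,4)]
  \<comment> \<open>Evaluated at \<open>v\<close>, the proportionality of the coordinates expresses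
    1 as a multiple of \<open>A.bary v v'\<close>.\<close>
  have nz: "A.bary v v' \<noteq> 0" using opp[of v] A.bary_vertex[of v v] by auto
  have "\<not> A.bary v v' > 0"
  proof
    assume pos: "A.bary v v' > 0"
    have "D \<noteq> {}" using facet_nonempty[OF T(1) v(1)] by (simp add: D_def)
    then have "rel_interior (convex hull D) \<noteq> {}" by (simp add: rel_interior_eq_empty)
    then obtain x0 where x0: "x0 \<in> rel_interior (convex hull D)" by blast
    then have x0D: "x0 \<in> convex hull D" using rel_interior_subset by blast
    have bpos: "A.bary w x0 > 0" if "w \<in> D" for w
      by (rule A.rel_interior_face_pos[OF subset_insertI x0 that])
    have b0: "A.bary v x0 = 0" using x0D A.mem_face_iff[OF subset_insertI] D(3) by blast
    define y where "y e = x0 + e *\<^sub>R (v' - x0)" for e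
    have yb: "A.bary w (y e) = A.bary w x0 + e * (A.bary w v' - A.bary w x0)" for w e
      by (simp add: y_def A.bary_def inner_add_right inner_diff_right)
    have "\<forall>\<^sub>F e in at_right 0. A.bary w (y e) > 0" if "w \<in> insert v D" for w
    proof (cases "w = v")
      case True
      show ?thesis unfolding True yb b0 using pos eventually_at_right_less[of 0]
        by (auto elim!: eventually_mono)
    next
      case False
      have "((\<lambda>e. A.bary w (y e)) \<longlongrightarrow> A.bary w x0 + 0 * (A.bary w v' - A.bary w x0)) (at_right 0)"
        unfolding yb by (intro tendsto_intros)
      then show ?thesis using bpos that False by (intro order_tendstoD(1)[of _ "A.bary w x0"]) auto
    qed
    then have "\<forall>\<^sub>F e in at_right 0. \<forall>w\<in>insert v D. A.bary w (y e) > 0"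
      using A.finite_C by (intro eventually_ball_finite) auto
    moreover have "\<forall>\<^sub>F e in at_right 0. e < (1::real)" by (rule eventually_at_right_real[of 0 1, THEN eventually_mono]) auto
    moreover have "\<forall>\<^sub>F e in at_right 0. 0 < (e::real)" by (rule eventually_at_right_less)
    ultimately have "\<forall>\<^sub>F e in at_right 0. (\<forall>w\<in>insert v D. A.bary w (y e) > 0) \<and> 0 < e \<and> e < 1"
      by eventually_elim simp
    then have "\<exists>e. (\<forall>w\<in>insert v D. A.bary w (y e) > 0) \<and> 0 < e \<and> e < 1"
      by (rule eventually_happens'[OF trivial_limit_at_right_real])
    then obtain e where e: "\<forall>w\<in>insert v D. A.bary w (y e) > 0" "0 < e" "e < 1" by (elim exE conjE)
    have "y e \<in> interior T"
      by (rule vbary_pos_interior[OF T(1)]) (use e(1) D(1) in \<open>auto simp: vbary_def\<close>)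
    moreover have "y e \<in> T'"
    proof -
      have "x0 \<in> T'" using x0D hull_mono[of D "Cs T'"] hull[OF T(2)] D(2) by blast
      moreover have "v' \<in> T'" using hull_inc[of v' "Cs T'"] hull[OF T(2)] v(2) by blast
      moreover have "convex T'" by (subst hull[OF T(2)]) (rule convex_convex_hull)
      moreover have "y e = (1 - e) *\<^sub>R x0 + e *\<^sub>R v'" by (simp add: y_def algebra_simps)
      ultimately show ?thesis using e by (auto intro!: convexD_alt)
    qed
    ultimately have "T' = T" by (rule mesh_mem_interior_eq[OF T(2,1), rotated])
    then show False using T(3) by simp
  qed
  then show ?thesis using nz by (simp add: vbary_def)
qed

text \<open>The three vertices would lie pairwise on opposite sides of one hyperplane: the
  coordinate at \<open>v3\<close> is a product of two negative numbers and yet negative.\<close>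

lemma no_third_simplex:
  assumes T: "T1 \<in> \<T>" "T2 \<in> \<T>" "T3 \<in> \<T>" "T1 \<noteq> T2" "T1 \<noteq> T3" "T2 \<noteq> T3"
    and v: "v1 \<in> Cs T1" "v2 \<in> Cs T2" "v3 \<in> Cs T3"
    and F: "facet T1 v1 = facet T2 v2" "facet T1 v1 = facet T3 v3"
  shows False
proof -
  define D where "D = Cs T1 - {v1}"
  have D: "Cs T1 = insert v1 D" "Cs T2 = insert v2 D" "v1 \<notin> D" "v2 \<notin> D"
    using v shared_facet_vertices[OF T(1,2) F(1)] by (auto simp: D_def)
  have "vbary T1 v1 v3 = vbary T1 v1 v2 * vbary T2 v2 v3"
    unfolding vbary_def
    by (rule opposite_coords(1)[OF _ _ D(3,4)]) (use coords[OF T(1)] coords[OF T(2)] D in simp_all)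
  moreover have "vbary T1 v1 v3 < 0" by (rule opposite_sides[OF T(1,3,5) v(1,3) F(2)])
  moreover have "vbary T1 v1 v2 < 0" by (rule opposite_sides[OF T(1,2,4) v(1,2) F(1)])
  moreover have "vbary T2 v2 v3 < 0"
    by (rule opposite_sides[OF T(2,3,6) v(2,3)]) (use F in simp)
  ultimately show False using mult_neg_neg[of "vbary T1 v1 v2" "vbary T2 v2 v3"] by simp
qed

text \<open>Crossing the facet along the negative gradient leaves \<open>T\<close> but not the mesh,
  so \<open>x\<close> is a limit of points of the other simplices, whose finite union is closed. The
  common face of \<open>T\<close> with a simplex containing \<open>x\<close> meets the relative
  interior of the facet and hence contains the facet.\<close>

lemma interior_facet_shared:
  assumes T: "T \<in> \<T>" and v: "v \<in> Cs T" and x: "x \<in> rel_interior (facet T v)" "x \<in> interior (\<Union>\<T>)"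
  shows "\<exists>T'\<in>\<T>. T' \<noteq> T \<and> (\<exists>v'\<in>Cs T'. facet T v = facet T' v')"
proof -
  interpret affine_coords "Cs T" "Gs T" "cs T" by (rule coords[OF T])
  have xF: "x \<in> facet T v" using x(1) rel_interior_subset by blast
  have b0: "bary v x = 0" using xF mem_face_iff[of "Cs T - {v}"] v unfolding facet_def by blast
  define K where "K = \<Union>(\<T> - {T})"
  have "closed K" unfolding K_def
    by (intro closed_Union finite_Diff finite_mesh ballI compact_imp_closed mesh_compact) auto
  moreover have "x \<in> closure K"
    unfolding closure_approachable
  proof (intro allI impI)
    fix e :: real assume e: "e > 0"
    obtain d where d: "d > 0" "ball x d \<subseteq> \<Union>\<T>" using x(2) unfolding mem_interior by blast
    have nz: "norm (Gs T v) > 0" using G_nonzero[OF v] by simp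
    \<comment> \<open>The displacement has length \<open>min e d / 2\<close>, below both the
      tolerance and the radius of the ball inside the mesh.\<close>
    define t where "t = min e d / (2 * norm (Gs T v))"
    have t: "t > 0" using e d nz by (simp add: t_def)
    define y where "y = x - t *\<^sub>R Gs T v"
    have "t * norm (Gs T v) = min e d / 2" using nz by (simp add: t_def)
    then have dist: "dist y x < e" "dist x y < d" using e d t by (auto simp: y_def dist_norm)
    have "bary v y = - (t * (Gs T v \<bullet> Gs T v))" using b0 by (simp add: y_def bary_def inner_diff_right)
    also have "\<dots> < 0" using t G_nonzero[OF v] by simp
    finally have "y \<notin> convex hull (Cs T)" using mem_face_iff[OF subset_refl] v by force
    then have "y \<notin> T" using hull[OF T] by simp
    moreover have "y \<in> \<Union>\<T>" using d(2) dist(2) by auto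
    ultimately have "y \<in> K" by (auto simp: K_def)
    then show "\<exists>y\<in>K. dist y x < e" using dist(1) by blast
  qed
  ultimately have "x \<in> K" by simp
  then obtain T' where T': "T' \<in> \<T>" "T' \<noteq> T" "x \<in> T'" by (auto simp: K_def)
  have FT: "facet T v \<in> subsimplices (DIM('a) - 1) T"
    by (subst (2) hull[OF T]) (use v in \<open>auto simp: facet_def facets_iff simp del: One_nat_def\<close>)
  then have face: "facet T v face_of T" and simp: "int (DIM('a) - 1) simplex (facet T v)"
    by (simp_all add: subsimplices_def del: of_nat_diff)
  have sub: "facet T v \<subseteq> T \<inter> T'"
  proof (rule subset_of_face_of[OF mesh_face[OF T T'(1)] face_of_imp_subset[OF face]])
    show "(T \<inter> T') \<inter> rel_interior (facet T v) \<noteq> {}"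
      using x(1) xF T'(3) face_of_imp_subset[OF face] by blast
  qed
  have "facet T v face_of (T \<inter> T')" by (rule face_of_subset[OF face sub]) simp
  from face_of_trans[OF this mesh_face'[OF T T'(1)]] have "facet T v face_of T'" .
  then have "facet T v \<in> subsimplices (DIM('a) - 1) (convex hull (Cs T'))"
    using simp hull[OF T'(1)] by (simp only: subsimplices_def mem_Collect_eq)
  then obtain v' where "v' \<in> Cs T'" "facet T v = facet T' v'"
    unfolding affine_coords.facets_iff[OF coords[OF T'(1)]] facet_def by (elim bexE)
  then show ?thesis using T' by blast
qed

text \<open>Fluxes are indexed by a simplex and an opposite vertex, and regrouped by facet. A fibre
  is a single pair, handled by \<open>bd\<close>, or exactly two, handled by \<open>int\<close>. The
  limit taken facet by facet is 0, and taken simplex by simplex it is minus the sum of the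
  divergence integrals.\<close>

lemma mesh_divergence:
  assumes V: "\<And>T. T \<in> \<T> \<Longrightarrow> smooth_field (V T) (g T)"
    and int: "\<And>T T' v v' x. T \<in> \<T> \<Longrightarrow> T' \<in> \<T> \<Longrightarrow> T \<noteq> T' \<Longrightarrow> v \<in> Cs T \<Longrightarrow> v' \<in> Cs T' \<Longrightarrow>
      facet T v = facet T' v' \<Longrightarrow> x \<in> facet T v \<Longrightarrow> V T x \<bullet> Gs T v = V T' x \<bullet> Gs T v"
    and bd: "\<And>T v x. T \<in> \<T> \<Longrightarrow> v \<in> Cs T \<Longrightarrow> \<not> (\<exists>T'\<in>\<T>. T' \<noteq> T \<and> (\<exists>v'\<in>Cs T'. facet T v = facet T' v')) \<Longrightarrow>
      x \<in> facet T v \<Longrightarrow> V T x \<bullet> Gs T v = 0"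
  shows "(\<Sum>T\<in>\<T>. LINT x:T|lborel. \<Sum>b\<in>Basis. g T b x \<bullet> b) = 0"
proof -
  define flux where "flux k p = (LINT x|lborel. affine_coords.cutoff_layer (Cs (fst p)) (Gs (fst p)) (cs (fst p)) k (snd p) x *
    (V (fst p) x \<bullet> Gs (fst p) (snd p)))" for k p
  define P where "P = Sigma \<T> Cs"
  define fac where "fac p = facet (fst p) (snd p)" for p
  have finP: "finite P" unfolding P_def
    by (intro finite_SigmaI finite_mesh affine_coords.finite_C[OF coords])
  have fibre: "(\<lambda>k. \<Sum>q\<in>{q \<in> P. fac q = F}. flux k q) \<longlonglongrightarrow> 0" if F: "F \<in> fac ` P" for F
  proof -
    obtain T v where Tv: "T \<in> \<T>" "v \<in> Cs T" "F = facet T v" using F by (auto simp: P_def fac_def)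
    show ?thesis
    proof (cases "\<exists>T'\<in>\<T>. T' \<noteq> T \<and> (\<exists>v'\<in>Cs T'. facet T v = facet T' v')")
      case False
      have "{q \<in> P. fac q = F} = {(T, v)}"
      proof (intro set_eqI iffI)
        fix q assume "q \<in> {q \<in> P. fac q = F}"
        then obtain T' v' where q: "q = (T', v')" "T' \<in> \<T>" "v' \<in> Cs T'" "facet T' v' = facet T v"
          using Tv(3) by (auto simp: P_def fac_def)
        then have "T' = T" using False by metis
        then show "q \<in> {(T, v)}" using facet_vertex_unique[OF Tv(1) _ Tv(2)] q by auto
      qed (use Tv in \<open>auto simp: P_def fac_def\<close>)
      then have "(\<lambda>k. \<Sum>q\<in>{q \<in> P. fac q = F}. flux k q) = (\<lambda>k. flux k (T, v))" by simp
      moreover have "(\<lambda>k. flux k (T, v)) \<longlonglongrightarrow> 0"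
        unfolding flux_def fst_conv snd_conv
        by (rule affine_coords.flux_boundary_tendsto_0[OF coords[OF Tv(1)] Tv(2) V[OF Tv(1)]])
           (rule bd[OF Tv(1,2) False], simp add: facet_def)
      ultimately show ?thesis by simp
    next
      case True
      then obtain T' v' where T': "T' \<in> \<T>" "T' \<noteq> T" "v' \<in> Cs T'" "facet T v = facet T' v'" by (elim bexE conjE)
      note TT = T'(2)[symmetric]
      have "{q \<in> P. fac q = F} = {(T, v), (T', v')}"
      proof (intro set_eqI iffI)
        fix q assume "q \<in> {q \<in> P. fac q = F}"
        then obtain T'' v'' where q: "q = (T'', v'')" "T'' \<in> \<T>" "v'' \<in> Cs T''" "facet T'' v'' = facet T v"
          using Tv(3) by (auto simp: P_def fac_def)
        consider "T'' = T" | "T'' = T'" | "T \<noteq> T''" "T' \<noteq> T''" by blast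
        then show "q \<in> {(T, v), (T', v')}"
        proof cases
          case 1
          then show ?thesis using facet_vertex_unique[OF Tv(1) _ Tv(2)] q by auto
        next
          case 2
          then show ?thesis using facet_vertex_unique[OF T'(1) _ T'(3)] q T'(4) by auto
        next
          case 3
          have False by (rule no_third_simplex[OF Tv(1) T'(1) q(2) TT 3 Tv(2) T'(3) q(3) T'(4) q(4)[symmetric]])
          then show ?thesis ..
        qed
      next
        fix q assume q: "q \<in> {(T, v), (T', v')}"
        have "(T, v) \<in> {q \<in> P. fac q = F}" by (simp add: P_def fac_def Tv)
        moreover have "(T', v') \<in> {q \<in> P. fac q = F}" by (simp add: P_def fac_def T'(1,3) Tv(3) T'(4))
        ultimately show "q \<in> {q \<in> P. fac q = F}" using q by blast
      qed
      then have eq: "(\<lambda>k. \<Sum>q\<in>{q \<in> P. fac q = F}. flux k q) = (\<lambda>k. flux k (T, v) + flux k (T', v'))"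
        using TT by simp
      define D where "D = Cs T - {v}"
      have D: "Cs T = insert v D" "Cs T' = insert v' D" "v \<notin> D" "v' \<notin> D"
        using Tv(2) T'(3) shared_facet_vertices[OF Tv(1) T'(1,4)] by (auto simp: D_def)
      have "(\<lambda>k. flux k (T, v) + flux k (T', v')) \<longlonglongrightarrow> 0"
        unfolding flux_def fst_conv snd_conv D
      proof (rule flux_pair_tendsto_0[OF _ _ D(3,4) _ V[OF Tv(1)] V[OF T'(1)]])
        show "affine_coords (insert v D) (Gs T) (cs T)" using coords[OF Tv(1)] D by simp
        show "affine_coords (insert v' D) (Gs T') (cs T')" using coords[OF T'(1)] D by simp
        show "affine_coords.bary (Gs T) (cs T) v v' < 0"
          using opposite_sides[OF Tv(1) T'(1) TT Tv(2) T'(3,4)] by (simp add: vbary_def)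
        show "V T x \<bullet> Gs T v = V T' x \<bullet> Gs T v" if "x \<in> convex hull D" for x
          by (rule int[OF Tv(1) T'(1) TT Tv(2) T'(3,4)]) (use that in \<open>simp add: facet_def D_def\<close>)
      qed
      then show ?thesis unfolding eq .
    qed
  qed
  have split: "(\<Sum>T\<in>\<T>. \<Sum>v\<in>Cs T. flux k (T, v)) = (\<Sum>F\<in>fac ` P. \<Sum>q\<in>{q \<in> P. fac q = F}. flux k q)" for k
  proof -
    have "(\<Sum>T\<in>\<T>. \<Sum>v\<in>Cs T. flux k (T, v)) = (\<Sum>q\<in>P. flux k q)"
      unfolding P_def using finite_mesh affine_coords.finite_C[OF coords]
      by (subst sum.Sigma) auto
    also have "\<dots> = (\<Sum>F\<in>fac ` P. \<Sum>q\<in>{q \<in> P. fac q = F}. flux k q)"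
      by (rule sum.image_gen[OF finP])
    finally show ?thesis .
  qed
  have "(\<lambda>k. \<Sum>T\<in>\<T>. \<Sum>v\<in>Cs T. flux k (T, v)) \<longlonglongrightarrow> (\<Sum>F\<in>fac ` P. 0)"
    unfolding split by (rule tendsto_sum[OF fibre])
  moreover have "(\<lambda>k. \<Sum>T\<in>\<T>. \<Sum>v\<in>Cs T. flux k (T, v)) \<longlonglongrightarrow>
    (\<Sum>T\<in>\<T>. - (LINT x:T|lborel. \<Sum>b\<in>Basis. g T b x \<bullet> b))"
  proof (rule tendsto_sum)
    fix T assume T: "T \<in> \<T>"
    show "(\<lambda>k. \<Sum>v\<in>Cs T. flux k (T, v)) \<longlonglongrightarrow> - (LINT x:T|lborel. \<Sum>b\<in>Basis. g T b x \<bullet> b)"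
      using affine_coords.simplex_divergence[OF coords[OF T] V[OF T]] hull[OF T]
      unfolding flux_def fst_conv snd_conv by simp
  qed
  ultimately have "(\<Sum>F\<in>fac ` P. 0) = (\<Sum>T\<in>\<T>. - (LINT x:T|lborel. \<Sum>b\<in>Basis. g T b x \<bullet> b))"
    by (rule LIMSEQ_unique)
  then show ?thesis by (simp add: sum_negf)
qed

end

section \<open>Test functions and rows of polynomial matrix fields\<close>

lemma test_function_has_grad: "\<phi> \<in> test_functions \<Omega> \<Longrightarrow> has_grad \<phi> (gradient \<phi>)"
  by (rule C_k_has_grad) (simp add: test_functions_def)

lemma test_function_outside:
  assumes "\<phi> \<in> test_functions \<Omega>" "x \<notin> \<Omega>"
  shows "\<phi> x = 0" "gradient \<phi> x = 0"
proof -
  define U where "U = - closure {x. \<phi> x \<noteq> 0}"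
  have U: "open U" "x \<in> U" "\<And>y. y \<in> U \<Longrightarrow> \<phi> y = 0"
    using assms closure_subset[of "{x. \<phi> x \<noteq> 0}"] by (auto simp: U_def test_functions_def)
  then show "\<phi> x = 0" by blast
  have "((\<lambda>y. 0) has_derivative (\<lambda>v. 0)) (at x)" by (rule has_derivative_const)
  then have "(\<phi> has_derivative (\<lambda>v. 0)) (at x)"
    by (rule has_derivative_transform_within_open[OF _ U(1,2)]) (simp add: U(3))
  from has_derivative_unique[OF has_gradD[OF test_function_has_grad[OF assms(1)]] this]
  have "gradient \<phi> x \<bullet> v = 0" for v by (rule fun_cong)
  from this[of "gradient \<phi> x"] show "gradient \<phi> x = 0" by simp
qed

lemma has_grad_row_inner:
  assumes "\<And>j. has_grad (\<lambda>x. P x $ i $ j) (\<gamma> j)"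
  shows "has_grad (\<lambda>x. row i (P x) \<bullet> b) (\<lambda>x. \<Sum>j\<in>UNIV. (b $ j) *\<^sub>R \<gamma> j x)"
proof -
  have "has_grad (\<lambda>x. \<Sum>j\<in>UNIV. b $ j * (P x $ i $ j)) (\<lambda>x. \<Sum>j\<in>UNIV. (b $ j) *\<^sub>R \<gamma> j x)"
    by (intro has_grad_sum has_grad_cmult assms)
  then show ?thesis by (simp add: row_def inner_vec_def mult.commute)
qed

lemma matrix_entry_has_grad:
  fixes P :: "real^'n \<Rightarrow> real^'n^'n"
  assumes "deg_below k P"
  shows "\<exists>\<gamma>. has_grad (\<lambda>x. P x $ i $ j) \<gamma>"
proof (rule deg_below_has_grad)
  have "linear (\<lambda>A::real^'n^'n. A $ i $ j)" by (simp add: linear_iff)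
  from deg_below_linear[OF this assms] show "deg_below k (\<lambda>x. P x $ i $ j)" .
qed

lemma row_inner: "row i A \<bullet> u = (A *v u) $ i"
  by (simp add: row_def inner_vec_def matrix_vector_mult_def)

text \<open>Pointwise product rule for the divergence of a scalar times a vector field:
  \<open>s\<close> and \<open>z\<close> are the value and gradient of the scalar, \<open>w\<close>
  the value of the field, and \<open>\<gamma> j\<close> the gradient of its component
  \<open>j\<close>.\<close>

lemma divergence_of_product:
  fixes \<gamma> :: "'n::finite \<Rightarrow> real^'n" and w z :: "real^'n"
  shows "(\<Sum>b\<in>Basis. (s *\<^sub>R (\<Sum>j\<in>UNIV. (b $ j) *\<^sub>R \<gamma> j) + (w \<bullet> b) *\<^sub>R z) \<bullet> b) =
    s * (\<Sum>j\<in>UNIV. \<gamma> j $ j) + w \<bullet> z"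
proof -
  have "(\<Sum>b\<in>Basis. (\<Sum>j\<in>UNIV. (b $ j) *\<^sub>R \<gamma> j) \<bullet> b) = (\<Sum>b\<in>Basis. \<Sum>j\<in>UNIV. (\<gamma> j \<bullet> b) * (axis j 1 \<bullet> b))"
    by (simp add: inner_sum_left inner_axis' mult.commute)
  also have "\<dots> = (\<Sum>j\<in>UNIV. \<Sum>b\<in>Basis. (\<gamma> j \<bullet> b) * (axis j 1 \<bullet> b))" by (rule sum.swap)
  also have "\<dots> = (\<Sum>j\<in>UNIV. \<gamma> j \<bullet> axis j 1)" by (simp only: euclidean_inner[symmetric])
  also have "\<dots> = (\<Sum>j\<in>UNIV. \<gamma> j $ j)" by (simp add: inner_axis)
  finally have 1: "(\<Sum>b\<in>Basis. (\<Sum>j\<in>UNIV. (b $ j) *\<^sub>R \<gamma> j) \<bullet> b) = (\<Sum>j\<in>UNIV. \<gamma> j $ j)" .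
  have 2: "(\<Sum>b\<in>Basis. (w \<bullet> b) * (z \<bullet> b)) = w \<bullet> z" by (rule euclidean_inner[symmetric])
  have "(\<Sum>b\<in>Basis. (s *\<^sub>R (\<Sum>j\<in>UNIV. (b $ j) *\<^sub>R \<gamma> j) + (w \<bullet> b) *\<^sub>R z) \<bullet> b) =
    s * (\<Sum>b\<in>Basis. (\<Sum>j\<in>UNIV. (b $ j) *\<^sub>R \<gamma> j) \<bullet> b) + (\<Sum>b\<in>Basis. (w \<bullet> b) * (z \<bullet> b))"
    by (simp only: inner_add_left inner_scaleR_left sum.distrib sum_distrib_left)
  then show ?thesis unfolding 1 2 .
qed

section \<open>From integrals over the domain to sums over simplices\<close>

context mesh_coords
begin

lemma mesh_convex:
  assumes "T \<in> \<T>"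
  shows "convex T"
  by (subst hull[OF assms]) (rule convex_convex_hull)

lemma AE_not_frontier: "AE x in lebesgue. \<forall>T\<in>\<T>. x \<notin> frontier T"
proof -
  have "AE x in lebesgue. x \<notin> frontier T" if "T \<in> \<T>" for T
    using negligible_convex_frontier[OF mesh_convex[OF that]]
    unfolding negligible_iff_null_sets by (rule AE_not_in)
  then show ?thesis using finite_mesh by (simp add: AE_finite_all)
qed

lemma unique_simplex:
  assumes "\<forall>T\<in>\<T>. x \<notin> frontier T" "T \<in> \<T>" "x \<in> T" "T' \<in> \<T>" "x \<in> T'"
  shows "T' = T"
proof -
  have "x \<in> closure T" using assms(3) closure_subset by blast
  then have "x \<in> interior T" using assms(1,2) by (auto simp: frontier_def)
  then show ?thesis by (rule mesh_mem_interior_eq[OF assms(4,2,5)])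
qed

text \<open>The frontiers of the simplices are null sets, and off them a point lies in at most one
  simplex, so the sum of indicators selects one term almost everywhere. Since \<open>q T\<close>
  vanishes off \<Omega>, whole simplices can replace their parts in \<Omega>.\<close>

lemma integral_over_mesh:
  fixes q :: "'a set \<Rightarrow> 'a \<Rightarrow> real"
  assumes \<Omega>: "open \<Omega>" "\<Omega> \<subseteq> \<Union>\<T>" and q: "\<And>T. T \<in> \<T> \<Longrightarrow> continuous_on UNIV (q T)"
    "\<And>T x. T \<in> \<T> \<Longrightarrow> x \<notin> \<Omega> \<Longrightarrow> q T x = 0"
    and h: "h \<in> borel_measurable (lebesgue_on \<Omega>)"
      "AE x in lebesgue. x \<in> \<Omega> \<longrightarrow> (\<forall>T\<in>\<T>. x \<in> T \<longrightarrow> h x = q T x)"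
  shows "(LINT x|lebesgue_on \<Omega>. h x) = (\<Sum>T\<in>\<T>. LINT x:T|lborel. q T x)"
proof -
  have \<Omega>m: "\<Omega> \<inter> space lebesgue \<in> sets lebesgue" using \<Omega>(1) by (simp add: borel_open sets_completionI_sets)
  have i: "integrable lborel (\<lambda>x. indicator T x *\<^sub>R q T x)" if "T \<in> \<T>" for T
    by (rule borel_integrable_compact[OF mesh_compact[OF that] continuous_on_subset[OF q(1)[OF that]]]) simp
  have il: "integrable lebesgue (\<lambda>x. indicator T x *\<^sub>R q T x)" if "T \<in> \<T>" for T
    using i[OF that] by (simp add: integrable_completion borel_measurable_integrable)
  have "(LINT x|lebesgue_on \<Omega>. h x) = (LINT x|lebesgue. indicator \<Omega> x *\<^sub>R h x)"
    by (rule integral_restrict_space[OF \<Omega>m])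
  also have "\<dots> = (LINT x|lebesgue. (\<Sum>T\<in>\<T>. indicator T x *\<^sub>R q T x))"
  proof (rule integral_cong_AE)
    show "(\<lambda>x. indicator \<Omega> x *\<^sub>R h x) \<in> borel_measurable lebesgue"
      using h(1) borel_measurable_restrict_space_iff[OF \<Omega>m, of h] by simp
    show "(\<lambda>x. \<Sum>T\<in>\<T>. indicator T x *\<^sub>R q T x) \<in> borel_measurable lebesgue"
      by (intro borel_measurable_sum borel_measurable_integrable[OF il])
    show "AE x in lebesgue. indicator \<Omega> x *\<^sub>R h x = (\<Sum>T\<in>\<T>. indicator T x *\<^sub>R q T x)"
      using AE_not_frontier h(2)
    proof eventually_elim
      case (elim x)
      show ?case
      proof (cases "x \<in> \<Omega>")
        case False
        then have "(\<Sum>T\<in>\<T>. indicator T x *\<^sub>R q T x) = 0" using q(2) by (intro sum.neutral) auto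
        then show ?thesis using False by simp
      next
        case True
        then obtain T where T: "T \<in> \<T>" "x \<in> T" using \<Omega>(2) by blast
        have "(\<Sum>T'\<in>\<T>. indicator T' x *\<^sub>R q T' x) = (\<Sum>T'\<in>{T}. indicator T' x *\<^sub>R q T' x)"
        proof (rule sum.mono_neutral_right[OF finite_mesh])
          show "\<forall>T'\<in>\<T> - {T}. indicator T' x *\<^sub>R q T' x = 0"
          proof
            fix T' assume T': "T' \<in> \<T> - {T}"
            then have "x \<notin> T'" using unique_simplex[OF elim(1) T, of T'] by blast
            then show "indicator T' x *\<^sub>R q T' x = 0" by simp
          qed
        qed (use T in simp)
        also have "\<dots> = h x" using T elim(2) True by simp
        finally show ?thesis using True by simp
      qed
    qed
  qed
  also have "\<dots> = (\<Sum>T\<in>\<T>. LINT x|lebesgue. indicator T x *\<^sub>R q T x)"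
    by (rule Bochner_Integration.integral_sum[OF il])
  also have "\<dots> = (\<Sum>T\<in>\<T>. LINT x:T|lborel. q T x)"
    unfolding set_lebesgue_integral_def
    by (rule sum.cong[OF refl]) (rule integral_completion, rule borel_measurable_integrable[OF i])
  finally show ?thesis .
qed

end

text \<open>The weak divergence is the piecewise classical one. The divergence theorem on the mesh
  is applied to the test function times a row of \<open>P T\<close>; normal continuity serves the
  shared facets, and on the remaining facets the test function vanishes.\<close>

lemma piecewise_polynomial_H_div:
  fixes \<Omega> :: "(real^'n) set" and A :: "real^'n \<Rightarrow> real^'n^'n"
  assumes mesh: "mesh_coords \<T> Cs Gs cs" and \<Omega>: "open \<Omega>" "bounded \<Omega>" "\<Union>\<T> = closure \<Omega>"
    and A: "A \<in> L2_space \<Omega> V"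
    and P: "\<And>T. T \<in> \<T> \<Longrightarrow> deg_below k (P T)"
      "\<And>T. T \<in> \<T> \<Longrightarrow> AE x in lebesgue_on (T \<inter> \<Omega>). A x = P T x"
    and normal: "\<And>T T' v v' x. T \<in> \<T> \<Longrightarrow> T' \<in> \<T> \<Longrightarrow> T \<noteq> T' \<Longrightarrow> v \<in> Cs T \<Longrightarrow> v' \<in> Cs T' \<Longrightarrow>
      mesh_coords.facet Cs T v = mesh_coords.facet Cs T' v' \<Longrightarrow> x \<in> mesh_coords.facet Cs T v \<Longrightarrow>
      P T x *v Gs T v = P T' x *v Gs T v"
  shows "A \<in> H_div \<Omega> V"
proof -
  interpret mesh_coords \<T> Cs Gs cs by fact
  define \<gamma> where "\<gamma> T i j = (SOME g. has_grad (\<lambda>x. P T x $ i $ j) g)" for T i j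
  have \<gamma>: "has_grad (\<lambda>x. P T x $ i $ j) (\<gamma> T i j)" if "T \<in> \<T>" for T i j
    unfolding \<gamma>_def by (rule someI_ex[OF matrix_entry_has_grad[OF P(1)[OF that]]])
  define dv where "dv T x = (\<chi> i. \<Sum>j\<in>UNIV. \<gamma> T i j x $ j)" for T x
  have dvc: "continuous_on UNIV (dv T)" if "T \<in> \<T>" for T
    unfolding dv_def[abs_def]
    by (intro continuous_on_vec_lambda continuous_on_sum continuous_on_component
        has_grad_continuous_grad[OF \<gamma>[OF that]])
  have Pc: "continuous_on UNIV (P T)" if "T \<in> \<T>" for T by (rule deg_below_continuous[OF P(1)[OF that]])
  \<comment> \<open>On points of several simplices the sum mixes several values, but such points
    form a null set.\<close>
  define g where "g x = (\<Sum>T\<in>\<T>. indicator T x *\<^sub>R dv T x)" for x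
  have gm: "g \<in> borel_measurable borel"
    unfolding g_def[abs_def]
    by (intro borel_measurable_sum borel_measurable_continuous_on_indicator borel_compact mesh_compact
        continuous_on_subset[OF dvc] subset_UNIV)
  have gml: "g \<in> borel_measurable (lebesgue_on \<Omega>)"
    by (rule measurable_restrict_space1) (use gm in \<open>simp add: measurable_completion\<close>)
  have \<Omega>l: "\<Omega> \<in> lmeasurable" by (rule lmeasurable_open[OF \<Omega>(2,1)])
  have g2: "g \<in> L2_space \<Omega> UNIV"
  proof -
    have "\<exists>M. \<forall>x\<in>T. norm (dv T x) \<le> M" if "T \<in> \<T>" for T
    proof -
      have "bounded (dv T ` T)"
        by (rule compact_imp_bounded[OF compact_continuous_image[OF continuous_on_subset[OF dvc[OF that]] mesh_compact[OF that]]]) simp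
      then show ?thesis by (simp add: bounded_iff)
    qed
    then have "\<forall>T\<in>\<T>. \<exists>M. \<forall>x\<in>T. norm (dv T x) \<le> M" by (intro ballI)
    from bchoice[OF this] obtain M where M: "\<forall>T\<in>\<T>. \<forall>x\<in>T. norm (dv T x) \<le> M T" by (rule exE)
    have bound: "norm (g x) \<le> (\<Sum>T\<in>\<T>. \<bar>M T\<bar>)" for x
      unfolding g_def
    proof (rule sum_norm_le)
      fix T assume T: "T \<in> \<T>"
      show "norm (indicator T x *\<^sub>R dv T x) \<le> \<bar>M T\<bar>"
      proof (cases "x \<in> T")
        case True
        then have "norm (dv T x) \<le> M T" using M T by blast
        then show ?thesis using True by simp
      qed simp
    qed
    have "integrable (lebesgue_on \<Omega>) (\<lambda>x. (norm (g x))\<^sup>2)"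
    proof (rule integrableI_bounded_set[where A=\<Omega> and B="(\<Sum>T\<in>\<T>. \<bar>M T\<bar>)\<^sup>2"])
      show "\<Omega> \<in> sets (lebesgue_on \<Omega>)" using \<Omega>l by (simp add: sets_restrict_space_iff)
      show "(\<lambda>x. (norm (g x))\<^sup>2) \<in> borel_measurable (lebesgue_on \<Omega>)" using gml by measurable
      show "emeasure (lebesgue_on \<Omega>) \<Omega> < \<infinity>"
      proof -
        have "emeasure (lebesgue_on \<Omega>) \<Omega> = emeasure lebesgue \<Omega>"
          by (rule emeasure_restrict_space) (use fmeasurableD[OF \<Omega>l] in simp_all)
        then show ?thesis using fmeasurableD2[OF \<Omega>l] by (simp add: less_top)
      qed
      show "AE x in lebesgue_on \<Omega>. x \<in> \<Omega> \<longrightarrow> norm ((norm (g x))\<^sup>2) \<le> (\<Sum>T\<in>\<T>. \<bar>M T\<bar>)\<^sup>2"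
        by (rule AE_I2) (use bound in \<open>simp add: power_mono\<close>)
      show "AE x in lebesgue_on \<Omega>. x \<notin> \<Omega> \<longrightarrow> (norm (g x))\<^sup>2 = 0"
        by (rule AE_I2) simp
    qed
    then show ?thesis using gml by (simp add: L2_space_def)
  qed
  have Am: "A \<in> borel_measurable (lebesgue_on \<Omega>)" using A by (simp add: L2_space_def)
  have AP: "AE x in lebesgue. \<forall>T\<in>\<T>. x \<in> T \<inter> \<Omega> \<longrightarrow> A x = P T x"
  proof -
    have "AE x in lebesgue. x \<in> T \<inter> \<Omega> \<longrightarrow> A x = P T x" if T: "T \<in> \<T>" for T
    proof -
      have "T \<in> sets lebesgue" using borel_compact[OF mesh_compact[OF T]] by (simp add: sets_completionI_sets)
      then have "(T \<inter> \<Omega>) \<inter> space lebesgue \<in> sets lebesgue" using \<Omega>l by auto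
      from AE_restrict_space_iff[OF this] P(2)[OF T] show ?thesis by simp
    qed
    then show ?thesis using finite_mesh by (simp add: AE_finite_all)
  qed
  have "has_weak_div \<Omega> A g" unfolding has_weak_div_def
  proof (intro ballI allI)
    fix \<phi> i assume \<phi>: "\<phi> \<in> test_functions \<Omega>"
    note h\<phi> = test_function_has_grad[OF \<phi>]
    note \<phi>c = has_grad_continuous[OF h\<phi>] and \<phi>gc = has_grad_continuous_grad[OF h\<phi>]
    have sub: "\<Omega> \<subseteq> \<Union>\<T>" using \<Omega>(3) closure_subset by blast
    define W where "W T x = \<phi> x *\<^sub>R row i (P T x)" for T x
    define w where "w T b x = \<phi> x *\<^sub>R (\<Sum>j\<in>UNIV. (b $ j) *\<^sub>R \<gamma> T i j x) + (row i (P T x) \<bullet> b) *\<^sub>R gradient \<phi> x" for T b x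
    have WG: "W T x \<bullet> u = \<phi> x * (P T x *v u) $ i" for T x u by (simp add: W_def row_inner)
    have div0: "(\<Sum>T\<in>\<T>. LINT x:T|lborel. \<Sum>b\<in>Basis. w T b x \<bullet> b) = 0"
    proof (rule mesh_divergence[where V=W])
      fix T assume T: "T \<in> \<T>"
      show "smooth_field (W T) (w T)" unfolding smooth_field_def
      proof
        fix b :: "real^'n"
        have "has_grad (\<lambda>x. \<phi> x * (row i (P T x) \<bullet> b)) (w T b)" unfolding w_def
          by (rule has_grad_mult[OF h\<phi> has_grad_row_inner[OF \<gamma>[OF T]]])
        then show "has_grad (\<lambda>x. W T x \<bullet> b) (w T b)" by (simp add: W_def)
      qed
    next
      fix T T' v v' x
      assume h: "T \<in> \<T>" "T' \<in> \<T>" "T \<noteq> T'" "v \<in> Cs T" "v' \<in> Cs T'" "facet T v = facet T' v'" "x \<in> facet T v"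
      show "W T x \<bullet> Gs T v = W T' x \<bullet> Gs T v" unfolding WG normal[OF h] ..
    next
      fix T v x
      assume T: "T \<in> \<T>" "v \<in> Cs T"
        and nb: "\<not> (\<exists>T'\<in>\<T>. T' \<noteq> T \<and> (\<exists>v'\<in>Cs T'. facet T v = facet T' v'))" and x: "x \<in> facet T v"
      interpret aff: affine_coords "Cs T" "Gs T" "cs T" by (rule coords[OF T(1)])
      \<comment> \<open>A relative interior point with a nonzero value would lie in \<Omega>, hence
        in the interior of the mesh, and the facet would be shared; continuity covers the rest of
        the facet.\<close>
      have "\<phi> x = 0"
      proof (rule continuous_zero_on_rel_interior[where K="facet T v" and g=\<phi>])
        show "convex (facet T v)" unfolding facet_def by (rule convex_convex_hull)
        show "closed (facet T v)" unfolding facet_def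
          by (rule compact_imp_closed[OF aff.compact_face[OF Diff_subset]])
        show "continuous_on (facet T v) \<phi>" by (rule \<phi>c)
        show "\<phi> y = 0" if y: "y \<in> rel_interior (facet T v)" for y
        proof (rule ccontr)
          assume "\<phi> y \<noteq> 0"
          then have "y \<in> \<Omega>" using test_function_outside(1)[OF \<phi>] by blast
          then have "y \<in> interior (\<Union>\<T>)" using interior_maximal[OF sub \<Omega>(1)] by blast
          from interior_facet_shared[OF T y this] nb show False by contradiction
        qed
      qed (rule x)
      then show "W T x \<bullet> Gs T v = 0" by (simp add: W_def)
    qed
    have wdv: "(\<Sum>b\<in>Basis. w T b x \<bullet> b) = \<phi> x * dv T x $ i + row i (P T x) \<bullet> gradient \<phi> x" for T x
      unfolding w_def by (subst divergence_of_product) (simp add: dv_def)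
    have c1: "continuous_on UNIV (\<lambda>x. \<phi> x * dv T x $ i)" if "T \<in> \<T>" for T
      by (intro continuous_intros \<phi>c dvc[OF that])
    have rowc: "continuous_on UNIV (\<lambda>x. row i (P T x))" if "T \<in> \<T>" for T
      unfolding row_def by (intro continuous_on_vec_lambda continuous_on_component Pc[OF that])
    have c2: "continuous_on UNIV (\<lambda>x. row i (P T x) \<bullet> gradient \<phi> x)" if "T \<in> \<T>" for T
      by (intro continuous_on_inner \<phi>gc rowc[OF that])
    have "(LINT x|lebesgue_on \<Omega>. row i (A x) \<bullet> gradient \<phi> x) =
      (\<Sum>T\<in>\<T>. LINT x:T|lborel. row i (P T x) \<bullet> gradient \<phi> x)"
    proof (rule integral_over_mesh[OF \<Omega>(1) sub c2])
      have "(\<lambda>B::real^'n^'n. row i B) \<in> borel_measurable borel"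
        unfolding row_def
        by (intro borel_measurable_continuous_onI continuous_on_vec_lambda continuous_on_component continuous_on_id)
      then have "(\<lambda>x. row i (A x)) \<in> borel_measurable (lebesgue_on \<Omega>)" by (rule measurable_compose[OF Am])
      moreover have "gradient \<phi> \<in> borel_measurable (lebesgue_on \<Omega>)"
        by (rule measurable_restrict_space1)
           (use borel_measurable_continuous_onI[OF \<phi>gc] in \<open>simp add: measurable_completion\<close>)
      ultimately show "(\<lambda>x. row i (A x) \<bullet> gradient \<phi> x) \<in> borel_measurable (lebesgue_on \<Omega>)"
        by (rule borel_measurable_inner)
      show "AE x in lebesgue. x \<in> \<Omega> \<longrightarrow> (\<forall>T\<in>\<T>. x \<in> T \<longrightarrow> row i (A x) \<bullet> gradient \<phi> x = row i (P T x) \<bullet> gradient \<phi> x)"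
        using AP by eventually_elim auto
    qed (simp_all add: test_function_outside(2)[OF \<phi>])
    moreover have "(LINT x|lebesgue_on \<Omega>. g x $ i * \<phi> x) = (\<Sum>T\<in>\<T>. LINT x:T|lborel. \<phi> x * dv T x $ i)"
    proof (rule integral_over_mesh[OF \<Omega>(1) sub c1])
      have "(\<lambda>x. g x $ i) \<in> borel_measurable (lebesgue_on \<Omega>)"
        by (rule measurable_compose[OF gml]) (intro borel_measurable_continuous_onI continuous_on_component continuous_on_id)
      moreover have "\<phi> \<in> borel_measurable (lebesgue_on \<Omega>)"
        by (rule measurable_restrict_space1)
           (use borel_measurable_continuous_onI[OF \<phi>c] in \<open>simp add: measurable_completion\<close>)
      ultimately show "(\<lambda>x. g x $ i * \<phi> x) \<in> borel_measurable (lebesgue_on \<Omega>)"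
        by (rule borel_measurable_times)
      show "AE x in lebesgue. x \<in> \<Omega> \<longrightarrow> (\<forall>T\<in>\<T>. x \<in> T \<longrightarrow> g x $ i * \<phi> x = \<phi> x * dv T x $ i)"
        using AE_not_frontier
      proof eventually_elim
        case (elim x)
        have "g x = dv T x" if T: "T \<in> \<T>" "x \<in> T" for T
        proof -
          have "(\<Sum>T'\<in>\<T>. indicator T' x *\<^sub>R dv T' x) = (\<Sum>T'\<in>{T}. indicator T' x *\<^sub>R dv T' x)"
          proof (rule sum.mono_neutral_right[OF finite_mesh])
            show "\<forall>T'\<in>\<T> - {T}. indicator T' x *\<^sub>R dv T' x = 0"
            proof
              fix T' assume T': "T' \<in> \<T> - {T}"
              then have "x \<notin> T'" using unique_simplex[OF elim T, of T'] by blast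
              then show "indicator T' x *\<^sub>R dv T' x = 0" by simp
            qed
          qed (use T in simp)
          then show ?thesis using T by (simp add: g_def)
        qed
        then show ?case by simp
      qed
    qed (simp_all add: test_function_outside(1)[OF \<phi>])
    moreover have "(\<Sum>T\<in>\<T>. LINT x:T|lborel. \<phi> x * dv T x $ i) +
      (\<Sum>T\<in>\<T>. LINT x:T|lborel. row i (P T x) \<bullet> gradient \<phi> x) = 0"
    proof -
      have "(\<Sum>T\<in>\<T>. LINT x:T|lborel. \<phi> x * dv T x $ i) +
        (\<Sum>T\<in>\<T>. LINT x:T|lborel. row i (P T x) \<bullet> gradient \<phi> x) =
        (\<Sum>T\<in>\<T>. LINT x:T|lborel. \<phi> x * dv T x $ i + row i (P T x) \<bullet> gradient \<phi> x)"
        unfolding sum.distrib[symmetric]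
      proof (rule sum.cong[OF refl])
        fix T assume T: "T \<in> \<T>"
        have "set_integrable lborel T f" if "continuous_on UNIV f" for f :: "real^'n \<Rightarrow> real"
          unfolding set_integrable_def
          by (rule borel_integrable_compact[OF mesh_compact[OF T] continuous_on_subset[OF that]]) simp
        from set_integral_add(2)[OF this[OF c1[OF T]] this[OF c2[OF T]]]
        show "(LINT x:T|lborel. \<phi> x * dv T x $ i) + (LINT x:T|lborel. row i (P T x) \<bullet> gradient \<phi> x) =
          (LINT x:T|lborel. \<phi> x * dv T x $ i + row i (P T x) \<bullet> gradient \<phi> x)" by simp
      qed
      then show ?thesis using div0 unfolding wdv by simp
    qed
    ultimately show "(LINT x|lebesgue_on \<Omega>. row i (A x) \<bullet> gradient \<phi> x) = - (LINT x|lebesgue_on \<Omega>. g x $ i * \<phi> x)"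
      by simp
  qed
  then show ?thesis unfolding H_div_def using A g2 by blast
qed

section \<open>The finite element space\<close>

lemma mesh_coords_exist:
  fixes \<T> :: "'a::euclidean_space set set"
  assumes "conforming_mesh \<Omega> \<T>"
  obtains Cs Gs cs where "mesh_coords \<T> Cs Gs cs"
proof -
  have tri: "triangulation \<T>" and simp: "\<forall>T\<in>\<T>. int DIM('a) simplex T"
    using assms by (simp_all add: conforming_mesh_def)
  have "\<forall>T\<in>\<T>. \<exists>z. affine_coords (fst z) (fst (snd z)) (snd (snd z)) \<and> T = convex hull (fst z)"
  proof
    fix T assume "T \<in> \<T>"
    then have "int DIM('a) simplex T" using simp by blast
    then obtain C where C: "\<not> affine_dependent C" "int (card C) = int DIM('a) + 1" "T = convex hull C"
      unfolding simplex_def by (elim exE conjE)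
    from C(2) have "card C = DIM('a) + 1" by simp
    from affine_coords_exist[OF C(1) this] obtain G c where "affine_coords C G c" .
    then show "\<exists>z. affine_coords (fst z) (fst (snd z)) (snd (snd z)) \<and> T = convex hull (fst z)"
      using C(3) by (intro exI[of _ "(C, G, c)"]) simp
  qed
  from bchoice[OF this] obtain f where
    f: "\<forall>T\<in>\<T>. affine_coords (fst (f T)) (fst (snd (f T))) (snd (snd (f T))) \<and> T = convex hull (fst (f T))"
    by (rule exE)
  have "mesh_coords \<T> (\<lambda>T. fst (f T)) (\<lambda>T. fst (snd (f T))) (\<lambda>T. snd (snd (f T)))"
    by (rule mesh_coords.intro[OF tri]) (rule f[rule_format, THEN conjunct1] f[rule_format, THEN conjunct2]; assumption)+
  then show thesis by (rule that)
qed

lemma mesh_subsimplicesI: "T \<in> \<T> \<Longrightarrow> f \<in> subsimplices l T \<Longrightarrow> f \<in> mesh_subsimplices l \<T>"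
  unfolding mesh_subsimplices_def by blast

theorem theorem4p3:
  fixes \<Omega> :: "(real^'n) set" and \<T> :: "(real^'n) set set" and m r :: nat
    and nf :: "(real^'n) set \<Rightarrow> nat \<Rightarrow> real^'n" and nF :: "(real^'n) set \<Rightarrow> real^'n"
  assumes "CARD('n) \<ge> 2" and "m \<le> CARD('n) - 2" and "r \<ge> 1"
    and "bounded_domain \<Omega>" and "conforming_mesh \<Omega> \<T>"
    and "\<And>l f. l \<le> m \<Longrightarrow> f \<in> mesh_subsimplices l \<T> \<Longrightarrow>
           (\<forall>i\<in>{1..CARD('n) - l}. normal_vector f (nf f i)) \<and>
           inj_on (nf f) {1..CARD('n) - l} \<and> independent (nf f ` {1..CARD('n) - l})"
    and "\<And>F. F \<in> mesh_subsimplices (CARD('n) - 1) \<T> \<Longrightarrow> normal_vector F (nF F)"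
  shows "(\<forall>T\<in>\<T>. unisolvent m r nf nF T) \<and> fe_space m r nf nF \<Omega> \<T> \<subseteq> H_div \<Omega> trace_free"
proof
  obtain Cs Gs cs where mesh: "mesh_coords \<T> Cs Gs cs" using assms(5) by (rule mesh_coords_exist)
  interpret mesh_coords \<T> Cs Gs cs by fact
  have face: "convex hull E \<in> subsimplices l T" if "T \<in> \<T>" "E \<subseteq> Cs T" "card E = l + 1" for T E l
    using affine_coords.subsimplicesI[OF coords[OF that(1)] subset_refl that(2,3)] hull[OF that(1)] by simp
  have facet: "facet T v \<in> subsimplices (CARD('n) - 1) T" if "T \<in> \<T>" "v \<in> Cs T" for T v
  proof -
    have "facet T v \<in> subsimplices (DIM(real^'n) - 1) (convex hull (Cs T))"
      unfolding affine_coords.facets_iff[OF coords[OF that(1)]] facet_def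
      by (rule bexI[OF refl that(2)])
    then show ?thesis using hull[OF that(1)] by simp
  qed
  have nf: "(\<forall>i\<in>{1..CARD('n) - l}. normal_vector (convex hull E) (nf (convex hull E) i)) \<and>
      inj_on (nf (convex hull E)) {1..CARD('n) - l} \<and> independent (nf (convex hull E) ` {1..CARD('n) - l})"
    if "T \<in> \<T>" "l \<le> m" "E \<subseteq> Cs T" "card E = l + 1" for T l E
    by (rule assms(6)[OF that(2) mesh_subsimplicesI[OF that(1) face[OF that(1,3,4)]]])
  have nF: "normal_vector (facet T v) (nF (facet T v))" if "T \<in> \<T>" "v \<in> Cs T" for T v
    by (rule assms(7)[OF mesh_subsimplicesI[OF that(1) facet[OF that]]])
  show "\<forall>T\<in>\<T>. unisolvent m r nf nF T"
  proof
    fix T assume T: "T \<in> \<T>"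
    have "unisolvent m r nf nF (convex hull (Cs T))"
      by (rule unisolvent_simplex[OF coords[OF T] assms(1-3)])
         (rule nf[OF T] nF[OF T, unfolded facet_def]; assumption)+
    then show "unisolvent m r nf nF T" using hull[OF T] by simp
  qed
  have \<Omega>: "open \<Omega>" "bounded \<Omega>" "\<Union>\<T> = closure \<Omega>"
    using assms(4,5) by (simp_all add: bounded_domain_def conforming_mesh_def)
  show "fe_space m r nf nF \<Omega> \<T> \<subseteq> H_div \<Omega> trace_free"
  proof
    fix A assume A: "A \<in> fe_space m r nf nF \<Omega> \<T>"
    then have L2: "A \<in> L2_space \<Omega> trace_free" by (simp add: fe_space_def)
    from A obtain p where
      p: "\<forall>T\<in>\<T>. p T \<in> poly_space (int r) T trace_free \<and> (AE x in lebesgue_on (T \<inter> \<Omega>). A x = p T x)"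
      and vert: "\<forall>v. {v} \<in> mesh_subsimplices 0 \<T> \<longrightarrow>
            (\<forall>T\<in>\<T>. \<forall>T'\<in>\<T>. v \<in> T \<and> v \<in> T' \<longrightarrow> p T v = p T' v)"
      and low: "\<forall>l\<in>{1..m}. \<forall>f\<in>mesh_subsimplices l \<T>. \<forall>T\<in>\<T>. \<forall>T'\<in>\<T>. f \<subseteq> T \<and> f \<subseteq> T' \<longrightarrow>
            (\<forall>i\<in>{1..CARD('n) - l}. \<forall>q\<in>moment_space r l f.
               normal_moment f (nf f i) (p T) q = normal_moment f (nf f i) (p T') q)"
      and high: "\<forall>F\<in>mesh_subsimplices (CARD('n) - 1) \<T>. \<forall>T\<in>\<T>. \<forall>T'\<in>\<T>. F \<subseteq> T \<and> F \<subseteq> T' \<longrightarrow>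
            (\<forall>l\<in>{m+1..CARD('n) - 1}. \<forall>f\<in>subsimplices l F. \<forall>q\<in>moment_space r l f.
               normal_moment f (nF F) (p T) q = normal_moment f (nF F) (p T') q)"
      unfolding fe_space_def mem_Collect_eq by (elim conjE exE)
    \<comment> \<open>Members of \<open>poly_space\<close> are cut off to zero outside
      \<open>T\<close>; differentiation and the cutoff limits need polynomials on the whole
      space.\<close>
    have "\<exists>P. deg_below (r + 1) P \<and> (\<forall>x\<in>T. P x = p T x)" if T: "T \<in> \<T>" for T
    proof -
      have "p T \<in> poly_space (int r) T trace_free" using p T by blast
      then obtain P where "deg_below (r + 1) P" "\<forall>x\<in>T. P x = p T x" "\<forall>x\<in>T. P x \<in> trace_free"
        by (rule poly_space_deg_belowE)
      then show ?thesis by (intro exI[of _ P] conjI)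
    qed
    then have "\<forall>T\<in>\<T>. \<exists>P. deg_below (r + 1) P \<and> (\<forall>x\<in>T. P x = p T x)" by (intro ballI)
    from bchoice[OF this] obtain P where P: "\<forall>T\<in>\<T>. deg_below (r + 1) (P T) \<and> (\<forall>x\<in>T. P T x = p T x)"
      by (rule exE)
    have deg: "deg_below (r + 1) (P T)" if "T \<in> \<T>" for T using P that by blast
    have Pp: "P T x = p T x" if "T \<in> \<T>" "x \<in> T" for T x using P that by blast
    show "A \<in> H_div \<Omega> trace_free"
    proof (rule piecewise_polynomial_H_div[OF mesh \<Omega> L2 deg])
      fix T assume T: "T \<in> \<T>"
      have "AE x in lebesgue_on (T \<inter> \<Omega>). A x = p T x" using p T by blast
      moreover have "AE x in lebesgue_on (T \<inter> \<Omega>). x \<in> T" by (rule AE_I2) simp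
      ultimately show "AE x in lebesgue_on (T \<inter> \<Omega>). A x = P T x"
        by eventually_elim (simp add: Pp[OF T])
    next
      fix T T' v v' x
      assume T: "T \<in> \<T>" "T' \<in> \<T>" "T \<noteq> T'" and v: "v \<in> Cs T" "v' \<in> Cs T'"
        and F: "facet T v = facet T' v'" and x: "x \<in> facet T v"
      interpret aff: affine_coords "Cs T" "Gs T" "cs T" by (rule coords[OF T(1)])
      have D: "Cs T - {v} = Cs T' - {v'}" by (rule shared_facet_vertices[OF T(1,2) F])
      have sub: "convex hull E \<subseteq> T" "convex hull E \<subseteq> T'" if "E \<subseteq> Cs T - {v}" for E
      proof -
        have "E \<subseteq> Cs T" "E \<subseteq> Cs T'" using that D by blast+
        then show "convex hull E \<subseteq> T" "convex hull E \<subseteq> T'"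
          using hull_mono[of E "Cs T" convex] hull_mono[of E "Cs T'" convex] hull[OF T(1)] hull[OF T(2)] by simp_all
      qed
      \<comment> \<open>The jump is itself a polynomial on the whole space, so
        \<open>facet_trace_zero\<close> applies to it with the coordinates of \<open>T\<close>;
        single-valuedness makes its data on the shared facet vanish.\<close>
      define B where "B = (\<lambda>x. P T x - P T' x)"
      have degB: "deg_below (r + 1) B" unfolding B_def by (rule deg_below_diff[OF deg[OF T(1)] deg[OF T(2)]])
      have moment: "normal_moment f \<nu> B q = normal_moment f \<nu> (p T) q - normal_moment f \<nu> (p T') q"
        if E: "E \<subseteq> Cs T - {v}" "f = convex hull E" and q: "q \<in> moment_space r l f" for E f \<nu> l q
      proof -
        have comp: "compact f" unfolding E(2) by (rule aff.compact_face) (use E(1) in blast)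
        have "normal_moment f \<nu> B q = normal_moment f \<nu> (\<lambda>x. P T x + (-1) *\<^sub>R P T' x) q"
          by (simp add: B_def)
        also have "\<dots> = normal_moment f \<nu> (P T) q + (-1) * normal_moment f \<nu> (P T') q"
          by (rule normal_moment_add_scale_field[OF comp deg_below_continuous[OF deg[OF T(1)]]
                deg_below_continuous[OF deg[OF T(2)]] poly_space_continuous[OF q]])
        also have "normal_moment f \<nu> (P T) q = normal_moment f \<nu> (p T) q"
          by (rule normal_moment_cong[OF comp]) (use Pp[OF T(1)] sub(1)[OF E(1)] E(2) in blast)
        also have "normal_moment f \<nu> (P T') q = normal_moment f \<nu> (p T') q"
          by (rule normal_moment_cong[OF comp]) (use Pp[OF T(2)] sub(2)[OF E(1)] E(2) in blast)
        finally show ?thesis by simp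
      qed
      have "B x *v Gs T v = 0"
      proof (rule facet_trace_zero[OF coords[OF T(1)] v(1) degB _ _ _ _ _ x[unfolded facet_def]])
        show "(\<forall>i\<in>{1..CARD('n) - l}. normal_vector (convex hull E) (nf (convex hull E) i)) \<and>
          inj_on (nf (convex hull E)) {1..CARD('n) - l} \<and> independent (nf (convex hull E) ` {1..CARD('n) - l})"
          if "1 \<le> l" "l \<le> m" "E \<subseteq> Cs T" "card E = l + 1" for l E
          by (rule nf[OF T(1) that(2-4)])
        show "normal_vector (convex hull (Cs T - {v})) (nF (facet T v))"
          using nF[OF T(1) v(1)] by (simp add: facet_def)
        show "B w = 0" if w: "w \<in> Cs T - {v}" for w
        proof -
          have "convex hull {w} \<in> subsimplices 0 T" by (rule face[OF T(1)]) (use w in auto)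
          then have "{w} \<in> mesh_subsimplices 0 \<T>" using mesh_subsimplicesI[OF T(1)] by simp
          moreover have wT: "w \<in> T" "w \<in> T'" using sub[of "{w}"] w by auto
          ultimately have "p T w = p T' w" using vert T(1,2) by blast
          then show ?thesis by (simp add: B_def Pp[OF T(1) wT(1)] Pp[OF T(2) wT(2)])
        qed
        show "normal_moment (convex hull E) (nf (convex hull E) i) B q = 0"
          if h: "1 \<le> l" "l \<le> m" "E \<subseteq> Cs T - {v}" "card E = l + 1" "i \<in> {1..CARD('n) - l}"
            "q \<in> moment_space r l (convex hull E)" for l E i q
        proof -
          have l: "l \<in> {1..m}" using h(1,2) by simp
          have f: "convex hull E \<in> mesh_subsimplices l \<T>"
            by (rule mesh_subsimplicesI[OF T(1) face[OF T(1) _ h(4)]]) (use h(3) in blast)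
          have "normal_moment (convex hull E) (nf (convex hull E) i) (p T) q =
            normal_moment (convex hull E) (nf (convex hull E) i) (p T') q"
            by (rule low[rule_format, OF l f T(1,2) conjI[OF sub[OF h(3)]] h(5,6)])
          then show ?thesis unfolding moment[OF h(3) refl h(6)] by simp
        qed
        show "normal_moment (convex hull E) (nF (facet T v)) B q = 0"
          if h: "m + 1 \<le> l" "l \<le> CARD('n) - 1" "E \<subseteq> Cs T - {v}" "card E = l + 1"
            "q \<in> moment_space r l (convex hull E)" for l E q
        proof -
          have l: "l \<in> {m+1..CARD('n) - 1}" using h(1,2) by simp
          have FM: "facet T v \<in> mesh_subsimplices (CARD('n) - 1) \<T>"
            by (rule mesh_subsimplicesI[OF T(1) facet[OF T(1) v(1)]])
          have f: "convex hull E \<in> subsimplices l (facet T v)"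
            unfolding facet_def by (rule aff.subsimplicesI[OF Diff_subset h(3,4)])
          have FT: "facet T v \<subseteq> T \<and> facet T v \<subseteq> T'"
            using sub[OF subset_refl] by (simp add: facet_def)
          have "normal_moment (convex hull E) (nF (facet T v)) (p T) q =
            normal_moment (convex hull E) (nF (facet T v)) (p T') q"
            by (rule high[rule_format, OF FM T(1,2) FT l f h(5)])
          then show ?thesis unfolding moment[OF h(3) refl h(5)] by simp
        qed
      qed
      then show "P T x *v Gs T v = P T' x *v Gs T v"
        by (simp add: B_def matrix_vector_mult_diff_rdistrib)
    qed
  qed
qed

end
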